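(* Let $T$ be a triangulation of a polygon and let $\gamma=(a,b)$ be its unique longest arc (crossing all diagonals of $T$). Let $G=G_\gamma$ be the corresponding labelled snake graph. Then there is a weight-preserving bijection between the set $\mathcal T_{a,b}$ of twisted super $T$-paths from $a$ to $b$ and the set $D(G)$ of double dimer covers of $G$; that is, a bijection $t\mapsto M$ with $$\mathrm{twt}(t)=\frac{\mathrm{wt}(M)}{\mathrm{cross}(\gamma)}.$$
   Context: **Triangulation.** Let $T$ have $n\ge2$ triangles; draw the polygon with $a$ at the bottom and $b$ at the top. Let $x_1,\dots,x_{n-1}$ be the diagonals in the order crossed by $\gamma$ from $a$ to $b$, $\Delta_1,\dots,\Delta_n$ the triangles in the order met; $\Delta_m$ carries an odd variable $\theta_m$. Each edge of $T$ carries a commuting even variable denoted by the same symbol; odd variables anticommute and square to zero; square roots and inverses of even variables are adjoined. $\mathrm{cross}(\gamma)=x_1\cdots x_{n-1}$. **Fan centers, default orientation, positive order.** For $2\le m\le n-1$ the fan center of $\Delta_m$ is the common vertex of $x_{m-1}$ and $x_m$; $\Delta_1$ and $\Delta_n$ have the same fan center as $\Delta_2$ and $\Delta_{n-1}$ respectively (if $n=2$, a chosen endpoint of $x_1$ is the only fan center). Let $c_1,\dots,c_N$ be the distinct fan centers in order from $a$ to $b$. Default orientation (assumed): the diagonal joining $c_s,c_{s+1}$ is oriented $c_s\to c_{s+1}$; every other diagonal is oriented away from the fan center which is its endpoint. Positive order: for each $m<n$, if $x_m$ is oriented so that $\Delta_m$ is on its right, then $\theta_m>\theta_s$ for all $s>m$;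 otherwise $\theta_m<\theta_s$ for all $s>m$. Products of odd variables in the positive order are written left to right with decreasing variables. **Twisted auxiliary graph $\Gamma_T^{a,b}$.** Take the graph of $T$ and add, for each triangle $\Delta_m$, a face-center vertex (also called $\theta_m$) lying on the arc $(a,b)$. Of the two vertices of $\Delta_m$ other than its fan center, one is closer to $a$ and the other closer to $b$: for $m\ge2$ the one closer to $a$ is the endpoint of $x_{m-1}$ different from the fan center, and for $m=1$ it is $a$; for $m\le n-1$ the one closer to $b$ is the endpoint of $x_m$ different from the fan center, and for $m=n$ it is $b$. Add an edge $\sigma_m^A$ joining $\theta_m$ to the vertex closer to $a$, and an edge $\sigma^B_m$ joining $\theta_m$ to the vertex closer to $b$ (these edges form the set $\sigma$). For $p<q$ add an edge $\tau_{pq}$ joining $\theta_p$ and $\theta_q$ (these form the set $\tau$). **Twisted super $T$-paths.** A twisted super $T$-path from $a$ to $b$ is a sequence $t=(a_0,\dots,a_{\ell}\mid t_1,\dots,t_\ell)$ such that: (T1) $a=a_0,a_1,\dots,a_\ell=b$ are vertices of $\Gamma_T^{a,b}$; (T2) $t_s$ is an edge of $\Gamma_T^{a,b}$ connecting $a_{s-1}$ and $a_s$; (T3) $t_s\ne t_r$ if $s\neq r$; (T4) $\ell$ is odd; (T5') $t_s$ crosses $(a,b)$ if $s$ is even, where $\tau$-edges are considered to cross $(a,b)$, and any step along a $\tau$-edge must end further from $a$ and closer to $b$; (T6') $t_s\in\sigma$ only if $s$ is odd, $t_s\in\tau$ only if $s$ is even; (T7) if $s<r$ and both $t_s,t_r$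 cross $(a,b)$, then $t_s\cap(a,b)$ is closer to $a$ than $t_r\cap(a,b)$ (where $\tau_{pq}\cap(a,b)$ is the segment of $(a,b)$ between the face centers $\theta_p$ and $\theta_q$). The set of these is $\mathcal T_{a,b}$. **Twisted weights.** For an edge $t_s\in T$ with $\lambda$-length $x$: $\mathrm{twt}(t_s)=x$ if $s$ is odd, $x^{-1}$ if $s$ is even. For a $\sigma$-edge joining a vertex $v$ of a triangle to its face center with odd variable $\theta$: $\mathrm{twt}=\sqrt{yz/w}\,\theta$, where $y,z$ are the sides of the triangle at $v$ and $w$ is the opposite side. For $\tau$-edges, $\mathrm{twt}=1$. $\mathrm{twt}(t)$ is the product over all $t_s$, with odd variables written in the positive order. **Labelled snake graph $G_\gamma$.** One square tile $T_m$ for each $x_m$. Let $x_m=(p,q)$ with $p$ left of $\gamma$ and $q$ right, $u$ the third vertex of $\Delta_m$, $v$ the third vertex of $\Delta_{m+1}$. If $m$ is odd, the left, bottom, top, right sides of $T_m$ are labelled $(u,p),(u,q),(p,v),(q,v)$; if $m$ is even, $(u,q),(u,p),(q,v),(p,v)$. The bottom-left corner of $T_m$ carries $\theta_m$, its top-right corner $\theta_{m+1}$. The third side of $\Delta_{m+1}$ (other than $x_m,x_{m+1}$) labels the right or top side of $T_m$; accordingly $T_{m+1}$ is attached to the right of, or on top of, $T_m$, glued along the side with this label. **Double dimer covers.** $D(G)$ is the set of multisets $M$ of edges of $G$ such that every vertex is incident to exactly two elements of $M$ (possibly two copies of one edge). Edges used once form cycles; a cycle surrounding tiles $T_s,\dots,T_t$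 has weight $\theta_s\theta_{t+1}$. $\mathrm{wt}(M)$ is the product of the square roots of the labels of all elements of $M$ (with multiplicity) times the product of cycle weights, all odd variables written in the positive order. *)

theory Defs
  imports Complex_Main "HOL-Library.Multiset" "HOL-Library.Poly_Mapping"
begin

section \<open>The superalgebra\<close>

text \<open>
  The Grassmann algebra over a commutative ring \<open>'a\<close> with odd generators indexed by the
  natural numbers.  An element is given by its coefficients with respect to the basis of
  monomials \<open>\<theta>\<^sub>S = \<theta>\<^sub>i\<^sub>1 \<theta>\<^sub>i\<^sub>2 \<dots>\<close>, where \<open>S = {i\<^sub>1 < i\<^sub>2 < \<dots>}\<close> is a finite set of indices.
\<close>

typedef (overloaded) 'a grassmann =
  "{f :: nat set \<Rightarrow> 'a::zero. finite {S. f S \<noteq> 0} \<and> (\<forall>S. f S \<noteq> 0 \<longrightarrow> finite S)}"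
  morphisms gcoeff Abs_grassmann
  by (rule exI[of _ "\<lambda>_. 0"]) simp

setup_lifting type_definition_grassmann

text \<open>\<open>\<theta>\<^sub>A \<theta>\<^sub>B = gsign A B \<theta>\<^bsub>A \<union> B\<^esub>\<close> for disjoint \<open>A\<close> and \<open>B\<close>: one sign for every inversion.\<close>

definition gsign :: "nat set \<Rightarrow> nat set \<Rightarrow> 'a::comm_ring_1" where
  "gsign A B = (-1) ^ card {(i, j). i \<in> A \<and> j \<in> B \<and> j < i}"

lemma gsign_empty [simp]: "gsign {} B = 1" "gsign A {} = 1"
  by (simp_all add: gsign_def)

lemma gsign_Un_left:
  assumes "finite A" "finite B" "finite C" "A \<inter> B = {}"
  shows "gsign (A \<union> B) C = (gsign A C * gsign B C :: 'a::comm_ring_1)"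
proof -
  let ?I = "\<lambda>A B. {(i, j). i \<in> A \<and> j \<in> B \<and> j < (i::nat)}"
  have "?I (A \<union> B) C = ?I A C \<union> ?I B C" "?I A C \<inter> ?I B C = {}"
    using assms(4) by auto
  moreover have "finite (?I A C)" "finite (?I B C)"
    using assms by (auto intro: finite_subset[of _ "A \<times> C"] finite_subset[of _ "B \<times> C"])
  ultimately have "card (?I (A \<union> B) C) = card (?I A C) + card (?I B C)"
    by (simp add: card_Un_disjoint)
  then show ?thesis
    by (simp add: gsign_def power_add)
qed

lemma gsign_Un_right:
  assumes "finite A" "finite B" "finite C" "B \<inter> C = {}"
  shows "gsign A (B \<union> C) = (gsign A B * gsign A C :: 'a::comm_ring_1)"
proof -
  let ?I = "\<lambda>A B. {(i, j). i \<in> A \<and> j \<in> B \<and> j < (i::nat)}"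
  have "?I A (B \<union> C) = ?I A B \<union> ?I A C" "?I A B \<inter> ?I A C = {}"
    using assms(4) by auto
  moreover have "finite (?I A B)" "finite (?I A C)"
    using assms by (auto intro: finite_subset[of _ "A \<times> B"] finite_subset[of _ "A \<times> C"])
  ultimately have "card (?I A (B \<union> C)) = card (?I A B) + card (?I A C)"
    by (simp add: card_Un_disjoint)
  then show ?thesis
    by (simp add: gsign_def power_add)
qed

definition gmult :: "(nat set \<Rightarrow> 'a::comm_ring_1) \<Rightarrow> (nat set \<Rightarrow> 'a) \<Rightarrow> nat set \<Rightarrow> 'a" where
  "gmult f g S =
     (if finite S then (\<Sum>A\<in>Pow S. gsign A (S - A) * f A * g (S - A)) else 0)"

lemma gmult_assoc: "gmult (gmult f g) h = gmult f (gmult g h)"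
proof
  fix S :: "nat set"
  show "gmult (gmult f g) h S = gmult f (gmult g h) S"
  proof (cases "finite S")
    case True
    have fin: "finite A" if "A \<subseteq> S" for A
      using that True by (rule finite_subset)
    have "gmult (gmult f g) h S =
        (\<Sum>A\<in>Pow S. \<Sum>B\<in>Pow A.
           gsign A (S - A) * gsign B (A - B) * f B * g (A - B) * h (S - A))"
      using True
      by (auto simp: gmult_def sum_distrib_left sum_distrib_right fin mult_ac intro!: sum.cong)
    also have "\<dots> = (\<Sum>(A, B)\<in>(SIGMA A:Pow S. Pow A).
           gsign A (S - A) * gsign B (A - B) * f B * g (A - B) * h (S - A))"
      by (rule sum.Sigma) (use True fin in auto)
    also have "\<dots> = (\<Sum>(B, C)\<in>(SIGMA B:Pow S. Pow (S - B)).
           gsign B (S - B) * gsign C (S - B - C) * f B * g C * h (S - B - C))"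
    proof (rule sum.reindex_bij_witness[where
          i = "\<lambda>(B, C). (B \<union> C, B)" and j = "\<lambda>(A, B). (B, A - B)"], goal_cases)
      case (5 x)
      obtain A B where x: "x = (A, B)" by fastforce
      with 5 have AB: "A \<subseteq> S" "B \<subseteq> A" by auto
      then have D: "S - B - (A - B) = S - A" "B \<union> (A - B) = A" "(A - B) \<union> (S - A) = S - B"
        by auto
      have f: "finite A" "finite B" "finite (A - B)" "finite (S - A)"
        using AB True fin by (auto intro: finite_subset)
      have "gsign A (S - A) = (gsign B (S - A) * gsign (A - B) (S - A) :: 'a)"
        using gsign_Un_left[of B "A - B" "S - A"] f D by auto
      moreover have "gsign B (S - B) = (gsign B (A - B) * gsign B (S - A) :: 'a)"
        using gsign_Un_right[of B "A - B" "S - A"] f D by auto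
      ultimately show ?case
        by (simp add: x D mult_ac)
    qed auto
    also have "\<dots> = (\<Sum>B\<in>Pow S. \<Sum>C\<in>Pow (S - B).
           gsign B (S - B) * gsign C (S - B - C) * f B * g C * h (S - B - C))"
      by (rule sum.Sigma[symmetric]) (use True in auto)
    also have "\<dots> = gmult f (gmult g h) S"
      using True by (auto simp: gmult_def sum_distrib_left mult_ac intro!: sum.cong)
    finally show ?thesis .
  qed (simp add: gmult_def)
qed

lemma gmult_nonzero:
  assumes "gmult f g S \<noteq> 0"
  shows "finite S \<and> (\<exists>A B. f A \<noteq> 0 \<and> g B \<noteq> 0 \<and> S = A \<union> B)"
proof -
  have S: "finite S"
    using assms by (auto simp: gmult_def split: if_splits)
  then have "(\<Sum>A\<in>Pow S. gsign A (S - A) * f A * g (S - A)) \<noteq> 0"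
    using assms by (simp add: gmult_def)
  then obtain A where "A \<in> Pow S" "gsign A (S - A) * f A * g (S - A) \<noteq> 0"
    by (meson sum.neutral)
  then have "f A \<noteq> 0" "g (S - A) \<noteq> 0" "S = A \<union> (S - A)"
    by auto
  with S show ?thesis by blast
qed

instantiation grassmann :: (comm_ring_1) ring_1
begin

lift_definition zero_grassmann :: "'a grassmann" is "\<lambda>_. 0"
  by simp

lift_definition one_grassmann :: "'a grassmann" is "\<lambda>S. if S = {} then 1 else 0"
  by simp

lift_definition plus_grassmann :: "'a grassmann \<Rightarrow> 'a grassmann \<Rightarrow> 'a grassmann"
  is "\<lambda>f g S. f S + g S"
proof goal_cases
  case (1 f g)
  have "{S. f S + g S \<noteq> 0} \<subseteq> {S. f S \<noteq> 0} \<union> {S. g S \<noteq> 0}" by auto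
  with 1 show ?case by (auto intro: finite_subset)
qed

lift_definition uminus_grassmann :: "'a grassmann \<Rightarrow> 'a grassmann" is "\<lambda>f S. - f S"
  by simp

lift_definition minus_grassmann :: "'a grassmann \<Rightarrow> 'a grassmann \<Rightarrow> 'a grassmann"
  is "\<lambda>f g S. f S - g S"
proof goal_cases
  case (1 f g)
  have "{S. f S - g S \<noteq> 0} \<subseteq> {S. f S \<noteq> 0} \<union> {S. g S \<noteq> 0}" by auto
  with 1 show ?case by (auto intro: finite_subset)
qed

lift_definition times_grassmann :: "'a grassmann \<Rightarrow> 'a grassmann \<Rightarrow> 'a grassmann"
  is gmult
proof goal_cases
  case (1 f g)
  have "{S. gmult f g S \<noteq> 0} \<subseteq> (\<lambda>(A, B). A \<union> B) ` ({S. f S \<noteq> 0} \<times> {S. g S \<noteq> 0})"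
    using gmult_nonzero[of f g] by fastforce
  then have "finite {S. gmult f g S \<noteq> 0}"
    by (rule finite_subset) (use 1 in auto)
  with gmult_nonzero[of f g] show ?case by auto
qed

instance
proof
  fix a b c :: "'a grassmann"
  show "a * b * c = a * (b * c)"
    by transfer (rule gmult_assoc)
  show "1 * a = a"
  proof (transfer, rule ext, goal_cases)
    case (1 f S)
    have "(\<Sum>A\<in>Pow S. gsign A (S - A) * (if A = {} then 1 else 0) * f (S - A)) =
        (\<Sum>A\<in>Pow S. if A = {} then f S else 0)"
      by (rule sum.cong) auto
    with 1 show ?case by (auto simp: gmult_def)
  qed
  show "a * 1 = a"
  proof (transfer, rule ext, goal_cases)
    case (1 f S)
    have "(\<Sum>A\<in>Pow S. gsign A (S - A) * f A * (if S - A = {} then 1 else 0)) =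
        (\<Sum>A\<in>Pow S. if A = S then f S else 0)"
      by (rule sum.cong) auto
    with 1 show ?case by (auto simp: gmult_def)
  qed
  show "(a + b) * c = a * c + b * c" "a * (b + c) = a * b + a * c"
    by (transfer, auto simp: gmult_def fun_eq_iff algebra_simps sum.distrib)+
  show "(0::'a grassmann) \<noteq> 1"
    by transfer (auto simp: fun_eq_iff)
qed (transfer, auto simp: fun_eq_iff)+

end

lift_definition gscale :: "'a::comm_ring_1 \<Rightarrow> 'a grassmann \<Rightarrow> 'a grassmann"
  is "\<lambda>c f S. c * f S"
proof goal_cases
  case (1 c f)
  have "{S. c * f S \<noteq> 0} \<subseteq> {S. f S \<noteq> 0}" by auto
  with 1 show ?case by (auto intro: finite_subset)
qed

lift_definition odd_var :: "nat \<Rightarrow> 'a::comm_ring_1 grassmann"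
  is "\<lambda>i S. if S = {i} then 1 else 0"
  by auto

lemma gmult_odd_var:
  assumes "finite S"
  shows "gmult (\<lambda>S. if S = {i} then 1 else 0) (\<lambda>S. if S = {j} then 1 else 0) S =
    (if i \<noteq> j \<and> S = {i, j} then if j < i then -1 else 1 else (0::'a::comm_ring_1))"
proof -
  have "(\<Sum>A\<in>Pow S. gsign A (S - A) * (if A = {i} then 1 else 0) *
          (if S - A = {j} then 1 else (0::'a))) =
        (\<Sum>A\<in>Pow S. if A = {i} then
          (if S - {i} = {j} then gsign {i} {j} else 0) else 0)"
    by (rule sum.cong) auto
  also have "\<dots> = (if i \<in> S \<and> S - {i} = {j} then gsign {i} {j} else 0)"
    using assms by (simp add: sum.delta)
  also have "(i \<in> S \<and> S - {i} = {j}) = (i \<noteq> j \<and> S = {i, j})"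
    by auto
  also have "gsign {i} {j} = (if j < i then -1 else (1::'a))"
  proof -
    have "{(k, l). k \<in> {i} \<and> l \<in> {j} \<and> l < k} = (if j < i then {(i, j)} else {})" by auto
    then show ?thesis by (simp add: gsign_def)
  qed
  finally show ?thesis
    using assms by (simp add: gmult_def)
qed

lemma odd_var_square: "odd_var i * odd_var i = (0 :: 'a::comm_ring_1 grassmann)"
proof (transfer, rule ext)
  fix i and S :: "nat set"
  show "gmult (\<lambda>S. if S = {i} then 1 else 0) (\<lambda>S. if S = {i} then 1 else 0) S = (0::'a)"
    using gmult_odd_var[of S i i] by (cases "finite S") (simp_all add: gmult_def)
qed

lemma odd_var_anticommute: "odd_var i * odd_var j = - (odd_var j * odd_var i :: 'a::comm_ring_1 grassmann)"
proof (transfer, rule ext)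
  fix i j and S :: "nat set"
  show "gmult (\<lambda>S. if S = {i} then 1 else 0) (\<lambda>S. if S = {j} then 1 else 0) S =
      - gmult (\<lambda>S. if S = {j} then 1 else 0) (\<lambda>S. if S = {i} then 1 else (0::'a)) S"
    using gmult_odd_var[of S i j, where ?'a = 'a] gmult_odd_var[of S j i, where ?'a = 'a]
    by (cases "finite S") (auto simp: gmult_def insert_commute)
qed

text \<open>
  Even variables are indexed by the edges of the triangulation, i.e. by two-element sets of
  polygon vertices.  The ring of even elements is the group ring of the group of exponent
  vectors; rational exponents provide the square roots and inverses of the variables.
\<close>

type_synonym even_ring = "(nat set \<Rightarrow>\<^sub>0 rat) \<Rightarrow>\<^sub>0 real"

definition var_pow :: "nat set \<Rightarrow> rat \<Rightarrow> even_ring" where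
  "var_pow e q = Poly_Mapping.single (Poly_Mapping.single e q) 1"

definition unit_inv :: "'a::comm_ring_1 \<Rightarrow> 'a" where
  "unit_inv u = (THE v. u * v = 1)"


section \<open>Triangulated polygons with a longest arc\<close>

text \<open>
  The vertices of a convex polygon are numbered \<open>0, 1, \<dots>\<close> in counterclockwise order.
  \<open>ccw u z w\<close> means that \<open>u, z, w\<close> occur in this cyclic order; equivalently, \<open>z\<close> lies
  strictly to the right of the chord directed from \<open>u\<close> to \<open>w\<close>.
\<close>

definition ccw :: "nat \<Rightarrow> nat \<Rightarrow> nat \<Rightarrow> bool" where
  "ccw u z w \<longleftrightarrow> u < z \<and> z < w \<or> z < w \<and> w < u \<or> w < u \<and> u < z"

definition crosses :: "nat set \<Rightarrow> nat set \<Rightarrow> bool" where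
  "crosses d e \<longleftrightarrow> (\<exists>i j k l. d = {i, j} \<and> e = {k, l} \<and> ccw i k j \<and> ccw j l i)"

definition polygon_sides :: "nat \<Rightarrow> nat set set" where
  "polygon_sides N = {{i, Suc i mod N} | i. i < N}"

definition polygon_diagonals :: "nat \<Rightarrow> nat set set" where
  "polygon_diagonals N = {e. e \<subseteq> {..<N} \<and> card e = 2} - polygon_sides N"

definition is_triangulation :: "nat \<Rightarrow> nat set set \<Rightarrow> bool" where
  "is_triangulation N D \<longleftrightarrow>
     D \<subseteq> polygon_diagonals N \<and>
     (\<forall>d\<in>D. \<forall>e\<in>D. \<not> crosses d e) \<and>
     (\<forall>d\<in>polygon_diagonals N. (\<forall>e\<in>D. \<not> crosses d e) \<longrightarrow> d \<in> D)"

text \<open>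
  The polygon has \<open>ntri + 2\<close> vertices.  \<open>dg m\<close> and \<open>tri m\<close> are the diagonal \<open>x\<^sub>m\<close>
  (\<open>1 \<le> m < ntri\<close>) and the triangle \<open>\<Delta>\<^sub>m\<close> (\<open>1 \<le> m \<le> ntri\<close>); other arguments are irrelevant.
  \<open>ctr\<close> is the chosen fan center, used only if \<open>ntri = 2\<close>.
\<close>

record arc_triangulation =
  ntri :: nat
  diags :: "nat set set"
  src :: nat
  tgt :: nat
  dg :: "nat \<Rightarrow> nat set"
  tri :: "nat \<Rightarrow> nat set"
  ctr :: nat

definition edges :: "arc_triangulation \<Rightarrow> nat set set" where
  "edges T = polygon_sides (ntri T + 2) \<union> diags T"

definition triangles :: "arc_triangulation \<Rightarrow> nat set set" where
  "triangles T = {t. t \<subseteq> {..<ntri T + 2} \<and> card t = 3 \<and>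
     (\<forall>e. e \<subseteq> t \<and> card e = 2 \<longrightarrow> e \<in> edges T)}"

text \<open>
  For non-crossing diagonals \<open>d\<close> and \<open>e\<close> which both cross \<open>(a,b)\<close>: no endpoint of \<open>e\<close> is on
  the same side of \<open>d\<close> as \<open>a\<close>.
\<close>

definition crossed_before :: "arc_triangulation \<Rightarrow> nat set \<Rightarrow> nat set \<Rightarrow> bool" where
  "crossed_before T d e \<longleftrightarrow> d \<noteq> e \<and> (\<forall>v\<in>e. v \<in> d \<or> crosses d {src T, v})"

definition longest_arc_triangulation :: "arc_triangulation \<Rightarrow> bool" where
  "longest_arc_triangulation T \<longleftrightarrow>
     2 \<le> ntri T \<and>
     is_triangulation (ntri T + 2) (diags T) \<and>
     src T < ntri T + 2 \<and> tgt T < ntri T + 2 \<and>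
     (\<forall>d\<in>diags T. crosses d {src T, tgt T}) \<and>
     bij_betw (dg T) {1..<ntri T} (diags T) \<and>
     (\<forall>k m. 1 \<le> k \<and> k < m \<and> m < ntri T \<longrightarrow> crossed_before T (dg T k) (dg T m)) \<and>
     bij_betw (tri T) {1..ntri T} (triangles T) \<and>
     src T \<in> tri T 1 \<and> tgt T \<in> tri T (ntri T) \<and>
     (\<forall>m. 1 \<le> m \<and> m < ntri T \<longrightarrow> tri T m \<inter> tri T (Suc m) = dg T m) \<and>
     (ntri T = 2 \<longrightarrow> ctr T \<in> dg T 1)"


section \<open>Fan centers, default orientation, positive order\<close>

definition fan_center :: "arc_triangulation \<Rightarrow> nat \<Rightarrow> nat" where
  "fan_center T m =
     (if ntri T = 2 then ctr T
      else let k = (if m = 1 then 2 else if m = ntri T then ntri T - 1 else m)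
           in THE v. v \<in> dg T (k - 1) \<inter> dg T k)"

text \<open>Triangles with the same fan center are consecutive, so the entries are distinct.\<close>

definition fan_centers :: "arc_triangulation \<Rightarrow> nat list" where
  "fan_centers T = remdups_adj (map (fan_center T) [1..<Suc (ntri T)])"

text \<open>The starting point of the diagonal \<open>x\<^sub>m\<close> in the default orientation.\<close>

definition diag_tail :: "arc_triangulation \<Rightarrow> nat \<Rightarrow> nat" where
  "diag_tail T m =
     (let cs = fan_centers T;
          joins = (\<lambda>s. Suc s < length cs \<and> dg T m = {cs ! s, cs ! Suc s})
      in if \<exists>s. joins s then cs ! (THE s. joins s)
         else THE v. v \<in> dg T m \<and> v \<in> set cs)"

definition diag_head :: "arc_triangulation \<Rightarrow> nat \<Rightarrow> nat" where
  "diag_head T m = (THE v. v \<in> dg T m \<and> v \<noteq> diag_tail T m)"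

definition tri_on_right :: "arc_triangulation \<Rightarrow> nat \<Rightarrow> bool" where
  "tri_on_right T m \<longleftrightarrow>
     ccw (diag_tail T m) (THE z. z \<in> tri T m \<and> z \<notin> dg T m) (diag_head T m)"

text \<open>\<open>\<theta>\<^sub>i > \<theta>\<^sub>j\<close> in the positive order.\<close>

definition pos_greater :: "arc_triangulation \<Rightarrow> nat \<Rightarrow> nat \<Rightarrow> bool" where
  "pos_greater T i j \<longleftrightarrow> i < j \<and> tri_on_right T i \<or> j < i \<and> \<not> tri_on_right T j"

definition pos_ordered_prod ::
    "arc_triangulation \<Rightarrow> nat multiset \<Rightarrow> even_ring grassmann" where
  "pos_ordered_prod T A =
     prod_list (map odd_var
       (THE is. mset is = A \<and> sorted_wrt (\<lambda>i j. i = j \<or> pos_greater T i j) is))"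


section \<open>Twisted super T-paths\<close>

datatype gvertex = PolyV nat | FaceC nat

datatype gedge = TEdge "nat set" | SigmaA nat | SigmaB nat | Tau nat nat

definition near_a :: "arc_triangulation \<Rightarrow> nat \<Rightarrow> nat" where
  "near_a T m =
     (if m = 1 then src T else THE v. v \<in> dg T (m - 1) \<and> v \<noteq> fan_center T m)"

definition near_b :: "arc_triangulation \<Rightarrow> nat \<Rightarrow> nat" where
  "near_b T m =
     (if m = ntri T then tgt T else THE v. v \<in> dg T m \<and> v \<noteq> fan_center T m)"

definition gvertices :: "arc_triangulation \<Rightarrow> gvertex set" where
  "gvertices T = PolyV ` {..<ntri T + 2} \<union> FaceC ` {1..ntri T}"

definition gedges :: "arc_triangulation \<Rightarrow> gedge set" where
  "gedges T = TEdge ` edges T \<union> SigmaA ` {1..ntri T} \<union> SigmaB ` {1..ntri T} \<union>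
     {Tau p q | p q. 1 \<le> p \<and> p < q \<and> q \<le> ntri T}"

fun gends :: "arc_triangulation \<Rightarrow> gedge \<Rightarrow> gvertex set" where
  "gends T (TEdge e) = PolyV ` e"
| "gends T (SigmaA m) = {FaceC m, PolyV (near_a T m)}"
| "gends T (SigmaB m) = {FaceC m, PolyV (near_b T m)}"
| "gends T (Tau p q) = {FaceC p, FaceC q}"

fun is_sigma :: "gedge \<Rightarrow> bool" where
  "is_sigma (SigmaA m) = True"
| "is_sigma (SigmaB m) = True"
| "is_sigma _ = False"

fun is_tau :: "gedge \<Rightarrow> bool" where
  "is_tau (Tau p q) = True"
| "is_tau _ = False"

fun crosses_arc :: "arc_triangulation \<Rightarrow> gedge \<Rightarrow> bool" where
  "crosses_arc T (TEdge e) = crosses e {src T, tgt T}"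
| "crosses_arc T (Tau p q) = True"
| "crosses_arc T _ = False"

text \<open>
  The arc from \<open>a\<close> to \<open>b\<close> meets \<open>\<theta>\<^sub>1, x\<^sub>1, \<theta>\<^sub>2, x\<^sub>2, \<dots>, x\<^bsub>n-1\<^esub>, \<theta>\<^sub>n\<close> in this order; the face center
  \<open>\<theta>\<^sub>m\<close> is put at position \<open>2m - 1\<close> and the crossing point with \<open>x\<^sub>m\<close> at position \<open>2m\<close>.
  The intersection of an edge with the arc is an interval of positions.
\<close>

fun arc_span :: "arc_triangulation \<Rightarrow> gedge \<Rightarrow> nat \<times> nat" where
  "arc_span T (TEdge e) = (let m = THE m. m \<in> {1..<ntri T} \<and> dg T m = e in (2 * m, 2 * m))"
| "arc_span T (Tau p q) = (2 * p - 1, 2 * q - 1)"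
| "arc_span T _ = (0, 0)"

definition closer_to_a :: "arc_triangulation \<Rightarrow> gedge \<Rightarrow> gedge \<Rightarrow> bool" where
  "closer_to_a T e f \<longleftrightarrow> snd (arc_span T e) < fst (arc_span T f)"

text \<open>
  A path is a pair \<open>(as, ts)\<close>; the vertex \<open>a\<^sub>s\<close> is \<open>as ! s\<close> and the edge \<open>t\<^sub>s\<close> (\<open>s \<ge> 1\<close>)
  is \<open>ts ! (s - 1)\<close>.
\<close>

definition twisted_paths :: "arc_triangulation \<Rightarrow> (gvertex list \<times> gedge list) set" where
  "twisted_paths T = {(as, ts). let l = length ts; t = (\<lambda>s. ts ! (s - 1)) in
     length as = l + 1 \<and>
     set as \<subseteq> gvertices T \<and> as ! 0 = PolyV (src T) \<and> as ! l = PolyV (tgt T) \<and>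
     (\<forall>s\<in>{1..l}. t s \<in> gedges T \<and> gends T (t s) = {as ! (s - 1), as ! s}) \<and>
     (\<forall>s\<in>{1..l}. \<forall>r\<in>{1..l}. s \<noteq> r \<longrightarrow> t s \<noteq> t r) \<and>
     odd l \<and>
     (\<forall>s\<in>{1..l}. even s \<longrightarrow> crosses_arc T (t s)) \<and>
     (\<forall>s\<in>{1..l}. \<forall>p q. is_tau (t s) \<and> as ! (s - 1) = FaceC p \<and> as ! s = FaceC q \<longrightarrow> p < q) \<and>
     (\<forall>s\<in>{1..l}. (is_sigma (t s) \<longrightarrow> odd s) \<and> (is_tau (t s) \<longrightarrow> even s)) \<and>
     (\<forall>s\<in>{1..l}. \<forall>r\<in>{1..l}. s < r \<and> crosses_arc T (t s) \<and> crosses_arc T (t r) \<longrightarrow>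
        closer_to_a T (t s) (t r))}"

text \<open>\<open>\<surd>(yz/w)\<close> for the sides \<open>y, z\<close> of \<open>\<Delta>\<^sub>m\<close> at its vertex \<open>v\<close> and the opposite side \<open>w\<close>.\<close>

definition sigma_coeff :: "arc_triangulation \<Rightarrow> nat \<Rightarrow> nat \<Rightarrow> even_ring" where
  "sigma_coeff T m v =
     (\<Prod>e | e \<subseteq> tri T m \<and> card e = 2 \<and> v \<in> e. var_pow e (1/2)) *
     var_pow (tri T m - {v}) (- 1/2)"

text \<open>The even factor and the odd variables of the twisted weight of \<open>t\<^sub>s\<close>.\<close>

fun twt_even :: "arc_triangulation \<Rightarrow> nat \<Rightarrow> gedge \<Rightarrow> even_ring" where
  "twt_even T s (TEdge e) = var_pow e (if odd s then 1 else -1)"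
| "twt_even T s (SigmaA m) = sigma_coeff T m (near_a T m)"
| "twt_even T s (SigmaB m) = sigma_coeff T m (near_b T m)"
| "twt_even T s (Tau p q) = 1"

fun twt_odd :: "gedge \<Rightarrow> nat multiset" where
  "twt_odd (SigmaA m) = {#m#}"
| "twt_odd (SigmaB m) = {#m#}"
| "twt_odd _ = {#}"

definition twt :: "arc_triangulation \<Rightarrow> gvertex list \<times> gedge list \<Rightarrow> even_ring grassmann" where
  "twt T = (\<lambda>(as, ts). gscale
     (\<Prod>s\<in>{1..length ts}. twt_even T s (ts ! (s - 1)))
     (pos_ordered_prod T (\<Sum>s\<in>{1..length ts}. twt_odd (ts ! (s - 1)))))"

definition cross_arc :: "arc_triangulation \<Rightarrow> even_ring" where
  "cross_arc T = (\<Prod>m\<in>{1..<ntri T}. var_pow (dg T m) 1)"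


section \<open>The labelled snake graph\<close>

datatype tile_side = SLeft | SBottom | STop | SRight

text \<open>Left and right refer to the arc directed from \<open>a\<close> (bottom) to \<open>b\<close> (top).\<close>

definition left_end :: "arc_triangulation \<Rightarrow> nat \<Rightarrow> nat" where
  "left_end T m = (THE v. v \<in> dg T m \<and> ccw (tgt T) v (src T))"

definition right_end :: "arc_triangulation \<Rightarrow> nat \<Rightarrow> nat" where
  "right_end T m = (THE v. v \<in> dg T m \<and> ccw (src T) v (tgt T))"

definition side_label :: "arc_triangulation \<Rightarrow> nat \<Rightarrow> tile_side \<Rightarrow> nat set" where
  "side_label T m d =
     (let p = left_end T m; q = right_end T m;
          u = (THE z. z \<in> tri T m \<and> z \<notin> dg T m);
          v = (THE z. z \<in> tri T (Suc m) \<and> z \<notin> dg T m)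
      in case d of
           SLeft \<Rightarrow> (if odd m then {u, p} else {u, q})
         | SBottom \<Rightarrow> (if odd m then {u, q} else {u, p})
         | STop \<Rightarrow> (if odd m then {p, v} else {q, v})
         | SRight \<Rightarrow> (if odd m then {q, v} else {p, v}))"

text \<open>For \<open>1 \<le> m < ntri - 1\<close>: whether \<open>T\<^bsub>m+1\<^esub>\<close> is attached to the right of \<open>T\<^sub>m\<close>, rather than on top.\<close>

definition goes_right :: "arc_triangulation \<Rightarrow> nat \<Rightarrow> bool" where
  "goes_right T m \<longleftrightarrow> side_label T m SRight =
     (THE e. e \<subseteq> tri T (Suc m) \<and> card e = 2 \<and> e \<noteq> dg T m \<and> e \<noteq> dg T (Suc m))"

text \<open>
  The snake graph is realised in the grid: vertices are grid points, edges are pairs of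
  adjacent grid points, and \<open>tile_pos T m\<close> is the bottom-left corner of the tile \<open>T\<^sub>m\<close>.
\<close>

definition tile_pos :: "arc_triangulation \<Rightarrow> nat \<Rightarrow> nat \<times> nat" where
  "tile_pos T m = (card {k\<in>{1..<m}. goes_right T k}, card {k\<in>{1..<m}. \<not> goes_right T k})"

definition side_edge :: "arc_triangulation \<Rightarrow> nat \<Rightarrow> tile_side \<Rightarrow> (nat \<times> nat) set" where
  "side_edge T m d = (case tile_pos T m of (i, j) \<Rightarrow>
     (case d of
        SLeft \<Rightarrow> {(i, j), (i, j + 1)}
      | SBottom \<Rightarrow> {(i, j), (i + 1, j)}
      | STop \<Rightarrow> {(i, j + 1), (i + 1, j + 1)}
      | SRight \<Rightarrow> {(i + 1, j), (i + 1, j + 1)}))"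

definition tile_edges :: "arc_triangulation \<Rightarrow> nat \<Rightarrow> (nat \<times> nat) set set" where
  "tile_edges T m = range (side_edge T m)"

definition snake_edges :: "arc_triangulation \<Rightarrow> (nat \<times> nat) set set" where
  "snake_edges T = (\<Union>m\<in>{1..<ntri T}. tile_edges T m)"

definition snake_vertices :: "arc_triangulation \<Rightarrow> (nat \<times> nat) set" where
  "snake_vertices T = \<Union> (snake_edges T)"

text \<open>Glued sides carry the same label.\<close>

definition edge_label :: "arc_triangulation \<Rightarrow> (nat \<times> nat) set \<Rightarrow> nat set" where
  "edge_label T e =
     (THE x. \<exists>m\<in>{1..<ntri T}. \<exists>d. e = side_edge T m d \<and> x = side_label T m d)"


section \<open>Double dimer covers\<close>

definition double_dimers :: "arc_triangulation \<Rightarrow> (nat \<times> nat) set multiset set" where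
  "double_dimers T = {M. set_mset M \<subseteq> snake_edges T \<and>
     (\<forall>v\<in>snake_vertices T. size {#e \<in># M. v \<in> e#} = 2)}"

text \<open>The cycle surrounding the tiles \<open>T\<^sub>s, \<dots>, T\<^sub>t\<close> consists of the edges on their outer boundary.\<close>

definition surrounding_cycle :: "arc_triangulation \<Rightarrow> nat \<Rightarrow> nat \<Rightarrow> (nat \<times> nat) set set" where
  "surrounding_cycle T s t = {e. \<exists>!m. m \<in> {s..t} \<and> e \<in> tile_edges T m}"

definition dimer_cycles :: "arc_triangulation \<Rightarrow> (nat \<times> nat) set multiset \<Rightarrow> (nat \<times> nat) set" where
  "dimer_cycles T M = {(s, t). 1 \<le> s \<and> s \<le> t \<and> t < ntri T \<and>
     (\<forall>e\<in>surrounding_cycle T s t. count M e = 1)}"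

definition dimer_wt :: "arc_triangulation \<Rightarrow> (nat \<times> nat) set multiset \<Rightarrow> even_ring grassmann" where
  "dimer_wt T M = gscale
     (\<Prod>e\<in>#M. var_pow (edge_label T e) (1/2))
     (pos_ordered_prod T (\<Sum>(s, t)\<in>dimer_cycles T M. {#s, t + 1#}))"

end

theory Submission
  imports Defs
begin

text \<open>
  Cut the polygon along the diagonals \<open>x\<^sub>1, \<dots>, x\<^sub>n\<^sub>-\<^sub>1\<close>. It becomes a strip of triangles: on the
  way from \<open>x\<^sub>m\<^sub>-\<^sub>1\<close> to \<open>x\<^sub>m\<close> through \<open>\<Delta>\<^sub>m\<close> one endpoint stays (the fan center of \<open>\<Delta>\<^sub>m\<close>) and the
  other one moves along the third side of \<open>\<Delta>\<^sub>m\<close>. This also covers the two ends of the strip if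
  \<open>x\<^sub>0\<close> and \<open>x\<^sub>n\<close> denote the sides of the polygon which join \<open>a\<close> and \<open>b\<close> to the fan centers of
  \<open>\<Delta>\<^sub>1\<close> and \<open>\<Delta>\<^sub>n\<close>. The proof does not match paths and covers directly. It encodes both by the same
  sequences of states \<open>h\<^sub>0, \<dots>, h\<^sub>n\<close>, one for each \<open>x\<^sub>m\<close>, where a state is one of three values: a
  side of the arc or \<open>None\<close>.

  For a path, the state \<open>Some s\<close> at \<open>x\<^sub>m\<close> says that odd steps leave from the endpoint of \<open>x\<^sub>m\<close> on
  the side \<open>s\<close> and even steps from the other endpoint. A step along \<open>x\<^sub>m\<close> changes both the
  endpoint and the parity, so it keeps the state; this is why one state describes all of the path
  near \<open>x\<^sub>m\<close>. The state \<open>None\<close> says that the path runs along a \<open>\<tau>\<close>-edge there. Inside \<open>\<Delta>\<^sub>m\<close>, with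
  \<open>M\<close> the moving side, a path can turn \<open>Some M\<close> into \<open>None\<close> by \<open>\<sigma>\<^sup>A\<close>, turn \<open>None\<close> into
  \<open>Some (\<not> M)\<close> by \<open>\<sigma>\<^sup>B\<close>, turn \<open>Some M\<close> into \<open>Some (\<not> M)\<close> by the third side, or keep its state. So
  the states may only increase in the order \<open>Some M < None < Some (\<not> M)\<close>. The first state is the
  least one for \<open>\<Delta>\<^sub>1\<close>, as the path starts at \<open>a\<close> with an odd step, and the last one is the
  greatest for \<open>\<Delta>\<^sub>n\<close>, as it ends at \<open>b\<close> after one. Whether it also steps along \<open>x\<^sub>m\<close> is forced by
  what it does in \<open>\<Delta>\<^sub>m\<close> and \<open>\<Delta>\<^sub>m\<^sub>+\<^sub>1\<close> (\<open>path_steps_bij\<close>).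

  For a cover, the vertices of the snake graph at distance \<open>m\<close> from its lowest corner correspond
  to the endpoints of \<open>x\<^sub>m\<close>, and the edges between the distances \<open>m - 1\<close> and \<open>m\<close> correspond to the
  sides of \<open>\<Delta>\<^sub>m\<close>. Counting degrees from the lowest corner shows that these edges are used twice in
  total for every \<open>m\<close>. So the two vertices at distance \<open>m\<close>, for \<open>0 < m < n\<close>, receive \<open>0 + 2\<close>,
  \<open>1 + 1\<close> or \<open>2 + 0\<close> elements of the cover from below; this is the state. It determines all
  multiplicities, and these are nonnegative exactly if the states increase as above (\<open>cover_bij\<close>).

  On both sides the even weight is a product of one factor for each triangle, which depends only
  on the two states next to it, up to \<open>\<surd>x\<^sub>0 \<surd>x\<^sub>n\<close> (\<open>path_steps_even\<close>, \<open>cover_even\<close>). On both sides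
  \<open>\<theta>\<^sub>m\<close> occurs if and only if exactly one of \<open>h\<^sub>m\<^sub>-\<^sub>1\<close> and \<open>h\<^sub>m\<close> is \<open>None\<close>: for paths these are
  the ends of the \<open>\<tau>\<close>-edges, for covers the ends of the cycles. So the products of the odd
  variables agree for every order in which they are written.
\<close>

section \<open>The strip of triangles\<close>

declare arc_span.simps(1) [simp del]

text \<open>
  The combinatorial content of a triangulation with a longest arc. Sides of the arc are truth
  values, \<open>True\<close> being the left one. \<open>vtx s m\<close> is the endpoint of \<open>x\<^sub>m\<close> on the side \<open>s\<close>, where \<open>m\<close>
  runs from \<open>0\<close> to \<open>n\<close>, and \<open>moving m\<close> is the side on which the endpoint changes in \<open>\<Delta>\<^sub>m\<close>. Naming
  the sides by truth values lets one argument treat both shapes of a triangle.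
\<close>

locale arc_skeleton =
  fixes T :: arc_triangulation and moving :: "nat \<Rightarrow> bool" and vtx :: "bool \<Rightarrow> nat \<Rightarrow> nat"
  assumes ntri_ge: "2 \<le> ntri T"
    and vtx_stay: "\<lbrakk>1 \<le> m; m \<le> ntri T\<rbrakk> \<Longrightarrow> vtx (\<not> moving m) m = vtx (\<not> moving m) (m - 1)"
    and vtx_new: "\<lbrakk>k < m; m \<le> ntri T\<rbrakk> \<Longrightarrow> vtx (moving m) m \<noteq> vtx (moving m) k"
    and vtx_sides: "\<lbrakk>i \<le> ntri T; j \<le> ntri T\<rbrakk> \<Longrightarrow> vtx True i \<noteq> vtx False j"
    and vtx_bound: "m \<le> ntri T \<Longrightarrow> vtx s m < ntri T + 2"
    and src_vtx: "src T = vtx (moving 1) 0"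
    and tgt_vtx: "tgt T = vtx (moving (ntri T)) (ntri T)"
    and ends_vtx: "\<lbrakk>1 \<le> m; m < ntri T\<rbrakk> \<Longrightarrow> left_end T m = vtx True m"
      "\<lbrakk>1 \<le> m; m < ntri T\<rbrakk> \<Longrightarrow> right_end T m = vtx False m"
    and dg_vtx: "\<lbrakk>1 \<le> m; m < ntri T\<rbrakk> \<Longrightarrow> dg T m = {vtx True m, vtx False m}"
    and tri_vtx: "\<lbrakk>1 \<le> m; m \<le> ntri T\<rbrakk> \<Longrightarrow>
        tri T m = {vtx (moving m) (m - 1), vtx (moving m) m, vtx (\<not> moving m) m}"
    and fan_center_vtx: "\<lbrakk>1 \<le> m; m \<le> ntri T\<rbrakk> \<Longrightarrow> fan_center T m = vtx (\<not> moving m) m"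
    and edges_vtx: "edges T = (\<lambda>m. {vtx True m, vtx False m}) ` {0..ntri T} \<union>
        (\<lambda>m. {vtx (moving m) (m - 1), vtx (moving m) m}) ` {1..ntri T}"
    and crossing_edges: "e \<in> edges T \<Longrightarrow>
        crosses e {src T, tgt T} \<longleftrightarrow> e \<in> (\<lambda>m. {vtx True m, vtx False m}) ` {1..<ntri T}"
begin

text \<open>
  The spokes are the \<open>x\<^sub>m\<close>; the rims are the third sides of the triangles.
\<close>

definition spoke :: "nat \<Rightarrow> nat set" where
  "spoke m = {vtx True m, vtx False m}"

definition rim :: "nat \<Rightarrow> nat set" where
  "rim m = {vtx (moving m) (m - 1), vtx (moving m) m}"

lemma spoke_sides: "spoke m = {vtx s m, vtx (\<not> s) m}"
  by (cases s) (auto simp: spoke_def)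

lemma vtx_eq_sides:
  assumes "i \<le> ntri T" "j \<le> ntri T" "vtx s i = vtx s' j"
  shows "s = s'"
  using vtx_sides[of i j] vtx_sides[of j i] assms by (cases s; cases s') auto

lemma vtx_neq_sides [simp]:
  assumes "i \<le> ntri T" "j \<le> ntri T"
  shows "vtx (\<not> s) i \<noteq> vtx s j" "vtx s i \<noteq> vtx (\<not> s) j"
  using vtx_eq_sides assms by blast+

text \<open>
  The endpoints on one side follow the boundary of the polygon from \<open>a\<close> towards \<open>b\<close>. So a vertex
  that was left behind is not an endpoint of any later \<open>x\<^sub>k\<close>. This is what rules out all detours
  of a path.
\<close>

lemma vtx_left:
  assumes "i < j" "j \<le> k" "k \<le> ntri T" "moving j = s"
  shows "vtx s k \<noteq> vtx s i"
  using assms(2,3)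
proof (induction k rule: dec_induct)
  case base
  then show ?case using vtx_new[of i j] assms by auto
next
  case (step k)
  show ?case
  proof (cases "moving (Suc k) = s")
    case True
    then show ?thesis using vtx_new[of i "Suc k"] step assms(1) by auto
  next
    case False
    then have "vtx s (Suc k) = vtx s k"
      using vtx_stay[of "Suc k"] step by (cases s) auto
    then show ?thesis using step by auto
  qed
qed

lemma vtx_stay_Suc:
  assumes "m < ntri T" "moving (Suc m) \<noteq> s"
  shows "vtx s (Suc m) = vtx s m"
  using vtx_stay[of "Suc m"] assms by (cases s) auto

lemma spoke_inj: "\<lbrakk>i \<le> ntri T; j \<le> ntri T\<rbrakk> \<Longrightarrow> spoke i = spoke j \<longleftrightarrow> i = j"
proof (induction i j rule: linorder_wlog)
  case (le i j)
  show ?case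
  proof (cases "i = j")
    case False
    then have "vtx (moving j) j \<notin> spoke i"
      using vtx_new[of i j] le spoke_sides[of i "moving j"] by auto
    then show ?thesis using False spoke_sides[of j "moving j"] by auto
  qed auto
qed auto

lemma rim_inj: "\<lbrakk>1 \<le> i; 1 \<le> j; i \<le> ntri T; j \<le> ntri T\<rbrakk> \<Longrightarrow> rim i = rim j \<longleftrightarrow> i = j"
proof (induction i j rule: linorder_wlog)
  case (le i j)
  show ?case
  proof (cases "i = j")
    case False
    then have "vtx (moving j) j \<notin> rim i"
      using vtx_new[of i j] vtx_new[of "i - 1" j] le
      by (cases "moving j"; cases "moving i") (auto simp: rim_def dest!: vtx_eq_sides[rotated 2])
    then show ?thesis using False by (auto simp: rim_def)
  qed auto
qed auto

lemma spoke_neq_rim [simp]: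
  assumes "i \<le> ntri T" "1 \<le> j" "j \<le> ntri T"
  shows "spoke i \<noteq> rim j" "rim j \<noteq> spoke i"
proof -
  have "vtx (\<not> moving j) i \<notin> rim j" using assms by (auto simp: rim_def)
  then show "spoke i \<noteq> rim j" "rim j \<noteq> spoke i" using spoke_sides[of i "moving j"] by auto
qed

lemma edges_spoke_rim: "edges T = spoke ` {0..ntri T} \<union> rim ` {1..ntri T}"
  unfolding edges_vtx spoke_def rim_def by simp

lemma spoke_edge [simp]: "m \<le> ntri T \<Longrightarrow> spoke m \<in> edges T"
  by (auto simp: edges_spoke_rim)

lemma rim_edge [simp]: "\<lbrakk>1 \<le> m; m \<le> ntri T\<rbrakk> \<Longrightarrow> rim m \<in> edges T"
  by (auto simp: edges_spoke_rim)

lemma dg_spoke: "\<lbrakk>1 \<le> m; m < ntri T\<rbrakk> \<Longrightarrow> dg T m = spoke m"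
  using dg_vtx by (simp add: spoke_def)

lemma crosses_spoke [simp]:
  assumes "m \<le> ntri T"
  shows "crosses (spoke m) {src T, tgt T} \<longleftrightarrow> 1 \<le> m \<and> m < ntri T"
  using crossing_edges[of "spoke m"] spoke_inj assms by (auto simp: spoke_def[symmetric])

lemma not_crosses_rim [simp]:
  assumes "1 \<le> m" "m \<le> ntri T"
  shows "\<not> crosses (rim m) {src T, tgt T}"
  using crossing_edges[of "rim m"] assms by (auto simp: spoke_def[symmetric])

lemma arc_span_spoke [simp]:
  assumes "1 \<le> m" "m < ntri T"
  shows "arc_span T (TEdge (spoke m)) = (2 * m, 2 * m)"
proof -
  have "(THE k. k \<in> {1..<ntri T} \<and> dg T k = spoke m) = m"
    using assms by (intro the_equality) (auto simp: dg_spoke spoke_inj)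
  then show ?thesis by (simp add: arc_span.simps)
qed

lemma near_a_vtx:
  assumes "1 \<le> m" "m \<le> ntri T"
  shows "near_a T m = vtx (moving m) (m - 1)"
proof (cases "m = 1")
  case False
  have "(THE v. v \<in> dg T (m - 1) \<and> v \<noteq> fan_center T m) = vtx (moving m) (m - 1)"
    using assms False spoke_sides[of "m - 1" "moving m"] vtx_stay[of m]
    by (intro the_equality) (auto simp: dg_spoke fan_center_vtx)
  then show ?thesis using False by (simp add: near_a_def)
qed (simp add: near_a_def src_vtx)

lemma near_b_vtx:
  assumes "1 \<le> m" "m \<le> ntri T"
  shows "near_b T m = vtx (moving m) m"
proof (cases "m = ntri T")
  case False
  have "(THE v. v \<in> dg T m \<and> v \<noteq> fan_center T m) = vtx (moving m) m"
    using assms False spoke_sides[of m "moving m"]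
    by (intro the_equality) (auto simp: dg_spoke fan_center_vtx)
  then show ?thesis using False by (simp add: near_b_def)
qed (simp add: near_b_def tgt_vtx)

end

section \<open>Triangulations with a longest arc are strips\<close>

text \<open>
  The number of counterclockwise steps from \<open>a\<close>. With \<open>a\<close> at \<open>0\<close>, the right side of the arc
  consists of the positions strictly between \<open>0\<close> and that of \<open>b\<close>, and the left side of the later
  ones, so that cyclic order becomes linear order.
\<close>

definition rot :: "arc_triangulation \<Rightarrow> nat \<Rightarrow> nat" where
  "rot T v = (if src T \<le> v then v - src T else v + (ntri T + 2) - src T)"

lemma ccw_rot:
  assumes "src T < ntri T + 2" "u < ntri T + 2" "z < ntri T + 2" "w < ntri T + 2"
  shows "ccw u z w \<longleftrightarrow> ccw (rot T u) (rot T z) (rot T w)"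
proof -
  have "rot T u < rot T v \<longleftrightarrow> (if src T \<le> u then u < v \<or> v < src T else u < v \<and> v < src T)"
    if "u < ntri T + 2" "v < ntri T + 2" for u v
    using that assms(1) unfolding rot_def by (simp split: if_splits) linarith
  note r = this[OF assms(2,3)] this[OF assms(3,2)] this[OF assms(2,4)] this[OF assms(4,2)]
    this[OF assms(3,4)] this[OF assms(4,3)]
  show ?thesis
    unfolding ccw_def r by (auto split: if_splits)
qed

lemma rot_inj:
  assumes "src T < ntri T + 2" "u < ntri T + 2" "v < ntri T + 2"
  shows "rot T u = rot T v \<longleftrightarrow> u = v"
  using assms unfolding rot_def by (auto split: if_splits)

lemma crosses_arc_sides:
  assumes "src T < ntri T + 2" "tgt T < ntri T + 2" "e \<subseteq> {..<ntri T + 2}" "crosses e {src T, w}" "w < ntri T + 2"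
  shows "\<exists>p q. e = {p, q} \<and> 0 < rot T q \<and> rot T q < rot T w \<and> rot T w < rot T p"
proof -
  obtain i j k l where *: "e = {i, j}" "{src T, w} = {k, l}" "ccw i k j" "ccw j l i"
    using assms(4) unfolding crosses_def by blast
  have 0: "rot T (src T) = 0" by (simp add: rot_def)
  have kl: "k = src T \<and> l = w \<or> k = w \<and> l = src T"
    using *(2) by (metis doubleton_eq_iff)
  have b: "i < ntri T + 2" "j < ntri T + 2" "k < ntri T + 2" "l < ntri T + 2"
    using assms * kl by auto
  have r: "ccw (rot T i) (rot T k) (rot T j)" "ccw (rot T j) (rot T l) (rot T i)"
    using *(3,4) ccw_rot[OF assms(1)] b by auto
  from kl show ?thesis
  proof
    assume "k = src T \<and> l = w"
    then have "0 < rot T j \<and> rot T j < rot T w \<and> rot T w < rot T i"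
      using r 0 by (auto simp: ccw_def)
    then show ?thesis using *(1) by blast
  next
    assume "k = w \<and> l = src T"
    then have "0 < rot T i \<and> rot T i < rot T w \<and> rot T w < rot T j"
      using r 0 by (auto simp: ccw_def)
    then show ?thesis using *(1) by (metis insert_commute)
  qed
qed

definition arc_end :: "arc_triangulation \<Rightarrow> bool \<Rightarrow> nat \<Rightarrow> nat" where
  "arc_end T s m = (if s then left_end T m else right_end T m)"

text \<open>
  The fan center stays, so the left endpoint moves if and only if the fan center is the right one.
  The minimum selects \<open>x\<^sub>n\<^sub>-\<^sub>1\<close> in the last triangle, where \<open>x\<^sub>n\<close> is not a diagonal.
\<close>

definition moving_side :: "arc_triangulation \<Rightarrow> nat \<Rightarrow> bool" where
  "moving_side T m \<longleftrightarrow> fan_center T m = right_end T (min m (ntri T - 1))"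

definition side_vertex :: "arc_triangulation \<Rightarrow> bool \<Rightarrow> nat \<Rightarrow> nat" where
  "side_vertex T s m =
     (if m = 0 then if s = moving_side T 1 then src T else arc_end T s 1
      else if m = ntri T then if s = moving_side T m then tgt T else arc_end T s (m - 1)
      else arc_end T s m)"

context
  fixes T :: arc_triangulation
  assumes LT: "longest_arc_triangulation T"
begin

lemma longest_arc_facts:
  "is_triangulation (ntri T + 2) (diags T)"
  "\<And>d. d \<in> diags T \<Longrightarrow> crosses d {src T, tgt T}"
  "dg T ` {1..<ntri T} = diags T"
  "\<And>k m. \<lbrakk>1 \<le> k; k < m; m < ntri T\<rbrakk> \<Longrightarrow> crossed_before T (dg T k) (dg T m)"
  "tri T ` {1..ntri T} = triangles T"
  "src T \<in> tri T 1" "tgt T \<in> tri T (ntri T)"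
  "\<And>m. \<lbrakk>1 \<le> m; m < ntri T\<rbrakk> \<Longrightarrow> tri T m \<inter> tri T (Suc m) = dg T m"
  "ntri T = 2 \<Longrightarrow> ctr T \<in> dg T 1"
  using LT unfolding longest_arc_triangulation_def bij_betw_def by simp_all

lemma basics: "2 \<le> ntri T" "src T < ntri T + 2" "tgt T < ntri T + 2" "rot T (src T) = 0"
  using LT by (auto simp: longest_arc_triangulation_def rot_def)

lemma dg_diag: "\<lbrakk>1 \<le> m; m < ntri T\<rbrakk> \<Longrightarrow> dg T m \<in> diags T"
  using longest_arc_facts(3) by auto

lemma diag_sides:
  assumes "d \<in> diags T"
  shows "\<exists>p q. d = {p, q} \<and> p < ntri T + 2 \<and> q < ntri T + 2 \<and>
    0 < rot T q \<and> rot T q < rot T (tgt T) \<and> rot T (tgt T) < rot T p"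
proof -
  have d: "d \<subseteq> {..<ntri T + 2}" "crosses d {src T, tgt T}"
    using longest_arc_facts(1,2) assms by (auto simp: is_triangulation_def polygon_diagonals_def)
  show ?thesis
    using crosses_arc_sides[OF basics(2,3) d basics(3)] d(1) by auto
qed

lemma rot_tgt: "0 < rot T (tgt T)"
  using diag_sides[OF dg_diag[of 1]] basics by auto

lemma dg_ends:
  assumes "1 \<le> m" "m < ntri T"
  shows "dg T m = {left_end T m, right_end T m}"
    and "0 < rot T (right_end T m)" "rot T (right_end T m) < rot T (tgt T)"
    and "rot T (tgt T) < rot T (left_end T m)"
    and "left_end T m < ntri T + 2" "right_end T m < ntri T + 2"
proof -
  obtain p q where pq: "dg T m = {p, q}" "p < ntri T + 2" "q < ntri T + 2"
    "0 < rot T q" "rot T q < rot T (tgt T)" "rot T (tgt T) < rot T p"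
    using diag_sides[OF dg_diag[OF assms]] by blast
  have "ccw (tgt T) v (src T) \<longleftrightarrow> rot T (tgt T) < rot T v"
    "ccw (src T) v (tgt T) \<longleftrightarrow> 0 < rot T v \<and> rot T v < rot T (tgt T)" if "v < ntri T + 2" for v
    using that rot_tgt basics(4)
    unfolding ccw_rot[OF basics(2,3) that basics(2)] ccw_rot[OF basics(2,2) that basics(3)]
    by (auto simp: ccw_def)
  then have "left_end T m = p" "right_end T m = q"
    unfolding left_end_def right_end_def pq(1) using pq(2-6)
    by (auto intro!: the_equality)
  then show "dg T m = {left_end T m, right_end T m}"
    "0 < rot T (right_end T m)" "rot T (right_end T m) < rot T (tgt T)"
    "rot T (tgt T) < rot T (left_end T m)"
    "left_end T m < ntri T + 2" "right_end T m < ntri T + 2"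
    using pq by auto
qed

lemma dg_arc_end:
  assumes "1 \<le> m" "m < ntri T"
  shows "dg T m = {arc_end T s m, arc_end T (\<not> s) m}"
  using dg_ends(1)[OF assms] by (auto simp: arc_end_def)

text \<open>
  Later diagonals have no endpoint on the \<open>a\<close>-side of earlier ones, so on either side of the arc
  the endpoints only go forward.
\<close>

lemma ends_mono:
  assumes "1 \<le> k" "k < m" "m < ntri T"
  shows "rot T (right_end T k) \<le> rot T (right_end T m)"
    and "rot T (left_end T m) \<le> rot T (left_end T k)"
    and "dg T k \<noteq> dg T m"
proof -
  have cb: "crossed_before T (dg T k) (dg T m)"
    using longest_arc_facts(4) assms by blast
  note k = dg_ends[of k] and m = dg_ends[of m]
  have *: "rot T (right_end T k) \<le> rot T v \<and> rot T v \<le> rot T (left_end T k)"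
    if v: "v \<in> dg T m" for v
  proof (cases "v \<in> dg T k")
    case False
    then have "crosses (dg T k) {src T, v}"
      using cb v by (auto simp: crossed_before_def)
    moreover have "dg T k \<subseteq> {..<ntri T + 2}" "v < ntri T + 2"
      using k m v assms by auto
    ultimately obtain p q where "dg T k = {p, q}" "rot T q < rot T v" "rot T v < rot T p"
      using crosses_arc_sides[OF basics(2,3)] by blast
    then show ?thesis using k assms by (auto simp: doubleton_eq_iff)
  qed (use k assms in auto)
  show "rot T (right_end T k) \<le> rot T (right_end T m)"
    "rot T (left_end T m) \<le> rot T (left_end T k)"
    using * m assms by auto
  show "dg T k \<noteq> dg T m"
    using cb by (auto simp: crossed_before_def)
qed

lemma tri_props:
  assumes "1 \<le> m" "m \<le> ntri T"
  shows "card (tri T m) = 3" "\<And>e. \<lbrakk>e \<subseteq> tri T m; card e = 2\<rbrakk> \<Longrightarrow> e \<in> edges T"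
proof -
  have "tri T m \<in> triangles T"
    using longest_arc_facts(5) assms by auto
  then show "card (tri T m) = 3" "\<And>e. \<lbrakk>e \<subseteq> tri T m; card e = 2\<rbrakk> \<Longrightarrow> e \<in> edges T"
    by (auto simp: triangles_def)
qed

lemma dg_tri:
  assumes "1 \<le> m" "m < ntri T"
  shows "dg T m \<subseteq> tri T m" "dg T m \<subseteq> tri T (Suc m)"
  using longest_arc_facts(8)[OF assms] by blast+

definition on_side :: "bool \<Rightarrow> nat \<Rightarrow> bool" where
  "on_side s v \<longleftrightarrow> (if s then rot T (tgt T) < rot T v else 0 < rot T v \<and> rot T v < rot T (tgt T))"

lemma side_vertex_0: "side_vertex T s 0 = (if s = moving_side T 1 then src T else arc_end T s 1)"
  by (simp add: side_vertex_def)

lemma side_vertex_last: "side_vertex T s (ntri T) =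
    (if s = moving_side T (ntri T) then tgt T else arc_end T s (ntri T - 1))"
  using basics(1) by (simp add: side_vertex_def)

lemma side_vertex_inner: "\<lbrakk>0 < m; m < ntri T\<rbrakk> \<Longrightarrow> side_vertex T s m = arc_end T s m"
  by (simp add: side_vertex_def)

lemma on_side_arc_end: "\<lbrakk>1 \<le> m; m < ntri T\<rbrakk> \<Longrightarrow> on_side s (arc_end T s m)"
  using dg_ends(2-4)[of m] by (auto simp: arc_end_def on_side_def)

lemma arc_end_sides:
  assumes "1 \<le> i" "i < ntri T" "1 \<le> j" "j < ntri T"
  shows "arc_end T True i \<noteq> arc_end T False j"
  using on_side_arc_end[OF assms(1,2), of True] on_side_arc_end[OF assms(3,4), of False]
  by (auto simp: on_side_def)

lemma arc_ends_distinct: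
  assumes "1 \<le> m" "m < ntri T"
  shows "arc_end T s m \<noteq> arc_end T (\<not> s) m" "arc_end T s m \<noteq> src T" "arc_end T s m \<noteq> tgt T"
    "card (dg T m) = 2"
proof -
  show "arc_end T s m \<noteq> arc_end T (\<not> s) m" "arc_end T s m \<noteq> src T" "arc_end T s m \<noteq> tgt T"
    using dg_ends(2-4)[OF assms] basics by (auto simp: arc_end_def)
  then show "card (dg T m) = 2"
    unfolding dg_arc_end[OF assms, of s] by simp
qed

lemma tri_eqI:
  assumes "1 \<le> m" "m \<le> ntri T" "{u, v, w} \<subseteq> tri T m" "u \<noteq> v" "u \<noteq> w" "v \<noteq> w"
  shows "tri T m = {u, v, w}"
  using tri_props(1)[OF assms(1,2)] assms(3-)
  by (intro card_subset_eq[symmetric]) (auto intro: card_ge_0_finite)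

text \<open>
  A triangle contains the four endpoints of its two diagonals but has only three vertices, and
  endpoints on different sides of the arc differ. So the diagonals share an endpoint on one side.
\<close>

lemma tri_inner:
  assumes "2 \<le> m" "m < ntri T"
  shows "\<exists>s. arc_end T (\<not> s) (m - 1) = arc_end T (\<not> s) m \<and>
    arc_end T s (m - 1) \<noteq> arc_end T s m \<and>
    tri T m = {arc_end T s (m - 1), arc_end T s m, arc_end T (\<not> s) m}"
proof -
  have m: "1 \<le> m - 1" "m - 1 < ntri T" "Suc (m - 1) = m" "1 \<le> m" "m \<le> ntri T"
    using assms by auto
  have sub: "dg T (m - 1) \<subseteq> tri T m" "dg T m \<subseteq> tri T m"
    using dg_tri[of m] dg_tri[of "m - 1"] m assms by auto
  have ne: "dg T (m - 1) \<noteq> dg T m"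
    using ends_mono(3)[of "m - 1" m] m assms by auto
  let ?e = "arc_end T"
  have d: "dg T (m - 1) = {?e True (m - 1), ?e False (m - 1)}" "dg T m = {?e True m, ?e False m}"
    using dg_arc_end[of _ True] m assms by auto
  have LR: "?e True i \<noteq> ?e False j" if "i \<in> {m - 1, m}" "j \<in> {m - 1, m}" for i j
    using that m assms by (intro arc_end_sides) auto
  have "?e True (m - 1) = ?e True m \<or> ?e False (m - 1) = ?e False m"
  proof (rule ccontr)
    assume "\<not> ?thesis"
    then have "card {?e True (m - 1), ?e False (m - 1), ?e True m, ?e False m} = 4"
      using LR LR[symmetric] by (auto simp: card_insert_if)
    moreover have "card {?e True (m - 1), ?e False (m - 1), ?e True m, ?e False m} \<le> card (tri T m)"
      using sub d tri_props(1)[OF m(4,5)] by (intro card_mono) (auto intro: card_ge_0_finite)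
    ultimately show False using tri_props(1)[OF m(4,5)] by simp
  qed
  then obtain s where s: "?e (\<not> s) (m - 1) = ?e (\<not> s) m"
    by (metis (full_types))
  have ne': "?e s (m - 1) \<noteq> ?e s m"
    using ne d s by (cases s) auto
  have "tri T m = {?e s (m - 1), ?e s m, ?e (\<not> s) m}"
  proof (rule tri_eqI[OF m(4,5)])
    show "{?e s (m - 1), ?e s m, ?e (\<not> s) m} \<subseteq> tri T m"
      using sub unfolding d by (cases s) auto
    show "?e s (m - 1) \<noteq> ?e (\<not> s) m" "?e s m \<noteq> ?e (\<not> s) m"
      using LR[of "m - 1" m] LR[of m "m - 1"] LR[of m m] by (cases s; force)+
  qed (rule ne')
  with s ne' show ?thesis by blast
qed

lemma fan_center_inner:
  assumes "2 \<le> k" "k < ntri T"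
  shows "(THE v. v \<in> dg T (k - 1) \<inter> dg T k) \<in> dg T (k - 1) \<inter> dg T k"
proof -
  obtain s where s: "arc_end T (\<not> s) (k - 1) = arc_end T (\<not> s) k"
    "arc_end T s (k - 1) \<noteq> arc_end T s k"
    using tri_inner[OF assms] by blast
  have "dg T (k - 1) = {arc_end T s (k - 1), arc_end T (\<not> s) k}"
    "dg T k = {arc_end T s k, arc_end T (\<not> s) k}"
    using dg_arc_end[of _ s] s assms by auto
  then have "\<exists>!v. v \<in> dg T (k - 1) \<inter> dg T k"
    using s by auto
  then show ?thesis by (rule theI')
qed

lemma fan_center_dg:
  assumes "1 \<le> m" "m \<le> ntri T"
  shows "m < ntri T \<Longrightarrow> fan_center T m \<in> dg T m" "2 \<le> m \<Longrightarrow> fan_center T m \<in> dg T (m - 1)"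
proof -
  note ctr = longest_arc_facts(9)
  show "fan_center T m \<in> dg T m" if "m < ntri T"
  proof (cases "ntri T = 2")
    case True
    then have "m = 1" using assms that by auto
    then show ?thesis using ctr True by (simp add: fan_center_def)
  next
    case False
    then show ?thesis
      using fan_center_inner[of 2] fan_center_inner[of m] basics assms that
      by (cases "m = 1") (auto simp: fan_center_def Let_def numeral_2_eq_2)
  qed
  show "fan_center T m \<in> dg T (m - 1)" if "2 \<le> m"
  proof (cases "ntri T = 2")
    case True
    then have "m = 2" using assms that by auto
    then show ?thesis using ctr True by (simp add: fan_center_def)
  next
    case False
    then show ?thesis
      using fan_center_inner[of "m - 1"] fan_center_inner[of m] basics assms that
      by (cases "m = ntri T") (auto simp: fan_center_def Let_def)
  qed
qed

lemma fan_center_arc_end: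
  assumes "1 \<le> m" "m \<le> ntri T"
  shows "m < ntri T \<Longrightarrow> fan_center T m = arc_end T (\<not> moving_side T m) m"
    "2 \<le> m \<Longrightarrow> fan_center T m = arc_end T (\<not> moving_side T m) (m - 1)"
proof -
  have *: "fan_center T m = arc_end T (\<not> moving_side T m) (min m (ntri T - 1))"
  proof -
    define k where "k = min m (ntri T - 1)"
    have k: "1 \<le> k" "k < ntri T" using assms basics(1) by (auto simp: k_def)
    have "fan_center T m \<in> dg T k"
    proof (cases "m = ntri T")
      case True
      then have "k = m - 1" by (auto simp: k_def)
      then show ?thesis using fan_center_dg(2)[OF assms] True basics(1) by simp
    next
      case False
      then have "k = m" using assms by (auto simp: k_def)
      then show ?thesis using fan_center_dg(1)[OF assms] k by simp
    qed
    then have "fan_center T m \<in> {left_end T k, right_end T k}"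
      using dg_ends(1)[OF k] by simp
    then show ?thesis
      unfolding k_def[symmetric] moving_side_def by (auto simp: arc_end_def)
  qed
  then show 1: "fan_center T m = arc_end T (\<not> moving_side T m) m" if "m < ntri T"
  proof -
    have "min m (ntri T - 1) = m" using that by simp
    then show ?thesis using * by simp
  qed
  show "fan_center T m = arc_end T (\<not> moving_side T m) (m - 1)" if m: "2 \<le> m"
  proof (cases "m = ntri T")
    case False
    then have mn: "m < ntri T" using assms by simp
    have "fan_center T m \<in> {arc_end T s (m - 1), arc_end T (\<not> s) (m - 1)}" for s
      using fan_center_dg(2)[OF assms m] dg_arc_end[of "m - 1" s] m assms by auto
    moreover have "arc_end T True m \<noteq> arc_end T False (m - 1)"
      "arc_end T False m \<noteq> arc_end T True (m - 1)"
      using arc_end_sides[of m "m - 1"] arc_end_sides[of "m - 1" m, symmetric] m mn by auto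
    ultimately show ?thesis
      unfolding 1[OF mn] by (cases "moving_side T m") fastforce+
  qed (use * m in \<open>auto simp: min_def\<close>)
qed

lemma side_vertex_cases:
  assumes "m \<le> ntri T"
  obtains "on_side s (side_vertex T s m)"
  | "m = 0" "s = moving_side T 1" "side_vertex T s m = src T"
  | "m = ntri T" "s = moving_side T (ntri T)" "side_vertex T s m = tgt T"
proof -
  have "on_side s (side_vertex T s m) \<or> (m = 0 \<and> s = moving_side T 1 \<and> side_vertex T s m = src T)
    \<or> (m = ntri T \<and> s = moving_side T (ntri T) \<and> side_vertex T s m = tgt T)"
    unfolding side_vertex_def using on_side_arc_end basics assms by auto
  then show thesis using that by blast
qed

lemma side_vertex_sides:
  assumes "i \<le> ntri T" "j \<le> ntri T"
  shows "side_vertex T True i \<noteq> side_vertex T False j"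
  using rot_tgt basics
  by (rule_tac s = True in side_vertex_cases[OF assms(1)];
      rule_tac s = False in side_vertex_cases[OF assms(2)]) (auto simp: on_side_def)

text \<open>
  The distance from \<open>a\<close> along the given side of the polygon; on the left side positions are
  counted backwards, with \<open>a\<close> itself at \<open>0\<close> instead of \<open>n + 2\<close>.
\<close>

definition depth :: "bool \<Rightarrow> nat \<Rightarrow> nat" where
  "depth s v = (if s then if v = src T then 0 else ntri T + 2 - rot T v else rot T v)"

lemma rot_less: "v < ntri T + 2 \<Longrightarrow> rot T v < ntri T + 2"
  using basics by (auto simp: rot_def)

lemma depth_0: "depth s (src T) = 0"
  using basics by (auto simp: depth_def)

lemma depth_arc_end_mono: "\<lbrakk>1 \<le> k; k < m; m < ntri T\<rbrakk> \<Longrightarrow> depth s (arc_end T s k) \<le> depth s (arc_end T s m)"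
  using ends_mono(1,2)[of k m] basics rot_tgt dg_ends(4)[of k] dg_ends(4)[of m]
  by (auto simp: depth_def arc_end_def)

lemma depth_arc_end:
  assumes "1 \<le> m" "m < ntri T"
  shows "0 < depth s (arc_end T s m)" "depth s (arc_end T s m) < depth s (tgt T)"
  using dg_ends[OF assms] rot_less basics rot_tgt
  by (fastforce simp: depth_def arc_end_def)+

lemma depth_inj: "\<lbrakk>u < ntri T + 2; v < ntri T + 2; depth s u = depth s v\<rbrakk> \<Longrightarrow> u = v"
  using rot_inj[of T u v] rot_less[of u] rot_less[of v] basics
  by (auto simp: depth_def split: if_splits)

lemma arc_end_less: "\<lbrakk>1 \<le> m; m < ntri T\<rbrakk> \<Longrightarrow> arc_end T s m < ntri T + 2"
  using dg_ends[of m] by (auto simp: arc_end_def)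

lemma moving_inner:
  assumes "2 \<le> m" "m < ntri T"
  shows "arc_end T (\<not> moving_side T m) (m - 1) = arc_end T (\<not> moving_side T m) m"
    "arc_end T (moving_side T m) (m - 1) \<noteq> arc_end T (moving_side T m) m"
    "tri T m = {arc_end T (moving_side T m) (m - 1), arc_end T (moving_side T m) m,
       arc_end T (\<not> moving_side T m) m}"
proof -
  obtain s where s: "arc_end T (\<not> s) (m - 1) = arc_end T (\<not> s) m"
    "arc_end T s (m - 1) \<noteq> arc_end T s m"
    "tri T m = {arc_end T s (m - 1), arc_end T s m, arc_end T (\<not> s) m}"
    using tri_inner[OF assms] by blast
  have 1: "arc_end T (\<not> moving_side T m) (m - 1) = arc_end T (\<not> moving_side T m) m"
    using fan_center_arc_end[of m] assms by auto
  then have "s = moving_side T m" using s by (cases s; cases "moving_side T m") auto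
  with s 1 show "arc_end T (\<not> moving_side T m) (m - 1) = arc_end T (\<not> moving_side T m) m"
    "arc_end T (moving_side T m) (m - 1) \<noteq> arc_end T (moving_side T m) m"
    "tri T m = {arc_end T (moving_side T m) (m - 1), arc_end T (moving_side T m) m,
       arc_end T (\<not> moving_side T m) m}"
    by auto
qed

lemma depth_step:
  assumes "m < ntri T"
  shows "depth s (side_vertex T s m) \<le> depth s (side_vertex T s (Suc m))"
    "s = moving_side T (Suc m) \<Longrightarrow>
       depth s (side_vertex T s m) < depth s (side_vertex T s (Suc m))"
proof -
  consider "m = 0" | "m > 0" "Suc m = ntri T" | "m > 0" "Suc m < ntri T" using assms by linarith
  then have "depth s (side_vertex T s m) \<le> depth s (side_vertex T s (Suc m)) \<and>
     (s = moving_side T (Suc m) \<longrightarrow>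
       depth s (side_vertex T s m) < depth s (side_vertex T s (Suc m)))"
  proof cases
    case 1
    have "side_vertex T s (Suc m) = arc_end T s 1"
      using side_vertex_inner[of 1 s] basics(1) 1 by simp
    then show ?thesis
      using depth_arc_end(1)[of 1 s] basics(1) depth_0[of s] 1
      by (cases "s = moving_side T 1") (auto simp: side_vertex_0)
  next
    case 2
    then have "side_vertex T s m = arc_end T s m"
      "side_vertex T s (Suc m) = (if s = moving_side T (Suc m) then tgt T else arc_end T s m)"
      using side_vertex_inner[of m s] side_vertex_last[of s] by (simp_all flip: 2(2))
    then show ?thesis
      using depth_arc_end(2)[of m s] 2 by auto
  next
    case 3
    have "depth s (arc_end T s m) \<noteq> depth s (arc_end T s (Suc m))" if "s = moving_side T (Suc m)"
      using depth_inj[of "arc_end T s m" "arc_end T s (Suc m)" s] arc_end_less[of m s]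
        arc_end_less[of "Suc m" s] moving_inner(2)[of "Suc m"] that 3 by auto
    moreover have "depth s (arc_end T s m) \<le> depth s (arc_end T s (Suc m))"
      using depth_arc_end_mono[of m "Suc m" s] 3 by auto
    ultimately show ?thesis using 3 by (auto simp: side_vertex_inner)
  qed
  then show "depth s (side_vertex T s m) \<le> depth s (side_vertex T s (Suc m))"
    "s = moving_side T (Suc m) \<Longrightarrow>
       depth s (side_vertex T s m) < depth s (side_vertex T s (Suc m))"
    by auto
qed

lemma depth_mono:
  assumes "k \<le> m" "m \<le> ntri T"
  shows "depth s (side_vertex T s k) \<le> depth s (side_vertex T s m)"
  using assms
proof (induction m rule: dec_induct)
  case (step m)
  then show ?case using depth_step(1)[of m s] by simp
qed simp

lemma side_vertex_new:
  assumes "k < m" "m \<le> ntri T"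
  shows "side_vertex T (moving_side T m) m \<noteq> side_vertex T (moving_side T m) k"
proof -
  obtain j where j: "m = Suc j" using assms by (cases m) auto
  then show ?thesis
    using depth_mono[of k j "moving_side T m"] depth_step(2)[of j "moving_side T m"] assms
    by (metis Suc_le_lessD Suc_leD less_Suc_eq_le not_le)
qed

lemma side_vertex_stay:
  assumes "1 \<le> m" "m \<le> ntri T"
  shows "side_vertex T (\<not> moving_side T m) m = side_vertex T (\<not> moving_side T m) (m - 1)"
  using assms basics moving_inner(1)[of m] by (auto simp: side_vertex_def)

lemma tri_side_vertex:
  assumes "1 \<le> m" "m \<le> ntri T"
  shows "tri T m = {side_vertex T (moving_side T m) (m - 1), side_vertex T (moving_side T m) m,
    side_vertex T (\<not> moving_side T m) m}"
proof -
  consider "m = 1" | "m = ntri T" "2 \<le> m" | "2 \<le> m" "m < ntri T" using assms basics by linarith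
  then show ?thesis
  proof cases
    case 1
    have one: "1 \<le> (1::nat)" "1 < ntri T" using basics(1) by auto
    have "src T \<in> tri T 1" "dg T 1 \<subseteq> tri T 1"
      using longest_arc_facts(6) dg_tri[of 1] basics(1) by auto
    then have "tri T 1 = {src T, arc_end T (moving_side T 1) 1, arc_end T (\<not> moving_side T 1) 1}"
      using arc_ends_distinct(1)[of 1 "moving_side T 1"] arc_ends_distinct(2)[of 1, symmetric]
        basics(1) unfolding dg_arc_end[OF one, of "moving_side T 1"]
      by (intro tri_eqI) simp_all
    then show ?thesis using 1 basics(1) by (simp add: side_vertex_def)
  next
    case 2
    then have m: "1 \<le> m - 1" "m - 1 < ntri T" "Suc (m - 1) = m" by auto
    have "tgt T \<in> tri T m" "dg T (m - 1) \<subseteq> tri T m"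
      using longest_arc_facts(7) dg_tri(2)[OF m(1,2)] m(3) 2(1) by auto
    then have "tri T m = {arc_end T (moving_side T m) (m - 1), tgt T,
        arc_end T (\<not> moving_side T m) (m - 1)}"
      using arc_ends_distinct(1)[OF m(1,2), of "moving_side T m"]
        arc_ends_distinct(3)[OF m(1,2)] arc_ends_distinct(3)[OF m(1,2), symmetric] assms
      unfolding dg_arc_end[OF m(1,2), of "moving_side T m"]
      by (intro tri_eqI) simp_all
    moreover have "side_vertex T s m = (if s = moving_side T m then tgt T else arc_end T s (m - 1))"
      "side_vertex T s (m - 1) = arc_end T s (m - 1)" for s
      using side_vertex_last[of s] side_vertex_inner[of "m - 1" s] m(1,2) 2(1) by auto
    ultimately show ?thesis by simp
  next
    case 3
    then show ?thesis using moving_inner(3)[OF 3] by (simp add: side_vertex_inner)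
  qed
qed

abbreviation (input) spoke_at :: "nat \<Rightarrow> nat set" where
  "spoke_at m \<equiv> {side_vertex T True m, side_vertex T False m}"

abbreviation (input) rim_at :: "nat \<Rightarrow> nat set" where
  "rim_at m \<equiv> {side_vertex T (moving_side T m) (m - 1), side_vertex T (moving_side T m) m}"

lemma spoke_at_sides: "spoke_at m = {side_vertex T s m, side_vertex T (\<not> s) m}"
  by (cases s) auto

lemma side_vertex_neq [simp]:
  assumes "i \<le> ntri T" "j \<le> ntri T"
  shows "side_vertex T s i \<noteq> side_vertex T (\<not> s) j" "side_vertex T (\<not> s) i \<noteq> side_vertex T s j"
  using side_vertex_sides[OF assms] side_vertex_sides[OF assms(2,1)] by (cases s; auto)+

lemma spoke_at_edge:
  assumes "m \<le> ntri T"
  shows "spoke_at m \<in> edges T"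
proof -
  define k where "k = max 1 m"
  have k: "1 \<le> k" "k \<le> ntri T" "m = k \<or> m = k - 1" using assms basics(1) by (auto simp: k_def)
  have "spoke_at m \<subseteq> tri T k"
    using tri_side_vertex[OF k(1,2)] side_vertex_stay[OF k(1,2)] k(3)
      spoke_at_sides[of m "moving_side T k"] by auto
  moreover have "card (spoke_at m) = 2"
    using side_vertex_sides[OF assms assms] by simp
  ultimately show ?thesis using tri_props(2)[OF k(1,2)] by blast
qed

lemma rim_at_edge:
  assumes "1 \<le> m" "m \<le> ntri T"
  shows "rim_at m \<in> edges T"
proof -
  have "rim_at m \<subseteq> tri T m" using tri_side_vertex[OF assms] by auto
  moreover have "card (rim_at m) = 2" using side_vertex_new[of "m - 1" m] assms by auto
  ultimately show ?thesis using tri_props(2)[OF assms] by blast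
qed

lemma dg_spoke_at: "\<lbrakk>1 \<le> m; m < ntri T\<rbrakk> \<Longrightarrow> dg T m = spoke_at m"
  using dg_arc_end[of m True] by (simp add: side_vertex_def)

lemma diags_spoke_at: "diags T = spoke_at ` {1..<ntri T}"
  unfolding longest_arc_facts(3)[symmetric] using dg_spoke_at by auto

lemma spoke_at_inj:
  assumes "i < j" "j \<le> ntri T"
  shows "spoke_at i \<noteq> spoke_at j"
proof -
  have "side_vertex T (moving_side T j) j \<notin> spoke_at i"
    using side_vertex_new[OF assms] spoke_at_sides[of i "moving_side T j"] assms by auto
  then show ?thesis using spoke_at_sides[of j "moving_side T j"] by auto
qed

lemma rim_at_neq_spoke_at:
  assumes "1 \<le> j" "j \<le> ntri T" "i \<le> ntri T"
  shows "rim_at j \<noteq> spoke_at i"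
proof -
  have "side_vertex T (\<not> moving_side T j) i \<notin> rim_at j" using assms by auto
  then show ?thesis using spoke_at_sides[of i "moving_side T j"] by auto
qed

lemma rim_at_inj:
  assumes "1 \<le> i" "i < j" "j \<le> ntri T"
  shows "rim_at i \<noteq> rim_at j"
proof -
  have "side_vertex T (moving_side T j) j \<notin> rim_at i"
    using side_vertex_new[of i j] side_vertex_new[of "i - 1" j] assms
    by (cases "moving_side T i = moving_side T j") auto
  then show ?thesis by auto
qed

text \<open>
  The third sides of the triangles, together with \<open>x\<^sub>0\<close> and \<open>x\<^sub>n\<close>, are \<open>n + 2\<close> different edges and
  not diagonals. The polygon has only \<open>n + 2\<close> sides, so these are all of them.
\<close>

lemma sides_rims:
  "polygon_sides (ntri T + 2) = {spoke_at 0, spoke_at (ntri T)} \<union> rim_at ` {1..ntri T}"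
proof -
  let ?S = "{spoke_at 0, spoke_at (ntri T)} \<union> rim_at ` {1..ntri T}"
  have "inj_on rim_at {1..ntri T}"
    using rim_at_inj by (intro linorder_inj_onI) auto
  then have "card (rim_at ` {1..ntri T}) = ntri T" by (simp add: card_image)
  moreover have "spoke_at 0 \<notin> rim_at ` {1..ntri T}" "spoke_at (ntri T) \<notin> rim_at ` {1..ntri T}"
    using rim_at_neq_spoke_at by fastforce+
  moreover have "spoke_at 0 \<noteq> spoke_at (ntri T)"
    using spoke_at_inj[of 0 "ntri T"] basics(1) by simp
  ultimately have card: "card ?S = ntri T + 2" by simp
  have "e \<notin> diags T" if "e \<in> ?S" for e
  proof -
    have "spoke_at 0 \<noteq> spoke_at m" "spoke_at (ntri T) \<noteq> spoke_at m" if "1 \<le> m" "m < ntri T" for m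
      using spoke_at_inj[of 0 m] spoke_at_inj[of m "ntri T"] that by auto
    moreover have "rim_at j \<noteq> spoke_at m" if "1 \<le> j" "j \<le> ntri T" "1 \<le> m" "m < ntri T" for j m
      using rim_at_neq_spoke_at[of j m] that by simp
    ultimately show ?thesis
      using that unfolding diags_spoke_at by (elim UnE imageE insertE; simp add: image_iff)
  qed
  moreover have "?S \<subseteq> edges T"
    using rim_at_edge spoke_at_edge by auto
  ultimately have sub: "?S \<subseteq> polygon_sides (ntri T + 2)"
    unfolding edges_def by blast
  have "polygon_sides (ntri T + 2) = (\<lambda>i. {i, Suc i mod (ntri T + 2)}) ` {..<ntri T + 2}"
    by (auto simp: polygon_sides_def)
  then have fin: "finite (polygon_sides (ntri T + 2))" "card (polygon_sides (ntri T + 2)) \<le> ntri T + 2"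
    using card_image_le[of "{..<ntri T + 2}"] by (auto simp del: image_insert)
  have "card (polygon_sides (ntri T + 2)) \<le> card ?S" unfolding card by (rule fin(2))
  from card_seteq[OF fin(1) sub this] show ?thesis by (rule sym)
qed

lemma side_vertex_bound: "m \<le> ntri T \<Longrightarrow> side_vertex T s m < ntri T + 2"
  using basics(1-3) arc_end_less[of 1 s] arc_end_less[of m s] arc_end_less[of "m - 1" s]
  by (auto simp: side_vertex_def)

text \<open>
  The sides of the polygon do not cross the arc: \<open>x\<^sub>0\<close> and \<open>x\<^sub>n\<close> contain \<open>a\<close> or \<open>b\<close>, and both
  endpoints of a third side of a triangle lie on the same side of the arc or at \<open>a\<close> or \<open>b\<close>.
\<close>

lemma crossing_spoke_at:
  assumes "e \<in> edges T"
  shows "crosses e {src T, tgt T} \<longleftrightarrow> e \<in> spoke_at ` {1..<ntri T}"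
proof
  assume "e \<in> spoke_at ` {1..<ntri T}"
  then have "e \<in> diags T" unfolding diags_spoke_at .
  then show "crosses e {src T, tgt T}" by (rule longest_arc_facts(2))
next
  assume cr: "crosses e {src T, tgt T}"
  show "e \<in> spoke_at ` {1..<ntri T}"
  proof (rule ccontr)
    assume "e \<notin> spoke_at ` {1..<ntri T}"
    then have e: "e \<in> {spoke_at 0, spoke_at (ntri T)} \<union> rim_at ` {1..ntri T}"
      using assms sides_rims diags_spoke_at by (auto simp: edges_def)
    then have "e \<subseteq> {..<ntri T + 2}" using side_vertex_bound by auto
    from crosses_arc_sides[OF basics(2,3) this cr basics(3)]
    obtain p q where pq: "e = {p, q}" "on_side True p" "on_side False q"
      by (auto simp: on_side_def)
    have ends: "src T \<notin> e" "tgt T \<notin> e"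
      using pq basics(4) by (auto simp: on_side_def)
    have "src T \<in> spoke_at 0" "tgt T \<in> spoke_at (ntri T)"
      using spoke_at_sides[of 0 "moving_side T 1"] spoke_at_sides[of "ntri T" "moving_side T (ntri T)"]
        by (simp_all add: side_vertex_0 side_vertex_last)
    then have "e \<noteq> spoke_at 0" "e \<noteq> spoke_at (ntri T)" using ends by blast+
    then obtain m where m: "1 \<le> m" "m \<le> ntri T" "e = rim_at m"
      using e by force
    have "on_side s (side_vertex T s i)" if "i \<le> ntri T" "side_vertex T s i \<in> e" for s i
      by (rule side_vertex_cases[OF that(1), of s]) (use ends that in auto)
    then have "on_side (moving_side T m) v" if "v \<in> e" for v
      using that m by auto
    then have "on_side (moving_side T m) p" "on_side (moving_side T m) q" using pq by auto
    then show False using pq by (cases "moving_side T m") (auto simp: on_side_def)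
  qed
qed


lemma skeleton: "arc_skeleton T (moving_side T) (side_vertex T)"
proof (unfold_locales, goal_cases)
  case 1
  show ?case by (rule basics(1))
next
  case (6)
  show ?case by (simp add: side_vertex_def)
next
  case 7
  then show ?case by (simp add: side_vertex_last)
next
  case (8 m)
  then show ?case by (simp add: side_vertex_inner arc_end_def)
next
  case (9 m)
  then show ?case by (simp add: side_vertex_inner arc_end_def)
next
  case (10 m)
  then show ?case by (rule dg_spoke_at)
next
  case (11 m)
  then show ?case by (rule tri_side_vertex)
next
  case (12 m)
  then show ?case
    using fan_center_arc_end[of m] basics(1)
    by (cases "m = ntri T") (auto simp: side_vertex_last side_vertex_inner)
next
  case 13
  have "{0..ntri T} = {0, ntri T} \<union> {1..<ntri T}" using basics(1) by auto
  then have "spoke_at ` {0..ntri T} = {spoke_at 0, spoke_at (ntri T)} \<union> spoke_at ` {1..<ntri T}" by simp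
  then show ?case unfolding edges_def sides_rims diags_spoke_at by auto
qed (use side_vertex_stay side_vertex_new side_vertex_sides side_vertex_bound crossing_spoke_at in auto)

end

section \<open>Paths from states\<close>

text \<open>
  The situations in which a path can be when it passes \<open>x\<^sub>m\<close>: \<open>AtV s True\<close> at the endpoint on the
  side \<open>s\<close> before an odd step, \<open>AtV s False\<close> there before an even step, and \<open>OnTau k\<close> on a
  \<open>\<tau>\<close>-edge which starts at \<open>\<theta>\<^sub>k\<close>.
\<close>

datatype port = AtV bool bool | OnTau nat

text \<open>
  The ports of a vertex at its two parities belong to opposite states, and the two ports with the
  same state are exchanged by a step along \<open>x\<^sub>m\<close>.
\<close>

fun port_state :: "port \<Rightarrow> bool option" where
  "port_state (AtV s o') = Some (if o' then s else \<not> s)"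
| "port_state (OnTau k) = None"

text \<open>
  In the order \<open>Some M < None < Some (\<not> M)\<close> the first state is at most the second one.
\<close>

definition trans_ok :: "bool \<Rightarrow> bool option \<Rightarrow> bool option \<Rightarrow> bool" where
  "trans_ok M s s' \<longleftrightarrow> s = s' \<or> s = Some M \<or> s' = Some (\<not> M)"

lemma trans_ok_cases:
  assumes "trans_ok M (port_state (AtV s o')) s'" "s' \<noteq> port_state (AtV s o')"
  shows "port_state (AtV s o') = Some M" "s' = None \<or> s' = Some (\<not> M)"
  using assms by (cases s'; auto simp: trans_ok_def split: if_splits)+

text \<open>
  The conditions on a path are turned into a recursion along its list of steps, where a step
  consists of an edge and its target; \<open>od\<close> tells whether the step has an odd index.
\<close>

definition step_ok :: "arc_triangulation \<Rightarrow> bool \<Rightarrow> gvertex \<Rightarrow> gedge \<Rightarrow> gvertex \<Rightarrow> bool" where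
  "step_ok T od v e w \<longleftrightarrow> e \<in> gedges T \<and> gends T e = {v, w} \<and> (od \<or> crosses_arc T e) \<and>
     (is_tau e \<longrightarrow> (\<forall>p q. v = FaceC p \<and> w = FaceC q \<longrightarrow> p < q)) \<and>
     (is_sigma e \<longrightarrow> od) \<and> (is_tau e \<longrightarrow> \<not> od)"

fun walk :: "arc_triangulation \<Rightarrow> bool \<Rightarrow> gvertex \<Rightarrow> (gedge \<times> gvertex) list \<Rightarrow> bool" where
  "walk T od v [] \<longleftrightarrow> \<not> od \<and> v = PolyV (tgt T)"
| "walk T od v ((e, w) # ls) \<longleftrightarrow> step_ok T od v e w \<and> walk T (\<not> od) w ls"

definition advances :: "arc_triangulation \<Rightarrow> gedge \<Rightarrow> gedge \<Rightarrow> bool" where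
  "advances T e f \<longleftrightarrow> (crosses_arc T e \<and> crosses_arc T f \<longrightarrow> closer_to_a T e f)"

definition from_pos :: "arc_triangulation \<Rightarrow> nat \<Rightarrow> (gedge \<times> gvertex) list \<Rightarrow> bool" where
  "from_pos T c ls \<longleftrightarrow> (\<forall>e\<in>fst ` set ls. crosses_arc T e \<longrightarrow> c \<le> fst (arc_span T e))"

lemma from_pos_simps [simp]:
  "from_pos T c []"
  "from_pos T c ((e, w) # ls) \<longleftrightarrow> (crosses_arc T e \<longrightarrow> c \<le> fst (arc_span T e)) \<and> from_pos T c ls"
  by (auto simp: from_pos_def)

lemma from_pos_mono: "from_pos T c ls \<Longrightarrow> c' \<le> c \<Longrightarrow> from_pos T c' ls"
  by (auto simp: from_pos_def)

definition advancing :: "arc_triangulation \<Rightarrow> (gedge \<times> gvertex) list \<Rightarrow> bool" where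
  "advancing T ls \<longleftrightarrow> sorted_wrt (advances T) (map fst ls)"

lemma advancing_simps [simp]:
  "advancing T []"
  "advancing T ((e, w) # ls) \<longleftrightarrow>
     (crosses_arc T e \<longrightarrow> from_pos T (Suc (snd (arc_span T e))) ls) \<and> advancing T ls"
  by (auto simp: advancing_def advances_def from_pos_def closer_to_a_def Suc_le_eq)

lemma gedges_simps [simp]:
  "TEdge e \<in> gedges T \<longleftrightarrow> e \<in> edges T"
  "SigmaA m \<in> gedges T \<longleftrightarrow> 1 \<le> m \<and> m \<le> ntri T"
  "SigmaB m \<in> gedges T \<longleftrightarrow> 1 \<le> m \<and> m \<le> ntri T"
  "Tau p q \<in> gedges T \<longleftrightarrow> 1 \<le> p \<and> p < q \<and> q \<le> ntri T"
  by (auto simp: gedges_def)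

context arc_skeleton
begin

fun port_vertex :: "nat \<Rightarrow> port \<Rightarrow> gvertex" where
  "port_vertex m (AtV s o') = PolyV (vtx s m)"
| "port_vertex m (OnTau k) = FaceC k"

fun legal :: "nat \<Rightarrow> bool option \<Rightarrow> bool option list \<Rightarrow> bool" where
  "legal m s [] \<longleftrightarrow> m = ntri T \<and> s = Some (\<not> moving m)"
| "legal m s (s' # hs) \<longleftrightarrow> m < ntri T \<and> trans_ok (moving (Suc m)) s s' \<and> legal (Suc m) s' hs"

text \<open>
  The step along \<open>x\<^sub>m\<close>, taken if the path reaches \<open>x\<^sub>m\<close> at another port than it needs next.
\<close>

definition switch :: "nat \<Rightarrow> port \<Rightarrow> port \<Rightarrow> (gedge \<times> gvertex) list" where
  "switch m P Q = (if P = Q then [] else [(TEdge (spoke m), port_vertex m Q)])"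

text \<open>
  The rest of the path from a port at \<open>x\<^sub>m\<close> on. If a state \<open>Some s\<close> does not change in the next
  triangle, the path must pass it at the endpoint that stays there, whatever the parity. If the
  state changes, an odd step leaves the endpoint that moves. The last switch leads to \<open>b\<close> at an
  even parity.
\<close>

fun path_steps :: "nat \<Rightarrow> port \<Rightarrow> bool option list \<Rightarrow> (gedge \<times> gvertex) list" where
  "path_steps m (OnTau k) [] = []"
| "path_steps m (AtV s o') [] = switch m (AtV s o') (AtV (moving m) False)"
| "path_steps m (OnTau k) (s' # hs) =
     (if s' = None then path_steps (Suc m) (OnTau k) hs
      else (Tau k (Suc m), FaceC (Suc m)) # (SigmaB (Suc m), PolyV (vtx (moving (Suc m)) (Suc m))) #
        path_steps (Suc m) (AtV (moving (Suc m)) False) hs)"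
| "path_steps m (AtV s o') (s' # hs) =
     (let M = moving (Suc m) in
      if s' = port_state (AtV s o') then
        (let Q = AtV (\<not> M) (s' \<noteq> Some M) in switch m (AtV s o') Q @ path_steps (Suc m) Q hs)
      else switch m (AtV s o') (AtV M True) @
        (if s' = None then (SigmaA (Suc m), FaceC (Suc m)) # path_steps (Suc m) (OnTau (Suc m)) hs
         else (TEdge (rim (Suc m)), PolyV (vtx M (Suc m))) # path_steps (Suc m) (AtV M False) hs))"

text \<open>
  The possible remainders of paths from a port at \<open>x\<^sub>m\<close>. Positions from \<open>2m\<close> on are those of \<open>x\<^sub>m\<close>
  and of everything beyond it. A \<open>\<tau>\<close>-edge on which the path already is starts at an earlier
  position, so there the condition is that it ends beyond \<open>x\<^sub>m\<close>.
\<close>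

fun continuation :: "nat \<Rightarrow> port \<Rightarrow> (gedge \<times> gvertex) list \<Rightarrow> bool" where
  "continuation m (AtV s o') ls \<longleftrightarrow>
     walk T o' (PolyV (vtx s m)) ls \<and> advancing T ls \<and> from_pos T (2 * m) ls"
| "continuation m (OnTau k) ls \<longleftrightarrow>
     walk T False (FaceC k) ls \<and> advancing T ls \<and> (\<exists>q>m. snd (hd ls) = FaceC q)"

lemma step_spoke:
  assumes "m \<le> ntri T" "od \<or> 1 \<le> m \<and> m < ntri T"
  shows "step_ok T od (PolyV (vtx s m)) (TEdge (spoke m)) (PolyV (vtx (\<not> s) m))"
proof -
  have "gends T (TEdge (spoke m)) = {PolyV (vtx s m), PolyV (vtx (\<not> s) m)}"
    by (simp add: spoke_sides[of m s])
  then show ?thesis using assms by (auto simp: step_ok_def simp del: gends.simps)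
qed

lemma step_rim:
  assumes "1 \<le> m" "m \<le> ntri T"
  shows "step_ok T True (PolyV (vtx (moving m) (m - 1))) (TEdge (rim m)) (PolyV (vtx (moving m) m))"
proof -
  have "gends T (TEdge (rim m)) = {PolyV (vtx (moving m) (m - 1)), PolyV (vtx (moving m) m)}"
    by (simp add: rim_def)
  then show ?thesis using assms by (auto simp: step_ok_def simp del: gends.simps)
qed

lemma step_SigmaA:
  assumes "1 \<le> m" "m \<le> ntri T"
  shows "step_ok T True (PolyV (vtx (moving m) (m - 1))) (SigmaA m) (FaceC m)"
  using assms by (simp add: step_ok_def near_a_vtx insert_commute)

lemma step_SigmaB:
  assumes "1 \<le> m" "m \<le> ntri T"
  shows "step_ok T True (FaceC m) (SigmaB m) (PolyV (vtx (moving m) m))"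
  using assms by (simp add: step_ok_def near_b_vtx)

lemma step_Tau:
  assumes "1 \<le> p" "p < q" "q \<le> ntri T"
  shows "step_ok T False (FaceC p) (Tau p q) (FaceC q)"
  using assms by (auto simp: step_ok_def)

lemma continuation_switch:
  assumes m: "m \<le> ntri T" "o' \<or> 1 \<le> m \<and> m < ntri T"
    and Q: "Q = AtV s o' \<or> Q = AtV (\<not> s) (\<not> o')"
    and ls: "\<And>s' o''. Q = AtV s' o'' \<Longrightarrow> walk T o'' (PolyV (vtx s' m)) ls" "advancing T ls" "from_pos T (Suc (2 * m)) ls"
  shows "continuation m (AtV s o') (switch m (AtV s o') Q @ ls)"
proof (cases "Q = AtV s o'")
  case True
  then show ?thesis using ls from_pos_mono[of T _ ls "2 * m"] by (auto simp: switch_def)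
next
  case False
  then have Q: "Q = AtV (\<not> s) (\<not> o')" using Q by simp
  have "from_pos T (2 * m) ls" using ls(3) by (rule from_pos_mono) simp
  moreover have "advancing T ((TEdge (spoke m), PolyV (vtx (\<not> s) m)) # ls)"
    using ls(2,3) m by auto
  ultimately show ?thesis
    using step_spoke[OF m, of s] Q False ls m by (auto simp: switch_def)
qed

lemma tau_step:
  assumes "walk T False (FaceC j) ls"
  obtains q r where "ls = (Tau j q, FaceC q) # r" "1 \<le> j" "j < q" "q \<le> ntri T"
    "walk T True (FaceC q) r"
proof (cases ls)
  case (Cons a r)
  obtain e w where a: "a = (e, w)" by fastforce
  have e: "step_ok T False (FaceC j) e w" "walk T True w r"
    using assms Cons a by auto
  then show ?thesis
    using that Cons a by (cases e) (fastforce simp: step_ok_def doubleton_eq_iff)+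
qed (use assms in auto)

lemma continuation_OnTau_from:
  assumes "continuation m (OnTau k) ls"
  shows "from_pos T (2 * k - 1) ls"
proof -
  have w: "walk T False (FaceC k) ls" using assms by simp
  obtain q r where ls: "ls = (Tau k q, FaceC q) # r" "1 \<le> k" "k < q" "q \<le> ntri T"
    "walk T True (FaceC q) r"
    by (rule tau_step[OF w])
  moreover have "from_pos T (2 * q) r"
    using assms ls by auto
  ultimately show ?thesis
    using from_pos_mono[of T "2 * q" r "2 * k - 1"] by auto
qed

lemma path_steps_continuation:
  assumes "legal m (port_state P) hs" "\<And>k. P = OnTau k \<Longrightarrow> 1 \<le> k \<and> k \<le> m"
    "m = 0 \<Longrightarrow> \<exists>s. P = AtV s True"
  shows "continuation m P (path_steps m P hs)"
  using assms
proof (induction hs arbitrary: m P)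
  case Nil
  then obtain s o' where P: "P = AtV s o'" "Some (if o' then s else \<not> s) = Some (\<not> moving m)" "m = ntri T"
    by (cases P) auto
  show ?case
  proof (cases "o'")
    case True
    then show ?thesis
      using P continuation_switch[of m o' "AtV (moving m) False" s "[]"] ntri_ge by (auto simp: tgt_vtx)
  next
    case False
    then show ?thesis
      using P by (auto simp: tgt_vtx switch_def)
  qed
next
  case (Cons s' hs)
  define M where "M = moving (Suc m)"
  have m: "m < ntri T" "trans_ok M (port_state P) s'" "legal (Suc m) s' hs"
    using Cons.prems by (auto simp: M_def)
  note IH = Cons.IH[of "Suc m"]
  show ?case
  proof (cases P)
    case (OnTau k)
    have k: "1 \<le> k" "k \<le> m" using Cons.prems(2) OnTau by auto
    show ?thesis
    proof (cases "s' = None")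
      case True
      then have c: "continuation (Suc m) (OnTau k) (path_steps (Suc m) (OnTau k) hs)"
        using IH[of "OnTau k"] m k by auto
      then show ?thesis using True OnTau by auto
    next
      case False
      then have s': "s' = Some (\<not> M)" using m OnTau by (auto simp: trans_ok_def)
      have c: "continuation (Suc m) (AtV M False) (path_steps (Suc m) (AtV M False) hs)"
        using IH[of "AtV M False"] m s' by auto
      have f: "from_pos T (2 * m + 2) (path_steps (Suc m) (AtV M False) hs)"
        using c by simp
      then show ?thesis
        using c s' OnTau step_Tau[of k "Suc m"] step_SigmaB[of "Suc m"] k m M_def
        by auto
    qed
  next
    case (AtV s o')
    have mo: "m \<le> ntri T" "o' \<or> 1 \<le> m \<and> m < ntri T"
      using m Cons.prems(3) AtV by (auto simp: Suc_le_eq)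
    show ?thesis
    proof (cases "s' = port_state P")
      case True
      define Q where "Q = AtV (\<not> M) (s' \<noteq> Some M)"
      have st: "s' = port_state Q" using True AtV by (auto simp: Q_def)
      have c: "continuation (Suc m) Q (path_steps (Suc m) Q hs)"
        using IH[of Q] m(3) by (simp add: st[symmetric]) (simp add: Q_def)
      have v: "vtx (\<not> M) (Suc m) = vtx (\<not> M) m"
        using vtx_stay_Suc[of m "\<not> M"] m M_def by simp
      have "continuation m P (switch m P Q @ path_steps (Suc m) Q hs)"
        unfolding AtV
      proof (rule continuation_switch[OF mo])
        show "Q = AtV s o' \<or> Q = AtV (\<not> s) (\<not> o')"
          using True AtV by (auto simp: Q_def)
        show "walk T o'' (PolyV (vtx s'' m)) (path_steps (Suc m) Q hs)" if "Q = AtV s'' o''" for s'' o''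
          using c that v unfolding Q_def by auto
        show "advancing T (path_steps (Suc m) Q hs)" using c unfolding Q_def by auto
        show "from_pos T (Suc (2 * m)) (path_steps (Suc m) Q hs)"
          using c from_pos_mono[of T "2 * Suc m" _ "Suc (2 * m)"] unfolding Q_def by auto
      qed
      then show ?thesis using AtV True by (auto simp: Q_def M_def Let_def)
    next
      case False
      then have st: "port_state P = Some M" "s' = None \<or> s' = Some (\<not> M)"
        using trans_ok_cases[of M s o' s'] m(2) False unfolding AtV by auto
      define rest where "rest = (if s' = None then (SigmaA (Suc m), FaceC (Suc m)) # path_steps (Suc m) (OnTau (Suc m)) hs
         else (TEdge (rim (Suc m)), PolyV (vtx M (Suc m))) # path_steps (Suc m) (AtV M False) hs)"
      have r: "walk T True (PolyV (vtx M m)) rest \<and> advancing T rest \<and> from_pos T (Suc (2 * m)) rest"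
      proof (cases "s' = None")
        case True
        then have c: "continuation (Suc m) (OnTau (Suc m)) (path_steps (Suc m) (OnTau (Suc m)) hs)"
          using IH[of "OnTau (Suc m)"] m by auto
        then show ?thesis
          using True step_SigmaA[of "Suc m"] m continuation_OnTau_from[OF c]
          unfolding rest_def by (auto simp: M_def advances_def)
      next
        case False
        then have c: "continuation (Suc m) (AtV M False) (path_steps (Suc m) (AtV M False) hs)"
          using IH[of "AtV M False"] m st by auto
        then show ?thesis
          using False step_rim[of "Suc m"] m from_pos_mono[of T "2 * Suc m" _ "Suc (2 * m)"]
          unfolding rest_def by (auto simp: M_def advances_def)
      qed
      have "continuation m P (switch m P (AtV M True) @ rest)"
        unfolding AtV
        by (rule continuation_switch[OF mo]) (use st AtV r in \<open>auto split: if_splits\<close>)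
      then show ?thesis using AtV False by (auto simp: rest_def M_def Let_def)
    qed
  qed
qed

text \<open>
  The edges that can still occur in a path from \<open>x\<^sub>m\<close> on. Every triangle uses edges which are no
  longer available in the next one. This yields condition T3, and it lets the states be read off
  from the set of edges of a path.
\<close>

definition fresh :: "nat \<Rightarrow> gedge \<Rightarrow> bool" where
  "fresh m e \<longleftrightarrow> (\<exists>k. m \<le> k \<and> k \<le> ntri T \<and> e = TEdge (spoke k)) \<or>
     (\<exists>j. m < j \<and> j \<le> ntri T \<and>
       (e = TEdge (rim j) \<or> e = SigmaA j \<or> e = SigmaB j \<or> (\<exists>k. e = Tau k j)))"

lemma fresh_mono: "fresh (Suc m) e \<Longrightarrow> fresh m e"
  unfolding fresh_def by (blast intro: Suc_leD Suc_lessD)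

lemma fresh_simps [simp]:
  "m \<le> ntri T \<Longrightarrow> fresh k (TEdge (spoke m)) \<longleftrightarrow> k \<le> m"
  "\<lbrakk>1 \<le> m; m \<le> ntri T\<rbrakk> \<Longrightarrow> fresh k (TEdge (rim m)) \<longleftrightarrow> k < m"
  "fresh k (SigmaA m) \<longleftrightarrow> k < m \<and> m \<le> ntri T"
  "fresh k (SigmaB m) \<longleftrightarrow> k < m \<and> m \<le> ntri T"
  "fresh k (Tau p m) \<longleftrightarrow> k < m \<and> m \<le> ntri T"
  by (auto simp: fresh_def spoke_inj rim_inj)

lemma path_steps_fresh:
  assumes "legal m (port_state P) hs"
  shows "(\<forall>e\<in>fst ` set (path_steps m P hs). fresh m e) \<and> distinct (map fst (path_steps m P hs))"
  using assms
proof (induction hs arbitrary: m P)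
  case Nil
  then show ?case by (cases P) (auto simp: switch_def)
next
  case (Cons s' hs)
  define M where "M = moving (Suc m)"
  have m: "m < ntri T" "trans_ok M (port_state P) s'" "legal (Suc m) s' hs"
    using Cons.prems by (auto simp: M_def)
  have *: "(\<forall>e\<in>fst ` set (path_steps (Suc m) Q hs). fresh (Suc m) e \<and> fresh m e) \<and>
      distinct (map fst (path_steps (Suc m) Q hs))"
    if "port_state Q = s'" for Q
    using Cons.IH[of "Suc m" Q] m that fresh_mono by auto
  have neq: "spoke m \<noteq> rim (Suc m)" using m by auto
  have nf: "\<not> fresh (Suc m) (TEdge (spoke m))" "\<not> fresh (Suc m) (TEdge (rim (Suc m)))"
    "\<not> fresh (Suc m) (SigmaA (Suc m))" "\<not> fresh (Suc m) (SigmaB (Suc m))"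
    "\<not> fresh (Suc m) (Tau k (Suc m))"
    "fresh m (TEdge (spoke m))" "fresh m (TEdge (rim (Suc m)))"
    "fresh m (SigmaA (Suc m))" "fresh m (SigmaB (Suc m))" "fresh m (Tau k (Suc m))" for k
    using m by auto
  show ?case
  proof (cases P)
    case (OnTau k)
    show ?thesis
    proof (cases "s' = None")
      case True
      then show ?thesis using OnTau *[of "OnTau k"] by auto
    next
      case False
      then have "s' = port_state (AtV M False)" using m OnTau by (auto simp: trans_ok_def)
      then show ?thesis using OnTau False *[of "AtV M False"] nf by (force simp: M_def)
    qed
  next
    case (AtV s o')
    show ?thesis
    proof (cases "s' = port_state P")
      case True
      define Q where "Q = AtV (\<not> M) (s' \<noteq> Some M)"
      have "s' = port_state Q" using True AtV by (auto simp: Q_def)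
      then have "(\<forall>e\<in>fst ` set (switch m P Q @ path_steps (Suc m) Q hs). fresh m e) \<and>
          distinct (map fst (switch m P Q @ path_steps (Suc m) Q hs))"
        using *[of Q] nf by (force simp: switch_def)
      then show ?thesis using AtV True by (auto simp: Q_def M_def Let_def)
    next
      case False
      then have st: "port_state P = Some M" "s' = None \<or> s' = Some (\<not> M)"
        using trans_ok_cases[of M s o' s'] m(2) False unfolding AtV by auto
      then show ?thesis
        using AtV False *[of "OnTau (Suc m)"] *[of "AtV M False"] nf neq
        by (elim disjE; force simp: switch_def M_def Let_def)
    qed
  qed
qed

end

context arc_skeleton
begin

section \<open>Paths determine their states\<close>

text \<open>
  What a path does in \<open>\<Delta>\<^sub>m\<^sub>+\<^sub>1\<close> is visible in its edges, since none of them can occur later.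
\<close>

lemma path_steps_edge_mem:
  assumes "legal m (port_state P) (s' # hs)"
  shows "\<And>s o'. P = AtV s o' \<Longrightarrow> SigmaA (Suc m) \<in> fst ` set (path_steps m P (s' # hs)) \<longleftrightarrow>
      s' \<noteq> port_state P \<and> s' = None"
    and "\<And>s o'. P = AtV s o' \<Longrightarrow> TEdge (rim (Suc m)) \<in> fst ` set (path_steps m P (s' # hs)) \<longleftrightarrow>
      s' \<noteq> port_state P \<and> s' \<noteq> None"
    and "\<And>k. P = OnTau k \<Longrightarrow> SigmaB (Suc m) \<in> fst ` set (path_steps m P (s' # hs)) \<longleftrightarrow> s' \<noteq> None"
proof -
  define M where "M = moving (Suc m)"
  have m: "m < ntri T" "trans_ok M (port_state P) s'" "legal (Suc m) s' hs"
    using assms by (auto simp: M_def)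
  have nf: "\<not> fresh (Suc m) (TEdge (rim (Suc m)))" "spoke m \<noteq> rim (Suc m)"
    "\<not> fresh (Suc m) (SigmaA (Suc m))" "\<not> fresh (Suc m) (SigmaB (Suc m))"
    using m by auto
  have *: "(TEdge (rim (Suc m)), w) \<notin> set (path_steps (Suc m) Q hs)"
    "(SigmaA (Suc m), w) \<notin> set (path_steps (Suc m) Q hs)"
    "(SigmaB (Suc m), w) \<notin> set (path_steps (Suc m) Q hs)" if "port_state Q = s'" for Q w
    using path_steps_fresh[of "Suc m" Q hs] m(3) nf that by force+
  show "SigmaB (Suc m) \<in> fst ` set (path_steps m P (s' # hs)) \<longleftrightarrow> s' \<noteq> None" if "P = OnTau k" for k
    using *[of "OnTau k"] that by force
  have main: "(SigmaA (Suc m) \<in> fst ` set (path_steps m P (s' # hs)) \<longleftrightarrow> s' \<noteq> port_state P \<and> s' = None) \<and>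
    (TEdge (rim (Suc m)) \<in> fst ` set (path_steps m P (s' # hs)) \<longleftrightarrow> s' \<noteq> port_state P \<and> s' \<noteq> None)"
    if P: "P = AtV s o'" for s o'
  proof (cases "s' = port_state P")
    case True
    define Q where "Q = AtV (\<not> M) (s' \<noteq> Some M)"
    have Q: "port_state Q = s'" using True P by (auto simp: Q_def)
    have "path_steps m P (s' # hs) = switch m P Q @ path_steps (Suc m) Q hs"
      using P True by (auto simp: Q_def M_def Let_def)
    then show ?thesis
      using *[OF Q] nf True by (auto simp: switch_def simp del: path_steps.simps)
  next
    case False
    have s': "port_state P = Some M" "s' = None \<or> s' = Some (\<not> M)"
      using trans_ok_cases[of M s o' s'] m(2) False unfolding P by auto
    have "path_steps m P (s' # hs) = switch m P (AtV M True) @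
        (if s' = None then (SigmaA (Suc m), FaceC (Suc m)) # path_steps (Suc m) (OnTau (Suc m)) hs
         else (TEdge (rim (Suc m)), PolyV (vtx M (Suc m))) # path_steps (Suc m) (AtV M False) hs)"
      using P False by (auto simp: M_def Let_def)
    then show ?thesis
      using *[of "OnTau (Suc m)"] *[of "AtV M False"] nf False s'
      by (force simp: switch_def simp del: path_steps.simps)
  qed
  show "P = AtV s o' \<Longrightarrow> SigmaA (Suc m) \<in> fst ` set (path_steps m P (s' # hs)) \<longleftrightarrow>
      s' \<noteq> port_state P \<and> s' = None" for s o'
    by (rule main[THEN conjunct1])
  show "P = AtV s o' \<Longrightarrow> TEdge (rim (Suc m)) \<in> fst ` set (path_steps m P (s' # hs)) \<longleftrightarrow>
      s' \<noteq> port_state P \<and> s' \<noteq> None" for s o'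
    by (rule main[THEN conjunct2])
qed

lemma path_steps_inj:
  assumes "legal m (port_state P) hs" "legal m (port_state P) hs'" "path_steps m P hs = path_steps m P hs'"
  shows "hs = hs'"
  using assms
proof (induction hs arbitrary: m P hs')
  case Nil
  then show ?case by (cases hs') auto
next
  case (Cons s1 hs1)
  then obtain s2 hs2 where hs': "hs' = s2 # hs2" by (cases hs') auto
  define M where "M = moving (Suc m)"
  have m: "trans_ok M (port_state P) s1" "legal (Suc m) s1 hs1"
    "trans_ok M (port_state P) s2" "legal (Suc m) s2 hs2"
    using Cons.prems hs' by (auto simp: M_def)
  note mem = path_steps_edge_mem[OF Cons.prems(1)] path_steps_edge_mem[OF Cons.prems(2)[unfolded hs']]
  note eq = Cons.prems(3)[unfolded hs']
  have s: "s1 = s2"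
  proof (cases P)
    case (OnTau k)
    then have "s1 = None \<longleftrightarrow> s2 = None" using mem(3,6) eq by auto
    then show ?thesis using m OnTau by (auto simp: trans_ok_def)
  next
    case (AtV s o')
    have "s1 \<noteq> port_state P \<and> s1 = None \<longleftrightarrow> s2 \<noteq> port_state P \<and> s2 = None"
      using mem(1,4)[OF AtV] eq by simp
    moreover have "s1 \<noteq> port_state P \<and> s1 \<noteq> None \<longleftrightarrow> s2 \<noteq> port_state P \<and> s2 \<noteq> None"
      using mem(2,5)[OF AtV] eq by simp
    moreover have "s1 = None \<or> s1 = Some (\<not> M)" if "s1 \<noteq> port_state P"
      using trans_ok_cases[of M s o' s1] m AtV that by auto
    moreover have "s2 = None \<or> s2 = Some (\<not> M)" if "s2 \<noteq> port_state P"
      using trans_ok_cases[of M s o' s2] m AtV that by auto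
    ultimately show ?thesis by metis
  qed
  have "hs1 = hs2"
  proof (cases P)
    case (OnTau k)
    show ?thesis
    proof (cases "s1 = None")
      case True
      then show ?thesis
        using Cons.IH[of "Suc m" "OnTau k" hs2] m s eq OnTau by auto
    next
      case False
      then have "s1 = Some (\<not> M)" using m OnTau by (auto simp: trans_ok_def)
      then show ?thesis
        using Cons.IH[of "Suc m" "AtV M False" hs2] m s eq OnTau by (auto simp: M_def)
    qed
  next
    case (AtV s o')
    show ?thesis
    proof (cases "s1 = port_state P")
      case True
      define Q where "Q = AtV (\<not> M) (s1 \<noteq> Some M)"
      have Q: "port_state Q = s1" using True AtV by (auto simp: Q_def)
      have "path_steps m P (s1 # h) = switch m P Q @ path_steps (Suc m) Q h" for h
        using AtV True by (auto simp: Q_def M_def Let_def)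
      then show ?thesis
        using Cons.IH[of "Suc m" Q hs2] m s eq Q by auto
    next
      case False
      have s': "port_state P = Some M" "s1 = None \<or> s1 = Some (\<not> M)"
        using trans_ok_cases[of M s o' s1] m(1) False unfolding AtV by auto
      have "path_steps m P (s1 # h) = switch m P (AtV M True) @
        (if s1 = None then (SigmaA (Suc m), FaceC (Suc m)) # path_steps (Suc m) (OnTau (Suc m)) h
         else (TEdge (rim (Suc m)), PolyV (vtx M (Suc m))) # path_steps (Suc m) (AtV M False) h)" for h
        using AtV False by (auto simp: M_def Let_def)
      then show ?thesis
        using Cons.IH[of "Suc m" "OnTau (Suc m)" hs2] Cons.IH[of "Suc m" "AtV M False" hs2] m s eq s'
        by (auto split: if_splits)
    qed
  qed
  with s hs' show ?case by simp
qed

section \<open>Every path comes from states\<close>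

lemma vtx_in_spoke:
  assumes "i \<le> ntri T" "k \<le> ntri T" "{PolyV (vtx s i), w} = PolyV ` spoke k"
  shows "vtx s k = vtx s i" "w = PolyV (vtx (\<not> s) k)"
proof -
  have *: "{PolyV (vtx s i), w} = {PolyV (vtx s k), PolyV (vtx (\<not> s) k)}"
    using assms(3) by (simp add: spoke_sides[of k s])
  moreover have "vtx s i \<noteq> vtx (\<not> s) k" using assms by simp
  ultimately show "vtx s k = vtx s i" "w = PolyV (vtx (\<not> s) k)"
    by (auto simp: doubleton_eq_iff)
qed

lemma vtx_in_rim:
  assumes "i \<le> ntri T" "1 \<le> j" "j \<le> ntri T" "{PolyV (vtx s i), w} = PolyV ` rim j"
  shows "moving j = s" "vtx s i = vtx s (j - 1) \<and> w = PolyV (vtx s j) \<or>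
    vtx s i = vtx s j \<and> w = PolyV (vtx s (j - 1))"
proof -
  have *: "{PolyV (vtx s i), w} = {PolyV (vtx (moving j) (j - 1)), PolyV (vtx (moving j) j)}"
    using assms(4) by (simp add: rim_def)
  then have "vtx s i = vtx (moving j) (j - 1) \<or> vtx s i = vtx (moving j) j"
    by (auto simp: doubleton_eq_iff)
  then show "moving j = s"
    using vtx_eq_sides[of i "j - 1" s "moving j"] vtx_eq_sides[of i j s "moving j"] assms by auto
  then show "vtx s i = vtx s (j - 1) \<and> w = PolyV (vtx s j) \<or>
    vtx s i = vtx s j \<and> w = PolyV (vtx s (j - 1))"
    using * by (auto simp: doubleton_eq_iff)
qed

text \<open>
  A path that has not ended at \<open>b\<close> must cross the arc with an even step, and from a polygon vertex
  it can only do so along a diagonal at this vertex which lies ahead.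
\<close>

lemma even_step:
  assumes "i \<le> ntri T" "walk T False (PolyV (vtx s i)) ls" "from_pos T (2 * m) ls"
  obtains "ls = []" "s = moving (ntri T)" "i = ntri T"
  | k r where "ls = (TEdge (spoke k), PolyV (vtx (\<not> s) k)) # r" "1 \<le> k" "m \<le> k" "k < ntri T"
      "vtx s k = vtx s i" "walk T True (PolyV (vtx (\<not> s) k)) r"
proof (cases ls)
  case Nil
  then have eq: "vtx s i = vtx (moving (ntri T)) (ntri T)" using assms by (simp add: tgt_vtx)
  then have s: "s = moving (ntri T)" using vtx_eq_sides[of i "ntri T"] assms by auto
  moreover have "i = ntri T"
    using vtx_new[of i "ntri T"] eq s assms(1) by (cases "i = ntri T") auto
  ultimately show thesis using that(1) Nil by simp
next
  case (Cons a r)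
  obtain e w where a: "a = (e, w)" by fastforce
  have st: "step_ok T False (PolyV (vtx s i)) e w" "walk T True w r"
    using assms Cons a by auto
  then obtain f where e: "e = TEdge f" "f \<in> edges T" "crosses f {src T, tgt T}"
      "PolyV ` f = {PolyV (vtx s i), w}"
    by (cases e) (auto simp: step_ok_def doubleton_eq_iff)
  then obtain k where k: "f = spoke k" "1 \<le> k" "k < ntri T"
    using crossing_edges[of f] by (auto simp: spoke_def)
  have "vtx s k = vtx s i" "w = PolyV (vtx (\<not> s) k)"
    using vtx_in_spoke[of i k s w] e k assms by auto
  moreover have "m \<le> k"
    using assms(3) Cons a e k by simp
  ultimately show thesis using that(2) Cons a e k st by auto
qed

text \<open>
  A path that goes back to a vertex left behind is stuck: no diagonal at this vertex is left to
  cross, and the vertex is not \<open>b\<close>.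
\<close>

lemma even_dead:
  assumes "i < j" "j \<le> m" "m \<le> ntri T" "moving j = s"
    "walk T False (PolyV (vtx s i)) ls" "from_pos T (2 * m) ls"
  shows False
proof -
  have "i \<le> ntri T" using assms by simp
  from this assms(5,6) show False
  proof (cases rule: even_step)
    case 1
    then show ?thesis using assms by simp
  next
    case (2 k r)
    then show ?thesis using vtx_left[of i j k s] assms by simp
  qed
qed

lemma even_continue:
  assumes "m < ntri T" "walk T False (PolyV (vtx s m)) ls" "advancing T ls" "from_pos T (2 * m) ls"
    "\<And>w r. ls \<noteq> (TEdge (spoke m), w) # r"
  shows "s \<noteq> moving (Suc m)" "continuation (Suc m) (AtV s False) ls"
proof -
  have "m \<le> ntri T" using assms by simp
  from this assms(2,4) have "s \<noteq> moving (Suc m) \<and> continuation (Suc m) (AtV s False) ls"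
  proof (cases rule: even_step)
    case 1
    then show ?thesis using assms by simp
  next
    case (2 k r)
    then have k: "Suc m \<le> k" using assms(5) by (metis le_neq_implies_less Suc_leI)
    then have s: "s \<noteq> moving (Suc m)"
      using vtx_left[of m "Suc m" k s] 2 by auto
    have "vtx s (Suc m) = vtx s m" using vtx_stay_Suc[of m s] assms(1) s by auto
    moreover have "from_pos T (2 * Suc m) ls"
      using 2 k assms(3) from_pos_mono[of T "Suc (2 * k)" r "2 * Suc m"] by auto
    ultimately show ?thesis using s assms(2,3) by simp
  qed
  then show "s \<noteq> moving (Suc m)" "continuation (Suc m) (AtV s False) ls" by auto
qed

text \<open>
  Odd steps need not cross the arc, but stepping backwards along a side of the polygon leads to a
  vertex left behind, and stepping to the face center of a triangle already passed leads to
  \<open>\<tau>\<close>-edges that start before the current position. So only forward steps remain.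
\<close>

lemma odd_step:
  assumes "m \<le> ntri T" "walk T True (PolyV (vtx s m)) ls" "from_pos T (2 * m) ls"
  obtains (spoke) k r where "m \<le> k" "k \<le> ntri T" "vtx s k = vtx s m"
      "ls = (TEdge (spoke k), PolyV (vtx (\<not> s) k)) # r" "walk T False (PolyV (vtx (\<not> s) k)) r"
  | (rim) j r where "m < j" "j \<le> ntri T" "moving j = s" "vtx s (j - 1) = vtx s m"
      "ls = (TEdge (rim j), PolyV (vtx s j)) # r" "walk T False (PolyV (vtx s j)) r"
  | (sigma) j r where "m < j" "j \<le> ntri T" "moving j = s" "vtx s (j - 1) = vtx s m"
      "ls = (SigmaA j, FaceC j) # r" "walk T False (FaceC j) r"
proof -
  obtain e w r where ls: "ls = (e, w) # r" using assms(2) by (cases ls) auto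
  have st: "step_ok T True (PolyV (vtx s m)) e w" "walk T False w r"
    and fr: "from_pos T (2 * m) r"
    using assms ls by auto
  show thesis
  proof (cases e)
    case (TEdge f)
    have f: "f \<in> edges T" "{PolyV (vtx s m), w} = PolyV ` f"
      using st TEdge by (auto simp: step_ok_def)
    from f(1) consider k where "f = spoke k" "k \<le> ntri T" | j where "f = rim j" "1 \<le> j" "j \<le> ntri T"
      by (auto simp: edges_spoke_rim)
    then show thesis
    proof cases
      case 1
      have k: "vtx s k = vtx s m" "w = PolyV (vtx (\<not> s) k)"
        using vtx_in_spoke[of m k s w] f 1 assms by auto
      show thesis
      proof (cases "m \<le> k")
        case True
        then show thesis using spoke[of k r] k 1 ls TEdge st by auto
      next
        case False
        have "\<not> 1 \<le> k"
          using assms(1,3) ls TEdge 1 False by (cases "k = ntri T") auto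
        then have k0: "k = 0" by simp
        have "s \<noteq> moving 1"
          using vtx_left[of 0 1 m s] k k0 False assms by auto
        then have "moving 1 = (\<not> s)" by (cases s) auto
        then show thesis
          using even_dead[of 0 1 m "\<not> s" r] st k k0 False assms fr by auto
      qed
    next
      case 2
      have j: "moving j = s" "vtx s m = vtx s (j - 1) \<and> w = PolyV (vtx s j) \<or>
          vtx s m = vtx s j \<and> w = PolyV (vtx s (j - 1))"
        using vtx_in_rim[of m j s w] f 2 assms by auto
      from j(2) show thesis
      proof
        assume a: "vtx s m = vtx s (j - 1) \<and> w = PolyV (vtx s j)"
        then have "m < j"
          using vtx_left[of "j - 1" j m s] 2 j assms by (cases "m < j") auto
        then show thesis using rim[of j r] a j 2 ls TEdge st by auto
      next
        assume a: "vtx s m = vtx s j \<and> w = PolyV (vtx s (j - 1))"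
        then have "j \<le> m"
          using vtx_new[of m j] 2 j assms by (cases "j \<le> m") auto
        then show thesis
          using even_dead[of "j - 1" j m s r] st a 2 j assms fr by auto
      qed
    qed
  next
    case (SigmaA j)
    have j: "1 \<le> j" "j \<le> ntri T" "vtx s m = vtx (moving j) (j - 1)" "w = FaceC j"
      using st SigmaA by (auto simp: step_ok_def near_a_vtx doubleton_eq_iff)
    then have s: "moving j = s" using vtx_eq_sides[of m "j - 1" s "moving j"] assms by auto
    then have "m < j"
      using vtx_left[of "j - 1" j m s] j assms by (cases "m < j") auto
    then show thesis using sigma[of j r] j s ls SigmaA st by auto
  next
    case (SigmaB j)
    have j: "1 \<le> j" "j \<le> ntri T" "vtx s m = vtx (moving j) j" "w = FaceC j"
      using st SigmaB by (auto simp: step_ok_def near_b_vtx doubleton_eq_iff)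
    then have s: "moving j = s" using vtx_eq_sides[of m j s "moving j"] assms by auto
    then have jm: "j \<le> m"
      using vtx_new[of m j] j assms by (cases "j \<le> m") auto
    have w: "walk T False (FaceC j) r" using st j by simp
    obtain q r' where "r = (Tau j q, FaceC q) # r'"
      by (rule tau_step[OF w])
    then have "2 * m \<le> 2 * j - 1" using fr by simp
    then show thesis using jm j(1) by arith
  next
    case (Tau p q)
    then show thesis using st by (auto simp: step_ok_def)
  qed
qed

lemma face_odd_step:
  assumes "walk T True (FaceC q) ls"
  obtains (A) r where "ls = (SigmaA q, PolyV (vtx (moving q) (q - 1))) # r" "1 \<le> q" "q \<le> ntri T"
      "walk T False (PolyV (vtx (moving q) (q - 1))) r"
  | (B) r where "ls = (SigmaB q, PolyV (vtx (moving q) q)) # r" "1 \<le> q" "q \<le> ntri T"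
      "walk T False (PolyV (vtx (moving q) q)) r"
proof -
  obtain e w r where ls: "ls = (e, w) # r" using assms by (cases ls) auto
  have st: "step_ok T True (FaceC q) e w" "walk T False w r"
    using assms ls by auto
  show thesis
  proof (cases e)
    case (SigmaA j)
    then have "j = q" "1 \<le> q" "q \<le> ntri T" "w = PolyV (vtx (moving q) (q - 1))"
      using st by (auto simp: step_ok_def near_a_vtx doubleton_eq_iff)
    then show thesis using A[of r] ls st SigmaA by auto
  next
    case (SigmaB j)
    then have "j = q" "1 \<le> q" "q \<le> ntri T" "w = PolyV (vtx (moving q) q)"
      using st by (auto simp: step_ok_def near_b_vtx doubleton_eq_iff)
    then show thesis using B[of r] ls st SigmaB by auto
  qed (use st in \<open>auto simp: step_ok_def doubleton_eq_iff\<close>)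
qed


text \<open>
  Both ports of a state need the same port next, so exactly one of the two paths starts with
  \<open>x\<^sub>m\<close>.
\<close>

lemma path_steps_flip:
  assumes "\<And>w r. path_steps m (AtV s o') hs \<noteq> (TEdge (spoke m), w) # r"
  shows "path_steps m (AtV (\<not> s) (\<not> o')) hs =
    (TEdge (spoke m), PolyV (vtx s m)) # path_steps m (AtV s o') hs"
proof -
  have *: "switch m (AtV s o') Q = []" "Q = AtV s o'" "switch m (AtV (\<not> s) (\<not> o')) Q = [(TEdge (spoke m), PolyV (vtx s m))]"
    if "path_steps m (AtV s o') hs = switch m (AtV s o') Q @ rest" for Q rest
    using that assms by (auto simp: switch_def split: if_splits)
  have st: "port_state (AtV (\<not> s) (\<not> o')) = port_state (AtV s o')" by simp
  show ?thesis
  proof (cases hs)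
    case Nil
    then show ?thesis using *[of "AtV (moving m) False" "[]"] by simp
  next
    case (Cons s' h)
    have "\<exists>Q rest. \<forall>s o'. port_state (AtV s o') = t \<longrightarrow> path_steps m (AtV s o') (s' # h) = switch m (AtV s o') Q @ rest" for t
      by (cases "s' = t") (auto simp: Let_def simp del: port_state.simps)
    then obtain Q rest where "\<And>s'' o''. port_state (AtV s'' o'') = port_state (AtV s o') \<Longrightarrow>
        path_steps m (AtV s'' o'') hs = switch m (AtV s'' o'') Q @ rest"
      unfolding Cons by blast
    from this[OF refl] this[OF st] show ?thesis using *(1,3) by simp
  qed
qed

lemma path_steps_stay:
  assumes "m < ntri T" "legal (Suc m) s' hs" "s' = port_state P" "s \<noteq> moving (Suc m)" "P = AtV s o'"
  shows "legal m (port_state P) (s' # hs)" "path_steps m P (s' # hs) = path_steps (Suc m) P hs"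
proof -
  have s: "moving (Suc m) = (\<not> s)" using assms(4) by auto
  show "legal m (port_state P) (s' # hs)" "path_steps m P (s' # hs) = path_steps (Suc m) P hs"
    using assms by (auto simp: trans_ok_def switch_def s Let_def)
qed

text \<open>
  If the path does not step along \<open>x\<^sub>m\<close>, its next step decides the next state. A step that uses
  nothing of \<open>\<Delta>\<^sub>m\<^sub>+\<^sub>1\<close> starts at the endpoint that stays there, so the path can be regarded as a
  path from \<open>x\<^sub>m\<^sub>+\<^sub>1\<close> on.
\<close>

lemma continuation_path_steps_AtV:
  assumes IH: "\<And>P ls. m < ntri T \<Longrightarrow> continuation (Suc m) P ls \<Longrightarrow> (\<And>k. P = OnTau k \<Longrightarrow> 1 \<le> k \<and> k \<le> Suc m) \<Longrightarrow>
      \<exists>hs. legal (Suc m) (port_state P) hs \<and> ls = path_steps (Suc m) P hs"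
    and m: "m \<le> ntri T"
    and c: "continuation m (AtV s o') ls"
    and ns: "\<And>w r. ls \<noteq> (TEdge (spoke m), w) # r"
  shows "\<exists>hs. legal m (port_state (AtV s o')) hs \<and> ls = path_steps m (AtV s o') hs"
proof (cases "o'")
  case False
  note o = False
  have w: "walk T False (PolyV (vtx s m)) ls" "from_pos T (2 * m) ls" "advancing T ls"
    using c o by auto
  show ?thesis
  proof (cases "m = ntri T")
    case True
    from m w(1,2) show ?thesis
    proof (cases rule: even_step)
      case 1
      then have "legal m (port_state (AtV s o')) [] \<and> ls = path_steps m (AtV s o') []"
        using True o by (auto simp: switch_def)
      then show ?thesis by blast
    qed (use True in auto)
  next
    case False
    then have mn: "m < ntri T" using m by simp
    have s: "s \<noteq> moving (Suc m)" and c': "continuation (Suc m) (AtV s False) ls"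
      using even_continue[OF mn w(1,3,2) ns] by auto
    obtain hs where hs: "legal (Suc m) (port_state (AtV s False)) hs" "ls = path_steps (Suc m) (AtV s False) hs"
      using IH[OF mn c'] by blast
    show ?thesis
      using path_steps_stay[OF mn hs(1) refl s refl] hs(2) o by metis
  qed
next
  case True
  note o = True
  have w: "walk T True (PolyV (vtx s m)) ls" "from_pos T (2 * m) ls" "advancing T ls"
    using c o by auto
  have move: ?thesis
    if mn: "m < ntri T" and s: "s \<noteq> moving (Suc m)" and f: "from_pos T (2 * Suc m) ls"
  proof -
    have v: "vtx s (Suc m) = vtx s m" using vtx_stay_Suc[of m s] mn s by auto
    have c': "continuation (Suc m) (AtV s True) ls" using w f v by simp
    obtain hs where hs: "legal (Suc m) (port_state (AtV s True)) hs" "ls = path_steps (Suc m) (AtV s True) hs"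
      using IH[OF mn c'] by blast
    show ?thesis
      using path_steps_stay[OF mn hs(1) refl s refl] hs(2) o by metis
  qed
  \<comment> \<open>After a forward step the path is at a vertex not met before, beyond \<open>x\<^sub>m\<close>, so its next even
    step runs along \<open>x\<^sub>m\<^sub>+\<^sub>1\<close> or a later diagonal.\<close>
  have beyond: "from_pos T (2 * Suc m) r"
    if "i \<le> ntri T" "m < i" "walk T False (PolyV (vtx s' i)) r" "from_pos T (2 * m) r" "advancing T r"
      "\<And>k. k \<le> m \<Longrightarrow> vtx s' i \<noteq> vtx s' k" for r i s'
    using that(1,3,4)
  proof (cases rule: even_step)
    case (2 k r')
    then have "m < k" using that(2) that(6)[of k] by (cases "m < k") auto
    then show ?thesis
      using 2 that(5) from_pos_mono[of T "Suc (2 * k)" r' "2 * Suc m"] by auto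
  qed simp
  from m w(1,2) show ?thesis
  proof (cases rule: odd_step)
    case (spoke k r)
    have km: "m < k" using ns spoke by (cases "k = m") auto
    then have mn: "m < ntri T" using spoke by simp
    have s: "s \<noteq> moving (Suc m)"
      using vtx_left[of m "Suc m" k s] spoke km by auto
    have "from_pos T (2 * Suc m) ls"
    proof (cases "k = ntri T")
      case False
      then have "1 \<le> k" "k < ntri T" using spoke km by auto
      then show ?thesis
        using w(3) km spoke from_pos_mono[of T "Suc (2 * k)" r "2 * Suc m"] by auto
    next
      case True
      \<comment> \<open>\<open>x\<^sub>n\<close> itself does not cross the arc, so the position must come from the rest of the path.\<close>
      have "s \<noteq> moving (ntri T)"
        using vtx_left[of m "ntri T" "ntri T" s] spoke True km by auto
      have "from_pos T (2 * m) r" "advancing T r" using w spoke by auto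
      from spoke(2,5) this(1) have "from_pos T (2 * Suc m) r"
      proof (cases rule: even_step)
        case (2 k' r')
        have "moving (ntri T) = (\<not> s)" using \<open>s \<noteq> moving (ntri T)\<close> by auto
        then show ?thesis
          using vtx_new[of k' "ntri T"] 2 True by auto
      qed simp
      then show ?thesis using spoke True by auto
    qed
    then show ?thesis by (rule move[OF mn s])
  next
    case (rim j r)
    have mn: "m < ntri T" using rim by simp
    have fr: "from_pos T (2 * m) r" "advancing T r" using w rim by auto
    have b: "from_pos T (2 * Suc m) r"
      by (rule beyond[OF rim(2,1,6) fr]) (use vtx_new[of _ j] rim in auto)
    show ?thesis
    proof (cases "s = moving (Suc m)")
      case False
      have "from_pos T (2 * Suc m) ls" using rim b by auto
      then show ?thesis by (rule move[OF mn False])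
    next
      case True
      have j: "j = Suc m"
        using vtx_left[of m "Suc m" "j - 1" s] rim True by (cases "j = Suc m") auto
      have "continuation (Suc m) (AtV s False) r" using rim j b fr by simp
      then obtain hs where hs: "legal (Suc m) (port_state (AtV s False)) hs" "r = path_steps (Suc m) (AtV s False) hs"
        using IH[OF mn] by blast
      have "legal m (port_state (AtV s o')) (Some (\<not> s) # hs)"
        using hs o mn True by (simp add: trans_ok_def)
      moreover have "ls = path_steps m (AtV s o') (Some (\<not> s) # hs)"
        using rim hs j True o by (simp add: switch_def Let_def)
      ultimately show ?thesis by blast
    qed
  next
    case (sigma j r)
    have mn: "m < ntri T" using sigma by simp
    have fr: "from_pos T (2 * m) r" "advancing T r" using w sigma by auto
    obtain q r' where r: "r = (Tau j q, FaceC q) # r'" "1 \<le> j" "j < q" "q \<le> ntri T"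
      by (rule tau_step[OF sigma(6)])
    show ?thesis
    proof (cases "s = moving (Suc m)")
      case False
      then have "Suc m < j" using sigma by (cases "j = Suc m") auto
      then have "from_pos T (2 * Suc m) ls"
        using sigma r fr from_pos_mono[of T "2 * q" r' "2 * Suc m"] by auto
      then show ?thesis by (rule move[OF mn False])
    next
      case True
      have j: "j = Suc m"
        using vtx_left[of m "Suc m" "j - 1" s] sigma True by (cases "j = Suc m") auto
      have "continuation (Suc m) (OnTau (Suc m)) r" using sigma j fr r by simp
      then obtain hs where hs: "legal (Suc m) None hs" "r = path_steps (Suc m) (OnTau (Suc m)) hs"
        using IH[OF mn, of "OnTau (Suc m)" r] by auto
      have "legal m (port_state (AtV s o')) (None # hs)"
        using hs o mn True by (simp add: trans_ok_def)
      moreover have "ls = path_steps m (AtV s o') (None # hs)"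
        using sigma hs j True o by (simp add: switch_def Let_def)
      ultimately show ?thesis by blast
    qed
  qed
qed

lemma continuation_unflip:
  assumes "continuation m (AtV s o') ((TEdge (spoke m), w) # r)" "m \<le> ntri T"
  shows "w = PolyV (vtx (\<not> s) m)" "continuation m (AtV (\<not> s) (\<not> o')) r" "\<And>w' r'. r \<noteq> (TEdge (spoke m), w') # r'"
proof -
  have st: "step_ok T o' (PolyV (vtx s m)) (TEdge (spoke m)) w" "walk T (\<not> o') w r"
    using assms by auto
  have w: "w = PolyV (vtx (\<not> s) m)"
    using st(1) vtx_in_spoke(2)[of m m s w] assms(2) by (auto simp: step_ok_def)
  then show "w = PolyV (vtx (\<not> s) m)" "continuation m (AtV (\<not> s) (\<not> o')) r"
    using st assms by auto
  show "r \<noteq> (TEdge (spoke m), w') # r'" for w' r'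
  proof
    assume r: "r = (TEdge (spoke m), w') # r'"
    have "crosses (spoke m) {src T, tgt T}"
      using st r by (cases "o'") (auto simp: step_ok_def)
    then show False using assms r by auto
  qed
qed

text \<open>
  Induction from \<open>b\<close> backwards to \<open>a\<close>. A step along \<open>x\<^sub>m\<close> is cut off first; the rest leaves from
  the other port with the same state.
\<close>

lemma continuation_path_steps:
  assumes "m \<le> ntri T" "continuation m P ls" "\<And>k. P = OnTau k \<Longrightarrow> 1 \<le> k \<and> k \<le> m"
  shows "\<exists>hs. legal m (port_state P) hs \<and> ls = path_steps m P hs"
  using assms
proof (induction "ntri T - m" arbitrary: m P ls rule: less_induct)
  case less
  have IH: "\<exists>hs. legal (Suc m) (port_state P') hs \<and> ls' = path_steps (Suc m) P' hs"
    if "m < ntri T" "continuation (Suc m) P' ls'" "\<And>k. P' = OnTau k \<Longrightarrow> 1 \<le> k \<and> k \<le> Suc m" for P' ls'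
  proof (rule less.hyps)
    show "ntri T - Suc m < ntri T - m" "Suc m \<le> ntri T" using that(1) by auto
  qed (fact that)+
  have PA: "\<exists>hs. legal m (port_state (AtV s o')) hs \<and> ls' = path_steps m (AtV s o') hs"
    if "continuation m (AtV s o') ls'" "\<And>w r. ls' \<noteq> (TEdge (spoke m), w) # r" for s o' ls'
    using IH less.prems(1) that by (rule continuation_path_steps_AtV)
  show ?case
  proof (cases P)
    case (AtV s o')
    show ?thesis
    proof (cases "\<exists>w r. ls = (TEdge (spoke m), w) # r")
      case False
      then show ?thesis
        unfolding AtV using less.prems(2) by (intro PA) (simp_all add: AtV)
    next
      case True
      then obtain w r where ls: "ls = (TEdge (spoke m), w) # r" by blast
      note u = continuation_unflip[OF less.prems(2)[unfolded AtV ls] less.prems(1)]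
      obtain hs where hs: "legal m (port_state (AtV (\<not> s) (\<not> o'))) hs" "r = path_steps m (AtV (\<not> s) (\<not> o')) hs"
        using PA[OF u(2,3)] by blast
      have "path_steps m (AtV (\<not> \<not> s) (\<not> \<not> o')) hs = (TEdge (spoke m), PolyV (vtx (\<not> s) m)) # r"
        unfolding hs(2) by (rule path_steps_flip) (use u(3) hs(2) in auto)
      then have "ls = path_steps m P hs" using ls u(1) AtV by simp
      moreover have "legal m (port_state P) hs" using hs(1) AtV by (cases "o'") simp_all
      ultimately show ?thesis by blast
    qed
  next
    case (OnTau k)
    have w: "walk T False (FaceC k) ls" "advancing T ls" "\<exists>q>m. snd (hd ls) = FaceC q"
      using less.prems OnTau by auto
    obtain q r where ls: "ls = (Tau k q, FaceC q) # r" "1 \<le> k" "k < q" "q \<le> ntri T"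
      "walk T True (FaceC q) r"
      by (rule tau_step[OF w(1)])
    have mq: "m < q" using w ls by auto
    then have mn: "m < ntri T" using ls by simp
    have fr: "from_pos T (2 * q) r" "advancing T r" using w ls by auto
    show ?thesis
    proof (cases "q = Suc m")
      case False
      then have "continuation (Suc m) (OnTau k) ls" using w ls mq by auto
      then obtain hs where hs: "legal (Suc m) None hs" "ls = path_steps (Suc m) (OnTau k) hs"
        using IH[OF mn, of "OnTau k" ls] less.prems(3) OnTau by auto
      then have "legal m (port_state P) (None # hs) \<and> ls = path_steps m P (None # hs)"
        using OnTau mn by (simp add: trans_ok_def)
      then show ?thesis by blast
    next
      case True
      from ls(5) show ?thesis
      proof (cases rule: face_odd_step)
        case (A r')
        then show ?thesis
          using even_dead[of "q - 1" q q "moving q" r'] fr by auto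
      next
        case (B r')
        then have c: "continuation (Suc m) (AtV (moving q) False) r'"
          using fr True by auto
        then obtain hs where hs: "legal (Suc m) (Some (\<not> moving q)) hs" "r' = path_steps (Suc m) (AtV (moving q) False) hs"
          using IH[OF mn c] by auto
        then have "legal m (port_state P) (Some (\<not> moving q) # hs) \<and> ls = path_steps m P (Some (\<not> moving q) # hs)"
          using OnTau mn True ls B by (simp add: trans_ok_def)
        then show ?thesis by blast
      qed
    qed
  qed
qed

text \<open>
  Distinctness of the edges, which is condition T3, comes from freshness.
\<close>

lemma path_steps_bij:
  "bij_betw (path_steps 0 (AtV (moving 1) True)) {hs. legal 0 (Some (moving 1)) hs}
     {ls. walk T True (PolyV (src T)) ls \<and> advancing T ls \<and> distinct (map fst ls)}"
proof (rule bij_betw_imageI)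
  show "inj_on (path_steps 0 (AtV (moving 1) True)) {hs. legal 0 (Some (moving 1)) hs}"
    using path_steps_inj[of 0 "AtV (moving 1) True"] by (auto intro!: inj_onI)
  show "path_steps 0 (AtV (moving 1) True) ` {hs. legal 0 (Some (moving 1)) hs} =
     {ls. walk T True (PolyV (src T)) ls \<and> advancing T ls \<and> distinct (map fst ls)}"
    (is "?L = ?R")
  proof (intro equalityI subsetI)
    fix ls assume "ls \<in> ?L"
    then obtain hs where hs: "legal 0 (port_state (AtV (moving 1) True)) hs" "ls = path_steps 0 (AtV (moving 1) True) hs"
      by auto
    then show "ls \<in> ?R"
      using path_steps_continuation[OF hs(1)] path_steps_fresh[OF hs(1)] by (auto simp: src_vtx)
  next
    fix ls assume ls: "ls \<in> ?R"
    then have "continuation 0 (AtV (moving 1) True) ls"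
      by (auto simp: src_vtx from_pos_def)
    from continuation_path_steps[OF _ this] obtain hs where "legal 0 (port_state (AtV (moving 1) True)) hs"
      "ls = path_steps 0 (AtV (moving 1) True) hs" by auto
    then show "ls \<in> ?L" by auto
  qed
qed

end

section \<open>Twisted super T-paths as walks\<close>

lemma walk_nth:
  "walk T od v ls \<longleftrightarrow>
     (\<forall>i<length ls. step_ok T (od = even i) ((v # map snd ls) ! i) (fst (ls ! i)) (snd (ls ! i))) \<and>
     od = odd (length ls) \<and> (v # map snd ls) ! length ls = PolyV (tgt T)"
proof (induction ls arbitrary: od v)
  case (Cons a ls)
  obtain e w where a: "a = (e, w)" by fastforce
  show ?case
    unfolding a walk.simps Cons.IH by (auto simp: All_less_Suc2)
qed auto

lemma gvertices_simps [simp]: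
  "PolyV v \<in> gvertices T \<longleftrightarrow> v < ntri T + 2"
  "FaceC m \<in> gvertices T \<longleftrightarrow> 1 \<le> m \<and> m \<le> ntri T"
  by (auto simp: gvertices_def)

definition path_of :: "arc_triangulation \<Rightarrow> (gedge \<times> gvertex) list \<Rightarrow> gvertex list \<times> gedge list" where
  "path_of T ls = (PolyV (src T) # map snd ls, map fst ls)"

lemma ball_atLeast1: "(\<forall>s\<in>{1..l}. P s) \<longleftrightarrow> (\<forall>i<l. P (Suc i))"
  unfolding image_Suc_lessThan[symmetric] by auto

lemma path_of_twisted:
  assumes "src T < ntri T + 2" and ends: "\<And>e. e \<in> gedges T \<Longrightarrow> gends T e \<subseteq> gvertices T"
  shows "path_of T ls \<in> twisted_paths T \<longleftrightarrow>
    walk T True (PolyV (src T)) ls \<and> advancing T ls \<and> distinct (map fst ls)"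
proof -
  let ?v = "PolyV (src T) # map snd ls"
  have verts: "set ?v \<subseteq> gvertices T" if "\<forall>i<length ls. fst (ls ! i) \<in> gedges T \<and>
      gends T (fst (ls ! i)) = {?v ! i, snd (ls ! i)}"
  proof -
    have "snd (ls ! i) \<in> gvertices T" if "i < length ls" for i
      using ends[of "fst (ls ! i)"] \<open>\<forall>i<length ls. _\<close> that by auto
    then have "snd p \<in> gvertices T" if "p \<in> set ls" for p
      using that by (auto simp: in_set_conv_nth)
    then show ?thesis using assms(1) by (auto simp: gvertices_def)
  qed
  have adv: "advancing T ls \<longleftrightarrow> (\<forall>s<length ls. \<forall>r<length ls. s < r \<and> crosses_arc T (fst (ls ! s)) \<and>
      crosses_arc T (fst (ls ! r)) \<longrightarrow> closer_to_a T (fst (ls ! s)) (fst (ls ! r)))"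
    unfolding advancing_def sorted_wrt_iff_nth_less by (auto simp: advances_def)
  have dist: "distinct (map fst ls) \<longleftrightarrow> (\<forall>s<length ls. \<forall>r<length ls. s \<noteq> r \<longrightarrow> fst (ls ! s) \<noteq> fst (ls ! r))"
    unfolding distinct_conv_nth by (simp cong: imp_cong)
  have ok: "step_ok T (True = even i) v e u \<longleftrightarrow> (e \<in> gedges T \<and> gends T e = {v, u}) \<and>
      (odd i \<longrightarrow> crosses_arc T e) \<and> (\<forall>p q. is_tau e \<and> v = FaceC p \<and> u = FaceC q \<longrightarrow> p < q) \<and>
      (is_sigma e \<longrightarrow> even i) \<and> (is_tau e \<longrightarrow> odd i)" for i v e u
    unfolding step_ok_def by (cases "even i"; simp; blast)
  have w: "walk T True (PolyV (src T)) ls \<longleftrightarrow>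
     (\<forall>i<length ls. fst (ls ! i) \<in> gedges T \<and> gends T (fst (ls ! i)) = {?v ! i, snd (ls ! i)}) \<and>
     (\<forall>i<length ls. odd i \<longrightarrow> crosses_arc T (fst (ls ! i))) \<and>
     (\<forall>i<length ls. \<forall>p q. is_tau (fst (ls ! i)) \<and> ?v ! i = FaceC p \<and> snd (ls ! i) = FaceC q \<longrightarrow> p < q) \<and>
     (\<forall>i<length ls. (is_sigma (fst (ls ! i)) \<longrightarrow> even i) \<and> (is_tau (fst (ls ! i)) \<longrightarrow> odd i)) \<and>
     odd (length ls) \<and> ?v ! length ls = PolyV (tgt T)"
    unfolding walk_nth ok imp_conjR all_conj_distrib by (simp only: conj_assoc simp_thms)
  have "path_of T ls \<in> twisted_paths T \<longleftrightarrow>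
     set ?v \<subseteq> gvertices T \<and> ?v ! length ls = PolyV (tgt T) \<and>
     (\<forall>i<length ls. fst (ls ! i) \<in> gedges T \<and> gends T (fst (ls ! i)) = {?v ! i, snd (ls ! i)}) \<and>
     (\<forall>s<length ls. \<forall>r<length ls. s \<noteq> r \<longrightarrow> fst (ls ! s) \<noteq> fst (ls ! r)) \<and>
     odd (length ls) \<and>
     (\<forall>i<length ls. odd i \<longrightarrow> crosses_arc T (fst (ls ! i))) \<and>
     (\<forall>i<length ls. \<forall>p q. is_tau (fst (ls ! i)) \<and> ?v ! i = FaceC p \<and> snd (ls ! i) = FaceC q \<longrightarrow> p < q) \<and>
     (\<forall>i<length ls. (is_sigma (fst (ls ! i)) \<longrightarrow> even i) \<and> (is_tau (fst (ls ! i)) \<longrightarrow> odd i)) \<and>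
     (\<forall>s<length ls. \<forall>r<length ls. s < r \<and> crosses_arc T (fst (ls ! s)) \<and>
      crosses_arc T (fst (ls ! r)) \<longrightarrow> closer_to_a T (fst (ls ! s)) (fst (ls ! r)))"
    unfolding path_of_def twisted_paths_def mem_Collect_eq prod.case Let_def ball_atLeast1
    by (simp only: nth_map length_map length_Cons nth_Cons_0 nth_Cons_Suc diff_Suc_1 even_Suc
        Suc_less_eq nat.inject not_not add_Suc_right add_0_right One_nat_def diff_Suc_Suc diff_zero simp_thms cong: imp_cong)
  then show ?thesis using verts w adv dist by blast
qed

lemma twisted_path_of:
  assumes "t \<in> twisted_paths T"
  obtains ls where "t = path_of T ls"
proof -
  obtain as ts where t: "t = (as, ts)" by fastforce
  have l: "length as = Suc (length ts)" "as ! 0 = PolyV (src T)"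
    using assms by (auto simp: t twisted_paths_def Let_def)
  then obtain as' where as: "as = PolyV (src T) # as'" "length as' = length ts"
    by (cases as) auto
  then have "t = path_of T (zip ts as')" by (simp add: t path_of_def)
  then show thesis by (rule that)
qed

context arc_skeleton
begin

lemma path_of_bij:
  "bij_betw (path_of T) {ls. walk T True (PolyV (src T)) ls \<and> advancing T ls \<and> distinct (map fst ls)}
     (twisted_paths T)"
proof (rule bij_betw_imageI)
  have src: "src T < ntri T + 2" using vtx_bound[of 0] by (simp add: src_vtx)
  have bound: "m \<le> ntri T \<Longrightarrow> vtx s m < Suc (Suc (ntri T))" for s m
    using vtx_bound[of m s] by simp
  have ends: "gends T e \<subseteq> gvertices T" if "e \<in> gedges T" for e
  proof (cases e)
    case (TEdge f)
    then have "f \<in> edges T" using that by simp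
    then have "f \<subseteq> {..<ntri T + 2}"
      using bound by (auto simp: edges_spoke_rim spoke_def rim_def)
    then show ?thesis using TEdge by auto
  qed (use that in \<open>auto simp: near_a_vtx near_b_vtx intro!: bound\<close>)
  note * = path_of_twisted[OF src ends]
  show "inj_on (path_of T) {ls. walk T True (PolyV (src T)) ls \<and> advancing T ls \<and> distinct (map fst ls)}"
    by (rule inj_onI) (auto simp: path_of_def intro: pair_list_eqI)
  show "path_of T ` {ls. walk T True (PolyV (src T)) ls \<and> advancing T ls \<and> distinct (map fst ls)} =
     twisted_paths T"
  proof (intro equalityI subsetI)
    fix t assume t: "t \<in> twisted_paths T"
    then obtain ls where "t = path_of T ls" by (rule twisted_path_of)
    with t show "t \<in> path_of T ` {ls. walk T True (PolyV (src T)) ls \<and> advancing T ls \<and> distinct (map fst ls)}"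
      using * by blast
  qed (use * in blast)
qed

end

section \<open>Weights of paths\<close>

text \<open>
  A monomial with a whole exponent vector, so that identities between products of powers of
  different variables become linear identities between exponents.
\<close>

definition even_mono :: "(nat set \<Rightarrow>\<^sub>0 rat) \<Rightarrow> even_ring" where
  "even_mono v = Poly_Mapping.single v 1"

lemma even_mono_simps:
  "var_pow e q = even_mono (Poly_Mapping.single e q)"
  "even_mono u * even_mono v = even_mono (u + v)"
  by (simp_all add: even_mono_def var_pow_def mult_single)

lemma even_mono_0 [simp]: "even_mono 0 = 1"
  by (simp add: even_mono_def)

fun path_even :: "arc_triangulation \<Rightarrow> bool \<Rightarrow> gedge list \<Rightarrow> even_ring" where
  "path_even T od [] = 1"
| "path_even T od (e # es) = twt_even T (if od then 1 else 0) e * path_even T (\<not> od) es"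

lemma twt_even_parity: "odd i = odd j \<Longrightarrow> twt_even T i e = twt_even T j e"
  by (cases e) auto

lemma path_even_prod:
  "(\<Prod>i<length es. twt_even T (if od then Suc i else i) (es ! i)) = path_even T od es"
proof (induction es arbitrary: od)
  case (Cons e es)
  have "(\<Prod>i<length es. twt_even T (if od then Suc (Suc i) else Suc i) (es ! i)) =
      (\<Prod>i<length es. twt_even T (if \<not> od then Suc i else i) (es ! i))"
    by (rule prod.cong) (auto intro: twt_even_parity)
  then show ?case
    unfolding Cons.IH by (simp add: prod.lessThan_Suc_shift del: prod.lessThan_Suc)
qed simp

lemma twt_path_of:
  "twt T (path_of T ls) = gscale (path_even T True (map fst ls))
     (pos_ordered_prod T (sum_list (map twt_odd (map fst ls))))"
  unfolding twt_def path_of_def prod.case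
  using path_even_prod[of T True "map fst ls"]
  by (simp add: prod.atLeast1_atMost_eq sum.atLeast1_atMost_eq sum_list_sum_nth atLeast0LessThan)

text \<open>
  The position of a state in the order that governs triangles moving on the side \<open>s\<close>. For covers
  it is the number of elements which the vertex on the side \<open>s\<close> receives from below.
\<close>

definition lower_degree :: "bool \<Rightarrow> bool option \<Rightarrow> nat" where
  "lower_degree s h = (case h of None \<Rightarrow> 1 | Some s' \<Rightarrow> if s' = s then 0 else 2)"

lemma lower_degree_simps [simp]: "lower_degree s None = 1" "lower_degree s (Some s') = (if s' = s then 0 else 2)"
  by (auto simp: lower_degree_def)

context arc_skeleton
begin

lemma sides_at:
  assumes "A \<noteq> B" "A \<noteq> C" "B \<noteq> (C::nat)"
  shows "{e. e \<subseteq> {A, B, C} \<and> card e = 2 \<and> A \<in> e} = {{A, B}, {A, C}}"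
  using assms by (auto simp: card_2_iff)

lemma sigma_coeff_a:
  assumes "1 \<le> m" "m \<le> ntri T"
  shows "sigma_coeff T m (near_a T m) =
    var_pow (spoke (m - 1)) (1/2) * var_pow (rim m) (1/2) * var_pow (spoke m) (-1/2)"
proof -
  have spoke: "spoke (m - 1) = {vtx (moving m) (m - 1), vtx (\<not> moving m) m}" "spoke m = {vtx (moving m) m, vtx (\<not> moving m) m}"
    using spoke_sides[of "m - 1" "moving m"] spoke_sides[of m "moving m"] vtx_stay[OF assms] by auto
  have ne: "vtx (moving m) (m - 1) \<noteq> vtx (moving m) m" "vtx (moving m) (m - 1) \<noteq> vtx (\<not> moving m) m"
     "vtx (moving m) m \<noteq> vtx (\<not> moving m) m"
    using vtx_new[of "m - 1" m] assms by auto
  have "tri T m - {near_a T m} = spoke m"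
    using ne unfolding tri_vtx[OF assms] near_a_vtx[OF assms] spoke by auto
  moreover have "{e. e \<subseteq> tri T m \<and> card e = 2 \<and> near_a T m \<in> e} = {rim m, spoke (m - 1)}"
    unfolding tri_vtx[OF assms] near_a_vtx[OF assms] spoke rim_def by (rule sides_at) (use ne in auto)
  moreover have "rim m \<noteq> spoke (m - 1)" using assms by simp
  ultimately show ?thesis by (simp add: sigma_coeff_def mult_ac)
qed

lemma sigma_coeff_b:
  assumes "1 \<le> m" "m \<le> ntri T"
  shows "sigma_coeff T m (near_b T m) =
    var_pow (spoke m) (1/2) * var_pow (rim m) (1/2) * var_pow (spoke (m - 1)) (-1/2)"
proof -
  have spoke: "spoke (m - 1) = {vtx (moving m) (m - 1), vtx (\<not> moving m) m}" "spoke m = {vtx (moving m) m, vtx (\<not> moving m) m}"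
    using spoke_sides[of "m - 1" "moving m"] spoke_sides[of m "moving m"] vtx_stay[OF assms] by auto
  have ne: "vtx (moving m) m \<noteq> vtx (moving m) (m - 1)" "vtx (moving m) (m - 1) \<noteq> vtx (\<not> moving m) m"
     "vtx (moving m) m \<noteq> vtx (\<not> moving m) m"
    using vtx_new[of "m - 1" m] assms by auto
  have "tri T m - {near_b T m} = spoke (m - 1)"
    using ne unfolding tri_vtx[OF assms] near_b_vtx[OF assms] spoke by auto
  moreover have "{e. e \<subseteq> tri T m \<and> card e = 2 \<and> near_b T m \<in> e} = {rim m, spoke m}"
  proof -
    have t: "tri T m = {vtx (moving m) m, vtx (moving m) (m - 1), vtx (\<not> moving m) m}"
      "rim m = {vtx (moving m) m, vtx (moving m) (m - 1)}"
      using tri_vtx[OF assms] by (auto simp: rim_def)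
    show ?thesis
      unfolding near_b_vtx[OF assms] spoke t by (rule sides_at) (use ne in auto)
  qed
  moreover have "rim m \<noteq> spoke m" using assms by simp
  ultimately show ?thesis by (simp add: sigma_coeff_def mult_ac)
qed

text \<open>
  The factor of \<open>\<Delta>\<^sub>m\<close> in the even weight. The exponents of \<open>g\<^sub>m\<close> (the third side of \<open>\<Delta>\<^sub>m\<close>),
  \<open>x\<^sub>m\<^sub>-\<^sub>1\<close> and \<open>x\<^sub>m\<close> are half the multiplicities in the cover, and the factor \<open>1/x\<^sub>m\<close> from the
  crossing monomial is divided equally between the two triangles at \<open>x\<^sub>m\<close>.
\<close>

definition tri_wt :: "nat \<Rightarrow> bool option \<Rightarrow> bool option \<Rightarrow> even_ring" where
  "tri_wt m s s' =
     var_pow (rim m) ((of_nat (lower_degree (moving m) s') - of_nat (lower_degree (moving m) s)) / 2) *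
     var_pow (spoke (m - 1)) ((of_nat (lower_degree (\<not> moving m) s') - 1) / 2) *
     var_pow (spoke m) ((of_nat (lower_degree (moving m) s) - 1) / 2)"

fun states_even :: "nat \<Rightarrow> bool option \<Rightarrow> bool option list \<Rightarrow> even_ring" where
  "states_even m s [] = var_pow (spoke m) (1/2)"
| "states_even m s (s' # hs) = tri_wt (Suc m) s s' * states_even (Suc m) s' hs"

fun states_odd :: "nat \<Rightarrow> bool option \<Rightarrow> bool option list \<Rightarrow> nat multiset" where
  "states_odd m s [] = {#}"
| "states_odd m s (s' # hs) =
     (if (s = None) = (s' = None) then {#} else {#Suc m#}) + states_odd (Suc m) s' hs"

fun port_odd :: "port \<Rightarrow> bool" where
  "port_odd (AtV s od) = od"
| "port_odd (OnTau k) = False"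

text \<open>
  The exponent of \<open>x\<^sub>m\<close> by which a path from this port exceeds the factors of the remaining
  triangles. A switch from even to odd parity divides by \<open>x\<^sub>m\<close> and one from odd to even multiplies
  by it, so the two ports of a vertex state differ by \<open>1\<close>.
\<close>

fun port_exp :: "port \<Rightarrow> rat" where
  "port_exp (AtV s od) = (if od then 1/2 else -1/2)"
| "port_exp (OnTau k) = 0"

lemma switch_even:
  assumes "Q = AtV s' o''" "Q = AtV s o' \<or> Q = AtV (\<not> s) (\<not> o')"
  shows "path_even T o' (map fst (switch m (AtV s o') Q @ ls)) =
    even_mono (Poly_Mapping.single (spoke m) (port_exp (AtV s o') - port_exp Q)) * path_even T o'' (map fst ls)"
  using assms by (auto simp: switch_def even_mono_simps split: if_splits)

lemma path_steps_even:
  assumes "legal m (port_state P) hs"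
  shows "path_even T (port_odd P) (map fst (path_steps m P hs)) =
    var_pow (spoke m) (port_exp P) * states_even m (port_state P) hs"
  using assms
proof (induction hs arbitrary: m P)
  case Nil
  then obtain s o' where P: "P = AtV s o'" "Some (if o' then s else \<not> s) = Some (\<not> moving m)" "m = ntri T"
    by (cases P) auto
  then have Q: "AtV (moving m) False = AtV s o' \<or> AtV (moving m) False = AtV (\<not> s) (\<not> o')"
    by (auto split: if_splits)
  show ?case
    using switch_even[OF refl Q, of m "[]"] unfolding P(1)
    by (simp add: even_mono_simps flip: single_add)
next
  case (Cons s' hs)
  define M where "M = moving (Suc m)"
  have m: "m < ntri T" "trans_ok M (port_state P) s'" "legal (Suc m) s' hs"
    using Cons.prems by (auto simp: M_def)
  have IH: "path_even T (port_odd Q) (map fst (path_steps (Suc m) Q hs)) =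
    even_mono (Poly_Mapping.single (spoke (Suc m)) (port_exp Q)) * states_even (Suc m) s' hs" if "port_state Q = s'" for Q
    using Cons.IH[of "Suc m" Q] m that by (simp add: even_mono_simps)
  note step = sigma_coeff_a[of "Suc m"] sigma_coeff_b[of "Suc m"]
  define R where "R = states_even (Suc m) s' hs"
  define U where "U = Poly_Mapping.single (spoke m) (port_exp P) +
    (Poly_Mapping.single (rim (Suc m)) ((of_nat (lower_degree M s') - of_nat (lower_degree M (port_state P))) / 2) +
     Poly_Mapping.single (spoke m) ((of_nat (lower_degree (\<not> M) s') - 1) / 2) +
     Poly_Mapping.single (spoke (Suc m)) ((of_nat (lower_degree M (port_state P)) - 1) / 2))"
  have goal: "var_pow (spoke m) (port_exp P) * states_even m (port_state P) (s' # hs) = even_mono U * R"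
    by (simp only: states_even.simps tri_wt_def even_mono_simps mult.assoc[symmetric] diff_Suc_1 U_def M_def R_def)
  have IH: "path_even T (port_odd Q) (map fst (path_steps (Suc m) Q hs)) =
    even_mono (Poly_Mapping.single (spoke (Suc m)) (port_exp Q)) * R" if "port_state Q = s'" for Q
    using IH[OF that] by (simp add: R_def)
  show ?case
  proof (cases P)
    case (OnTau k)
    show ?thesis
    proof (cases "s' = None")
      case True
      have "U = 0" unfolding U_def using True OnTau by simp
      then show ?thesis unfolding goal using OnTau True IH[of "OnTau k"] by simp
    next
      case False
      then have s': "s' = Some (\<not> M)" using m OnTau by (auto simp: trans_ok_def)
      define V :: "nat set \<Rightarrow>\<^sub>0 rat" where "V = Poly_Mapping.single (spoke (Suc m)) (1/2) + Poly_Mapping.single (rim (Suc m)) (1/2) +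
            Poly_Mapping.single (spoke m) (-1/2) + Poly_Mapping.single (spoke (Suc m)) (-1/2)"
      have "path_even T False (map fst (path_steps m P (s' # hs))) = even_mono V * R"
        using IH[of "AtV M False"] step m s' OnTau
        by (simp add: M_def even_mono_simps mult.assoc[symmetric] add.assoc[symmetric] V_def)
      moreover have "V = U"
        by (rule poly_mapping_eqI) (use OnTau s' in \<open>simp add: V_def U_def lookup_add lookup_single when_def\<close>)
      ultimately show ?thesis unfolding goal using OnTau by simp
    qed
  next
    case (AtV s o')
    show ?thesis
    proof (cases "s' = port_state P")
      case True
      define Q where "Q = AtV (\<not> M) (s' \<noteq> Some M)"
      have Q: "port_state Q = s'" using True AtV by (auto simp: Q_def)
      have Q2: "Q = AtV s o' \<or> Q = AtV (\<not> s) (\<not> o')"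
        using True AtV by (auto simp: Q_def)
      define V :: "nat set \<Rightarrow>\<^sub>0 rat" where "V = Poly_Mapping.single (spoke m) (port_exp P - port_exp Q) + Poly_Mapping.single (spoke (Suc m)) (port_exp Q)"
      have "path_steps m P (s' # hs) = switch m P Q @ path_steps (Suc m) Q hs"
        using AtV True by (auto simp: Q_def M_def Let_def)
      then have "path_even T o' (map fst (path_steps m P (s' # hs))) = even_mono V * R"
        using switch_even[OF Q_def Q2, of m] IH[OF Q] unfolding AtV V_def
        by (simp add: even_mono_simps(2)[symmetric] mult.assoc Q_def del: path_steps.simps port_exp.simps)
      moreover have "V = U"
      proof (rule poly_mapping_eqI)
        fix k
        obtain t where "port_state P = Some t" using AtV by simp
        then show "Poly_Mapping.lookup V k = Poly_Mapping.lookup U k"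
          using True by (cases "t = M")
            (simp_all add: V_def U_def Q_def lookup_add lookup_single when_def diff_divide_distrib)
      qed
      ultimately show ?thesis unfolding goal using AtV by simp
    next
      case False
      have s': "port_state P = Some M" "s' = None \<or> s' = Some (\<not> M)"
        using trans_ok_cases[of M s o' s'] m(2) False unfolding AtV by auto
      have Q2: "AtV M True = AtV s o' \<or> AtV M True = AtV (\<not> s) (\<not> o')"
        using s' AtV by (auto split: if_splits)
      show ?thesis
      proof (cases "s' = None")
        case True
        define V :: "nat set \<Rightarrow>\<^sub>0 rat" where "V = Poly_Mapping.single (spoke m) (port_exp P - 1/2) +
          (Poly_Mapping.single (spoke m) (1/2) + Poly_Mapping.single (rim (Suc m)) (1/2) +
            Poly_Mapping.single (spoke (Suc m)) (-1/2))"
        have "path_steps m P (s' # hs) = switch m P (AtV M True) @ (SigmaA (Suc m), FaceC (Suc m)) # path_steps (Suc m) (OnTau (Suc m)) hs"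
          using AtV False True by (auto simp: M_def Let_def)
        then have "path_even T o' (map fst (path_steps m P (s' # hs))) =
            even_mono (Poly_Mapping.single (spoke m) (port_exp P - 1/2)) *
            path_even T True (map fst ((SigmaA (Suc m), FaceC (Suc m)) # path_steps (Suc m) (OnTau (Suc m)) hs))"
          using switch_even[OF refl Q2, of m "(SigmaA (Suc m), FaceC (Suc m)) # path_steps (Suc m) (OnTau (Suc m)) hs"]
          unfolding AtV by (simp only: port_exp.simps if_True)
        also have "path_even T True (map fst ((SigmaA (Suc m), FaceC (Suc m)) # path_steps (Suc m) (OnTau (Suc m)) hs)) =
            even_mono (Poly_Mapping.single (spoke m) (1/2) + Poly_Mapping.single (rim (Suc m)) (1/2) +
              Poly_Mapping.single (spoke (Suc m)) (-1/2)) * R"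
          using IH[of "OnTau (Suc m)"] True step m
          by (simp add: even_mono_simps)
        finally have "path_even T o' (map fst (path_steps m P (s' # hs))) = even_mono V * R"
          by (simp only: V_def mult.assoc[symmetric] even_mono_simps)
        moreover have "V = U"
          by (rule poly_mapping_eqI) (use True s' in \<open>simp add: V_def U_def lookup_add lookup_single when_def\<close>)
        ultimately show ?thesis unfolding goal using AtV by simp
      next
        case N: False
        define V :: "nat set \<Rightarrow>\<^sub>0 rat" where "V = Poly_Mapping.single (spoke m) (port_exp P - 1/2) + (Poly_Mapping.single (rim (Suc m)) 1 +
            Poly_Mapping.single (spoke (Suc m)) (-1/2))"
        have "path_steps m P (s' # hs) = switch m P (AtV M True) @ (TEdge (rim (Suc m)), PolyV (vtx M (Suc m))) # path_steps (Suc m) (AtV M False) hs"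
          using AtV False N by (auto simp: M_def Let_def)
        then have "path_even T o' (map fst (path_steps m P (s' # hs))) =
            even_mono (Poly_Mapping.single (spoke m) (port_exp P - 1/2)) *
            path_even T True (map fst ((TEdge (rim (Suc m)), PolyV (vtx M (Suc m))) # path_steps (Suc m) (AtV M False) hs))"
          using switch_even[OF refl Q2, of m "(TEdge (rim (Suc m)), PolyV (vtx M (Suc m))) # path_steps (Suc m) (AtV M False) hs"]
          unfolding AtV by (simp only: port_exp.simps if_True)
        also have "path_even T True (map fst ((TEdge (rim (Suc m)), PolyV (vtx M (Suc m))) # path_steps (Suc m) (AtV M False) hs)) =
            even_mono (Poly_Mapping.single (rim (Suc m)) 1 + Poly_Mapping.single (spoke (Suc m)) (-1/2)) * R"
          using IH[of "AtV M False"] N s'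
          by (auto simp: even_mono_simps mult.assoc[symmetric])
        finally have "path_even T o' (map fst (path_steps m P (s' # hs))) = even_mono V * R"
          by (simp only: V_def mult.assoc[symmetric] even_mono_simps)
        moreover have "V = U"
          by (rule poly_mapping_eqI) (use N s' in \<open>auto simp: V_def U_def lookup_add lookup_single when_def\<close>)
        ultimately show ?thesis unfolding goal using AtV by simp
      qed
    qed
  qed
qed

lemma path_steps_odd:
  assumes "legal m (port_state P) hs"
  shows "sum_list (map twt_odd (map fst (path_steps m P hs))) = states_odd m (port_state P) hs"
  using assms
proof (induction hs arbitrary: m P)
  case Nil
  then show ?case by (cases P) (auto simp: switch_def)
next
  case (Cons s' hs)
  define M where "M = moving (Suc m)"
  have m: "trans_ok M (port_state P) s'" "legal (Suc m) s' hs"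
    using Cons.prems by (auto simp: M_def)
  have IH: "sum_list (map twt_odd (map fst (path_steps (Suc m) Q hs))) = states_odd (Suc m) s' hs" if "port_state Q = s'" for Q
    using Cons.IH[of "Suc m" Q] m that by simp
  show ?case
  proof (cases P)
    case (OnTau k)
    then show ?thesis
      using IH[of "OnTau k"] IH[of "AtV M False"] m by (auto simp: trans_ok_def M_def)
  next
    case (AtV s o')
    show ?thesis
    proof (cases "s' = port_state P")
      case True
      define Q where "Q = AtV (\<not> M) (s' \<noteq> Some M)"
      have Q: "port_state Q = s'" using True AtV by (auto simp: Q_def)
      have "path_steps m P (s' # hs) = switch m P Q @ path_steps (Suc m) Q hs"
        using AtV True by (auto simp: Q_def M_def Let_def)
      then show ?thesis using IH[OF Q] True by (simp add: switch_def del: path_steps.simps)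
    next
      case False
      have s': "port_state P = Some M" "s' = None \<or> s' = Some (\<not> M)"
        using trans_ok_cases[of M s o' s'] m(1) False unfolding AtV by auto
      have "path_steps m P (s' # hs) = switch m P (AtV M True) @
        (if s' = None then (SigmaA (Suc m), FaceC (Suc m)) # path_steps (Suc m) (OnTau (Suc m)) hs
         else (TEdge (rim (Suc m)), PolyV (vtx M (Suc m))) # path_steps (Suc m) (AtV M False) hs)"
        using AtV False by (auto simp: M_def Let_def)
      then show ?thesis
        using IH[of "OnTau (Suc m)"] IH[of "AtV M False"] s' by (auto simp: switch_def simp del: path_steps.simps)
    qed
  qed
qed

end

context arc_skeleton
begin

section \<open>The snake graph level by level\<close>

text \<open>
  The grid point at distance \<open>m\<close> from the lowest corner that corresponds to the endpoint of \<open>x\<^sub>m\<close>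
  on the side \<open>s\<close>. For \<open>0 < m < n\<close> these are the top-left and bottom-right corners of the tile
  \<open>T\<^sub>m\<close>, and the left endpoint is at the top-left exactly for odd \<open>m\<close>. The first and last levels
  have one point each.
\<close>

definition corner :: "nat \<Rightarrow> bool \<Rightarrow> nat \<times> nat" where
  "corner m s = (if m = 0 then (0, 0)
     else if m = ntri T then (fst (tile_pos T (m - 1)) + 1, snd (tile_pos T (m - 1)) + 1)
     else if s = odd m then (fst (tile_pos T m), snd (tile_pos T m) + 1)
     else (fst (tile_pos T m) + 1, snd (tile_pos T m)))"

text \<open>
  \<open>(m, s, s')\<close> encodes the edge from the side \<open>s\<close> at level \<open>m - 1\<close> to the side \<open>s'\<close> at level \<open>m\<close>.
\<close>

fun grid_edge :: "nat \<times> bool \<times> bool \<Rightarrow> (nat \<times> nat) set" where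
  "grid_edge (m, s, s') = {corner (m - 1) s, corner m s'}"

fun code_label :: "nat \<times> bool \<times> bool \<Rightarrow> nat set" where
  "code_label (m, s, s') = {vtx s (m - 1), vtx s' m}"

text \<open>
  With \<open>M\<close> the moving side of \<open>\<Delta>\<^sub>m\<close>, the codes \<open>(m, M, M)\<close>, \<open>(m, M, \<not> M)\<close> and \<open>(m, \<not> M, M)\<close> stand
  for the third side of \<open>\<Delta>\<^sub>m\<close>, for \<open>x\<^sub>m\<^sub>-\<^sub>1\<close> and for \<open>x\<^sub>m\<close>. In the first and in the last triangle
  one of them is missing, because the only vertex at level \<open>0\<close> or \<open>n\<close> is on the moving side.
\<close>

definition codes :: "(nat \<times> bool \<times> bool) set" where
  "codes = {(m, s, s'). 1 \<le> m \<and> m \<le> ntri T \<and> (s = moving m \<or> s' = moving m) \<and>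
     (m = 1 \<longrightarrow> s = moving m) \<and> (m = ntri T \<longrightarrow> s' = moving m)}"

lemma codes_iff: "(m, s, s') \<in> codes \<longleftrightarrow> 1 \<le> m \<and> m \<le> ntri T \<and> (s = moving m \<or> s' = moving m) \<and>
     (m = 1 \<longrightarrow> s = moving m) \<and> (m = ntri T \<longrightarrow> s' = moving m)"
  by (simp add: codes_def)

lemma finite_codes: "finite codes"
  by (rule finite_subset[of _ "{1..ntri T} \<times> UNIV \<times> UNIV"]) (auto simp: codes_def)

lemma tile_third_vertices:
  assumes "1 \<le> m" "m < ntri T"
  shows "(THE z. z \<in> tri T m \<and> z \<notin> dg T m) = vtx (moving m) (m - 1)"
    and "(THE z. z \<in> tri T (Suc m) \<and> z \<notin> dg T m) = vtx (moving (Suc m)) (Suc m)"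
proof -
  have "vtx (moving m) m \<noteq> vtx (moving m) (m - 1)" "vtx (moving m) (m - 1) \<noteq> vtx (\<not> moving m) m"
    using vtx_new[of "m - 1" m] assms by auto
  then show "(THE z. z \<in> tri T m \<and> z \<notin> dg T m) = vtx (moving m) (m - 1)"
    using assms tri_vtx[of m] dg_spoke[of m] spoke_sides[of m "moving m"] by (intro the_equality) auto
  have "vtx (moving (Suc m)) (Suc m) \<noteq> vtx (moving (Suc m)) m" "vtx (moving (Suc m)) (Suc m) \<noteq> vtx (\<not> moving (Suc m)) m"
    using vtx_new[of m "Suc m"] assms by auto
  then show "(THE z. z \<in> tri T (Suc m) \<and> z \<notin> dg T m) = vtx (moving (Suc m)) (Suc m)"
    using assms tri_vtx[of "Suc m"] dg_spoke[of m] spoke_sides[of m "moving (Suc m)"] vtx_stay[of "Suc m"]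
    by (intro the_equality) auto
qed

fun side_code :: "nat \<Rightarrow> tile_side \<Rightarrow> nat \<times> bool \<times> bool" where
  "side_code m SLeft = (m, moving m, odd m)"
| "side_code m SBottom = (m, moving m, even m)"
| "side_code m STop = (Suc m, odd m, moving (Suc m))"
| "side_code m SRight = (Suc m, even m, moving (Suc m))"

lemma side_label_code:
  assumes "1 \<le> m" "m < ntri T"
  shows "side_label T m d = code_label (side_code m d)"
  unfolding side_label_def tile_third_vertices[OF assms] ends_vtx[OF assms]
  by (cases d; cases "odd m"; simp)

lemma third_side:
  assumes "A \<noteq> B" "A \<noteq> C" "B \<noteq> (C::nat)"
  shows "(THE e. e \<subseteq> {A, B, C} \<and> card e = 2 \<and> e \<noteq> {A, C} \<and> e \<noteq> {B, C}) = {A, B}"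
proof (rule the_equality)
  show "{A, B} \<subseteq> {A, B, C} \<and> card {A, B} = 2 \<and> {A, B} \<noteq> {A, C} \<and> {A, B} \<noteq> {B, C}"
    using assms by (auto simp: doubleton_eq_iff)
  fix e assume e: "e \<subseteq> {A, B, C} \<and> card e = 2 \<and> e \<noteq> {A, C} \<and> e \<noteq> {B, C}"
  then obtain a b where ab: "e = {a, b}" "a \<noteq> b" by (auto simp: card_2_iff)
  have "a \<in> {A, B, C}" "b \<in> {A, B, C}" using e ab by auto
  then show "e = {A, B}"
    using e ab(2) unfolding ab(1) by (elim insertE emptyE; simp add: insert_commute)
qed

text \<open>
  The right side of \<open>T\<^sub>m\<close> starts at its bottom-right corner, which is on the left of the arc
  exactly for even \<open>m\<close>; it is labelled by the third side of \<open>\<Delta>\<^sub>m\<^sub>+\<^sub>1\<close> if this corner is on the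
  moving side.
\<close>

lemma goes_right_iff:
  assumes "1 \<le> m" "Suc m < ntri T"
  shows "goes_right T m \<longleftrightarrow> moving (Suc m) = even m"
proof -
  define M where "M = moving (Suc m)"
  have spoke: "dg T m = {vtx M m, vtx (\<not> M) (Suc m)}" "dg T (Suc m) = {vtx M (Suc m), vtx (\<not> M) (Suc m)}"
    using assms dg_spoke[of m] dg_spoke[of "Suc m"] spoke_sides[of m M] spoke_sides[of "Suc m" M]
      vtx_stay[of "Suc m"] by (auto simp: M_def)
  have t: "tri T (Suc m) = {vtx M m, vtx M (Suc m), vtx (\<not> M) (Suc m)}"
    using tri_vtx[of "Suc m"] assms by (simp add: M_def)
  have ne: "vtx M (Suc m) \<noteq> vtx M m" "vtx M (Suc m) \<noteq> vtx (\<not> M) (Suc m)" "vtx M m \<noteq> vtx (\<not> M) (Suc m)"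
    using vtx_new[of m "Suc m"] assms by (auto simp: M_def)
  have the: "(THE e. e \<subseteq> tri T (Suc m) \<and> card e = 2 \<and> e \<noteq> dg T m \<and> e \<noteq> dg T (Suc m)) = {vtx M m, vtx M (Suc m)}"
    unfolding spoke t by (rule third_side) (use ne in auto)
  have "side_label T m SRight = {vtx (even m) m, vtx M (Suc m)}"
    using side_label_code[of m SRight] assms by (simp add: M_def)
  moreover have "{vtx (even m) m, vtx M (Suc m)} = {vtx M m, vtx M (Suc m)} \<longleftrightarrow> M = even m"
    using vtx_eq_sides[of m m "even m" M] vtx_eq_sides[of m "Suc m" "even m" M] assms ne
    by (auto simp: doubleton_eq_iff)
  ultimately show ?thesis unfolding goes_right_def the by (simp add: M_def)
qed

lemma tile_pos_1: "tile_pos T (Suc 0) = (0, 0)"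
  by (simp add: tile_pos_def)

lemma tile_pos_Suc:
  assumes "1 \<le> m"
  shows "tile_pos T (Suc m) = (if goes_right T m then (Suc (fst (tile_pos T m)), snd (tile_pos T m))
    else (fst (tile_pos T m), Suc (snd (tile_pos T m))))"
proof -
  have "{1..<Suc m} = insert m {1..<m}" using assms by auto
  then have "{k \<in> {1..<Suc m}. P k} = (if P m then insert m {k \<in> {1..<m}. P k} else {k \<in> {1..<m}. P k})" for P
    by auto
  then show ?thesis by (simp add: tile_pos_def)
qed

lemma tile_pos_sum: "1 \<le> m \<Longrightarrow> fst (tile_pos T m) + snd (tile_pos T m) = m - 1"
proof (induction m rule: dec_induct)
  case (step m)
  then show ?case by (auto simp: tile_pos_Suc)
qed (simp add: tile_pos_1)

lemma corner_level: "m \<le> ntri T \<Longrightarrow> fst (corner m s) + snd (corner m s) = m"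
  using tile_pos_sum[of m] tile_pos_sum[of "m - 1"] ntri_ge by (auto simp: corner_def)

lemma corner_eq_iff:
  assumes "m \<le> ntri T" "k \<le> ntri T"
  shows "corner m s = corner k t \<longleftrightarrow> m = k \<and> (0 < m \<and> m < ntri T \<longrightarrow> s = t)"
  using corner_level[OF assms(1), of s] corner_level[OF assms(2), of t]
    assms by (cases "m = k") (auto simp: corner_def)

lemma grid_edge_inj: "inj_on grid_edge codes"
proof (rule inj_onI)
  fix c d assume cd: "c \<in> codes" "d \<in> codes" "grid_edge c = grid_edge d"
  obtain m s s' k t t' where c: "c = (m, s, s')" and d: "d = (k, t, t')"
    by (metis prod_cases3)
  have mk: "1 \<le> m" "m \<le> ntri T" "1 \<le> k" "k \<le> ntri T"
    using cd by (auto simp: c d codes_iff)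
  then have "(corner (m - 1) s = corner (k - 1) t \<and> corner m s' = corner k t') \<or>
    (corner (m - 1) s = corner k t' \<and> corner m s' = corner (k - 1) t)"
    using cd(3) by (auto simp: c d doubleton_eq_iff)
  then have "m = k" "(0 < m - 1 \<longrightarrow> s = t)" "(m < ntri T \<longrightarrow> s' = t')"
    using corner_eq_iff[of "m - 1" "k - 1" s t] corner_eq_iff[of m k s' t']
      corner_eq_iff[of "m - 1" k s t'] corner_eq_iff[of m "k - 1" s' t] mk by auto
  then show "c = d" using cd(1,2) by (cases "m = 1"; cases "m = ntri T"; auto simp: c d codes_iff)
qed

text \<open>
  Consecutive tiles are glued along the edge between the moving endpoints, so the lowest corner of
  a tile and the highest corner of the previous one lie on the moving side.
\<close>

lemma corner_bottom_left: "1 \<le> m \<Longrightarrow> m < ntri T \<Longrightarrow> corner (m - 1) (moving m) = tile_pos T m"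
proof (cases "m = 1")
  case False
  assume m: "1 \<le> m" "m < ntri T"
  then obtain k where k: "m = Suc k" "1 \<le> k" using False by (cases m) auto
  then show ?thesis
    using goes_right_iff[of k] m tile_pos_Suc[of k] by (auto simp: corner_def)
qed (simp add: corner_def tile_pos_1)

lemma corner_top_right: "1 \<le> m \<Longrightarrow> m < ntri T \<Longrightarrow>
  corner (Suc m) (moving (Suc m)) = (Suc (fst (tile_pos T m)), Suc (snd (tile_pos T m)))"
proof (cases "Suc m = ntri T")
  case True
  then have "ntri T - 1 = m" by simp
  then show ?thesis using True by (simp add: corner_def)
qed (use goes_right_iff[of m] tile_pos_Suc[of m] in \<open>auto simp: corner_def\<close>)

lemma side_edge_code:
  assumes "1 \<le> m" "m < ntri T"
  shows "side_edge T m d = grid_edge (side_code m d)"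
  using corner_bottom_left[OF assms] corner_top_right[OF assms] assms
  by (cases d) (auto simp: side_edge_def corner_def split: prod.splits)

lemma side_code_codes:
  assumes "1 \<le> m" "m < ntri T"
  shows "side_code m d \<in> codes"
  using assms by (cases d) (auto simp: codes_iff)

lemma tile_codes:
  "range (side_code m) = {(m, moving m, True), (m, moving m, False), (Suc m, True, moving (Suc m)), (Suc m, False, moving (Suc m))}"
proof -
  have "UNIV = {SLeft, SBottom, STop, SRight}" by (auto intro: tile_side.exhaust)
  then have "range (side_code m) = side_code m ` {SLeft, SBottom, STop, SRight}" by simp
  then show ?thesis by (cases "odd m") auto
qed

lemma tile_edges_code:
  assumes "1 \<le> m" "m < ntri T"
  shows "tile_edges T m = grid_edge ` range (side_code m)"
  using side_edge_code[OF assms] by (auto simp: tile_edges_def)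

lemma snake_edges_code: "snake_edges T = grid_edge ` codes"
proof -
  have "codes = (\<Union>m\<in>{1..<ntri T}. range (side_code m))"
  proof (intro equalityI subsetI)
    fix c assume "c \<in> (\<Union>m\<in>{1..<ntri T}. range (side_code m))"
    then show "c \<in> codes" using side_code_codes by auto
  next
    fix c assume c: "c \<in> codes"
    obtain m s s' where mss: "c = (m, s, s')" by (metis prod_cases3)
    show "c \<in> (\<Union>m\<in>{1..<ntri T}. range (side_code m))"
    proof (cases "s = moving m \<and> m < ntri T")
      case True
      then have "c \<in> range (side_code m)" unfolding tile_codes mss by (cases s') auto
      then show ?thesis using True c mss by (auto simp: codes_iff)
    next
      case False
      then have m: "2 \<le> m" "s' = moving m" "m \<le> ntri T" using c mss ntri_ge by (cases "m = 1"; auto simp: codes_iff)+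
      then have "c \<in> range (side_code (m - 1))" unfolding tile_codes mss by (cases s) auto
      then show ?thesis using m by (intro UN_I[of "m - 1"]) auto
    qed
  qed
  then show ?thesis
    unfolding snake_edges_def using tile_edges_code by (simp add: image_UN)
qed

lemma edge_label_code:
  assumes "c \<in> codes"
  shows "edge_label T (grid_edge c) = code_label c"
  unfolding edge_label_def
proof (rule the_equality)
  have "grid_edge c \<in> snake_edges T" using assms snake_edges_code by blast
  then obtain m d where md: "m \<in> {1..<ntri T}" "grid_edge c = side_edge T m d"
    by (auto simp: snake_edges_def tile_edges_def)
  moreover have "side_label T m d = code_label c" if "m \<in> {1..<ntri T}" "grid_edge c = side_edge T m d" for m d
    using that side_edge_code[of m d] side_code_codes[of m d] side_label_code[of m d]
      inj_onD[OF grid_edge_inj _ assms, of "side_code m d"] by auto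
  ultimately show "\<exists>m\<in>{1..<ntri T}. \<exists>d. grid_edge c = side_edge T m d \<and> code_label c = side_label T m d"
    by metis
  show "l = code_label c" if "\<exists>m\<in>{1..<ntri T}. \<exists>d. grid_edge c = side_edge T m d \<and> l = side_label T m d" for l
    using that \<open>\<And>m d. m \<in> {1..<ntri T} \<Longrightarrow> grid_edge c = side_edge T m d \<Longrightarrow> side_label T m d = code_label c\<close>
    by auto
qed

lemma snake_vertices_corner: "snake_vertices T = {corner m s | m s. m \<le> ntri T}"
proof (intro equalityI subsetI)
  fix v assume "v \<in> snake_vertices T"
  then obtain m s s' where "(m, s, s') \<in> codes" "v \<in> {corner (m - 1) s, corner m s'}"
    by (auto simp: snake_vertices_def snake_edges_code)
  moreover have "m - 1 \<le> ntri T" "m \<le> ntri T" using calculation(1) by (auto simp: codes_iff)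
  ultimately show "v \<in> {corner m s | m s. m \<le> ntri T}" by blast
next
  fix v assume "v \<in> {corner m s | m s. m \<le> ntri T}"
  then obtain m s where v: "v = corner m s" "m \<le> ntri T" by blast
  consider "m = 0" | "m = ntri T" | "0 < m" "m < ntri T" using v by linarith
  then have "\<exists>c\<in>codes. v \<in> grid_edge c"
  proof cases
    case 1
    then show ?thesis
      using ntri_ge v by (intro bexI[of _ "(1, moving 1, moving 1)"]) (auto simp: codes_iff corner_def)
  next
    case 2
    then show ?thesis
      using ntri_ge v by (intro bexI[of _ "(ntri T, moving (ntri T), moving (ntri T))"]) (auto simp: codes_iff corner_def)
  next
    case 3
    then show ?thesis
      using v by (intro bexI[of _ "(m, moving m, s)"]) (auto simp: codes_iff)
  qed
  then show "v \<in> snake_vertices T" by (auto simp: snake_vertices_def snake_edges_code)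
qed

end

section \<open>Double dimer covers from states\<close>

lemma trans_ok_lower_degree: "trans_ok M s s' \<longleftrightarrow> lower_degree M s \<le> lower_degree M s'"
  by (auto simp: trans_ok_def lower_degree_def split: option.splits)

lemma lower_degree_not: "lower_degree (\<not> M) s = 2 - lower_degree M s"
  by (auto simp: lower_degree_def split: option.splits)

lemma lower_degree_le: "lower_degree M s \<le> 2"
  by (auto simp: lower_degree_def split: option.splits)

lemma lower_degree_eq_iff: "lower_degree M s = lower_degree M s' \<longleftrightarrow> s = s'"
  by (auto simp: lower_degree_def split: option.splits if_splits)

lemma lower_degree_1: "lower_degree M s = 1 \<longleftrightarrow> s = None"
  by (auto simp: lower_degree_def split: option.splits)

lemma size_filter_sum:
  assumes "finite A" "set_mset M \<subseteq> A"
  shows "size (filter_mset P M) = (\<Sum>e\<in>{e\<in>A. P e}. count M e)"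
proof -
  have "size (filter_mset P M) = (\<Sum>e\<in>set_mset (filter_mset P M). count (filter_mset P M) e)"
    by (simp add: size_multiset_overloaded_eq)
  also have "\<dots> = (\<Sum>e\<in>{e\<in>A. P e}. count (filter_mset P M) e)"
    using assms by (intro sum.mono_neutral_left) (auto simp: not_in_iff)
  also have "\<dots> = (\<Sum>e\<in>{e\<in>A. P e}. count M e)"
    by (rule sum.cong) auto
  finally show ?thesis .
qed

context arc_skeleton
begin

lemma legal_iff:
  "legal m s hs \<longleftrightarrow> m + length hs = ntri T \<and> (s # hs) ! length hs = Some (\<not> moving (ntri T)) \<and>
     (\<forall>i<length hs. trans_ok (moving (Suc (m + i))) ((s # hs) ! i) (hs ! i))"
proof (induction hs arbitrary: m s)
  case (Cons s' hs)
  show ?case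
    unfolding legal.simps Cons.IH by (auto simp: All_less_Suc2)
qed auto

text \<open>
  Multiplicities by codes, with \<open>0\<close> for edges that do not exist; then the degree formulas have the
  same form at every level.
\<close>

definition code_count :: "(nat \<times> nat) set multiset \<Rightarrow> nat \<Rightarrow> bool \<Rightarrow> bool \<Rightarrow> nat" where
  "code_count D m s s' = (if (m, s, s') \<in> codes then count D (grid_edge (m, s, s')) else 0)"

lemma degree_sum:
  assumes "set_mset D \<subseteq> snake_edges T" "finite A" "{c \<in> codes. v \<in> grid_edge c} = codes \<inter> A"
  shows "size {#e \<in># D. v \<in> e#} = (\<Sum>(m, s, s')\<in>A. code_count D m s s')"
proof -
  have "size {#e \<in># D. v \<in> e#} = (\<Sum>e\<in>{e \<in> grid_edge ` codes. v \<in> e}. count D e)"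
    using assms(1) finite_codes unfolding snake_edges_code by (intro size_filter_sum) auto
  also have "{e \<in> grid_edge ` codes. v \<in> e} = grid_edge ` {c \<in> codes. v \<in> grid_edge c}"
    by auto
  also have "(\<Sum>e\<in>grid_edge ` {c \<in> codes. v \<in> grid_edge c}. count D e) =
      (\<Sum>c\<in>codes \<inter> A. count D (grid_edge c))"
    using inj_on_subset[OF grid_edge_inj] unfolding assms(3) by (subst sum.reindex) (auto simp: inj_on_subset)
  also have "\<dots> = (\<Sum>c\<in>A. if c \<in> codes then count D (grid_edge c) else 0)"
    using assms(2) by (simp add: sum.inter_restrict Int_commute)
  also have "\<dots> = (\<Sum>(m, s, s')\<in>A. code_count D m s s')"
    by (rule sum.cong) (auto simp: code_count_def)
  finally show ?thesis .
qed

lemma degree_inner: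
  assumes "set_mset D \<subseteq> snake_edges T" "0 < k" "k < ntri T"
  shows "size {#e \<in># D. corner k s \<in> e#} =
    code_count D k True s + code_count D k False s + (code_count D (Suc k) s True + code_count D (Suc k) s False)"
proof -
  have "{c \<in> codes. corner k s \<in> grid_edge c} =
      codes \<inter> {(k, True, s), (k, False, s), (Suc k, s, True), (Suc k, s, False)}"
  proof (intro equalityI subsetI)
    fix c assume c: "c \<in> {c \<in> codes. corner k s \<in> grid_edge c}"
    obtain m t t' where mt: "c = (m, t, t')" by (metis prod_cases3)
    have "1 \<le> m" "m \<le> ntri T" "corner k s = corner (m - 1) t \<or> corner k s = corner m t'"
      using c by (auto simp: mt codes_iff)
    then have "(m = Suc k \<and> s = t) \<or> (m = k \<and> s = t')"
      using corner_eq_iff[of k "m - 1" s t] corner_eq_iff[of k m s t'] assms by auto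
    then show "c \<in> codes \<inter> {(k, True, s), (k, False, s), (Suc k, s, True), (Suc k, s, False)}"
      using c by (cases t; cases t') (auto simp: mt)
  qed auto
  from degree_sum[OF assms(1) _ this] show ?thesis by simp
qed

lemma degree_first:
  assumes "set_mset D \<subseteq> snake_edges T"
  shows "size {#e \<in># D. corner 0 s \<in> e#} =
    code_count D 1 True True + code_count D 1 False True + (code_count D 1 True False + code_count D 1 False False)"
proof -
  have "{c \<in> codes. corner 0 s \<in> grid_edge c} =
      codes \<inter> {(1, True, True), (1, False, True), (1, True, False), (1, False, False)}"
  proof (intro equalityI subsetI)
    fix c assume c: "c \<in> {c \<in> codes. corner 0 s \<in> grid_edge c}"
    obtain m t t' where mt: "c = (m, t, t')" by (metis prod_cases3)
    have "1 \<le> m" "m \<le> ntri T" "corner 0 s = corner (m - 1) t \<or> corner 0 s = corner m t'"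
      using c by (auto simp: mt codes_iff)
    then have "m = 1"
      using corner_eq_iff[of 0 "m - 1" s t] corner_eq_iff[of 0 m s t'] by auto
    then show "c \<in> codes \<inter> {(1, True, True), (1, False, True), (1, True, False), (1, False, False)}"
      using c by (cases t; cases t') (auto simp: mt)
  qed (auto simp: corner_def)
  from degree_sum[OF assms(1) _ this] show ?thesis by simp
qed

lemma degree_last:
  assumes "set_mset D \<subseteq> snake_edges T"
  shows "size {#e \<in># D. corner (ntri T) s \<in> e#} =
    code_count D (ntri T) True True + code_count D (ntri T) False True + (code_count D (ntri T) True False + code_count D (ntri T) False False)"
proof -
  let ?n = "ntri T"
  have "{c \<in> codes. corner ?n s \<in> grid_edge c} =
      codes \<inter> {(?n, True, True), (?n, False, True), (?n, True, False), (?n, False, False)}"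
  proof (intro equalityI subsetI)
    fix c assume c: "c \<in> {c \<in> codes. corner ?n s \<in> grid_edge c}"
    obtain m t t' where mt: "c = (m, t, t')" by (metis prod_cases3)
    have "1 \<le> m" "m \<le> ?n" "corner ?n s = corner (m - 1) t \<or> corner ?n s = corner m t'"
      using c by (auto simp: mt codes_iff)
    then have "m = ?n"
      using corner_eq_iff[of ?n "m - 1" s t] corner_eq_iff[of ?n m s t'] by auto
    then show "c \<in> codes \<inter> {(?n, True, True), (?n, False, True), (?n, True, False), (?n, False, False)}"
      using c by (cases t; cases t') (auto simp: mt)
  qed (auto simp: corner_eq_iff)
  from degree_sum[OF assms(1) _ this] show ?thesis by simp
qed

lemma double_dimers_iff:
  "D \<in> double_dimers T \<longleftrightarrow> set_mset D \<subseteq> snake_edges T \<and>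
    (\<forall>k s. 0 < k \<and> k < ntri T \<longrightarrow>
      code_count D k True s + code_count D k False s + (code_count D (Suc k) s True + code_count D (Suc k) s False) = 2) \<and>
    code_count D 1 True True + code_count D 1 False True + (code_count D 1 True False + code_count D 1 False False) = 2 \<and>
    code_count D (ntri T) True True + code_count D (ntri T) False True +
      (code_count D (ntri T) True False + code_count D (ntri T) False False) = 2"
    (is "_ \<longleftrightarrow> _ \<and> ?R")
proof (cases "set_mset D \<subseteq> snake_edges T")
  case True
  have "(\<forall>v\<in>snake_vertices T. size {#e \<in># D. v \<in> e#} = 2) \<longleftrightarrow>
      (\<forall>k s. k \<le> ntri T \<longrightarrow> size {#e \<in># D. corner k s \<in> e#} = 2)"
    unfolding snake_vertices_corner by blast
  also have "\<dots> \<longleftrightarrow> (\<forall>k s. 0 < k \<and> k < ntri T \<longrightarrow> size {#e \<in># D. corner k s \<in> e#} = 2) \<and>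
      (\<forall>s. size {#e \<in># D. corner 0 s \<in> e#} = 2) \<and> (\<forall>s. size {#e \<in># D. corner (ntri T) s \<in> e#} = 2)"
    by (metis le_neq_implies_less less_imp_le_nat neq0_conv order_refl zero_le)
  also have "\<dots> \<longleftrightarrow> ?R"
    using degree_inner[OF True] unfolding degree_first[OF True] degree_last[OF True] by auto
  finally show ?thesis using True by (simp add: double_dimers_def)
qed (simp add: double_dimers_def)

text \<open>
  The multiplicities forced by the states: between two levels, one of the two edges that change
  sides is the only one to enter the nonmoving vertex from below, and the other one is the only
  one to leave the nonmoving vertex upwards. The third edge supplies what is missing at the moving
  vertex.
\<close>

definition state_mult :: "(nat \<Rightarrow> bool option) \<Rightarrow> nat \<times> bool \<times> bool \<Rightarrow> nat" where
  "state_mult h = (\<lambda>(m, s, s').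
     if s = moving m then
       if s' = moving m then lower_degree (moving m) (h m) - lower_degree (moving m) (h (m - 1)) else lower_degree (\<not> moving m) (h m)
     else if s' = moving m then lower_degree (moving m) (h (m - 1)) else 0)"

definition cover :: "(nat \<Rightarrow> bool option) \<Rightarrow> (nat \<times> nat) set multiset" where
  "cover h = (\<Sum>c\<in>codes. replicate_mset (state_mult h c) (grid_edge c))"

definition legal_fun :: "(nat \<Rightarrow> bool option) \<Rightarrow> bool" where
  "legal_fun h \<longleftrightarrow> h 0 = Some (moving 1) \<and> h (ntri T) = Some (\<not> moving (ntri T)) \<and>
     (\<forall>m. 1 \<le> m \<and> m \<le> ntri T \<longrightarrow> lower_degree (moving m) (h (m - 1)) \<le> lower_degree (moving m) (h m))"

lemma states_cong:
  assumes "\<And>k. k \<le> ntri T \<Longrightarrow> h k = h' k"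
  shows "legal_fun h \<longleftrightarrow> legal_fun h'" "cover h = cover h'"
proof -
  show "legal_fun h \<longleftrightarrow> legal_fun h'"
    unfolding legal_fun_def using assms by (simp add: le_diff_conv cong: conj_cong imp_cong)
  show "cover h = cover h'"
    unfolding cover_def using assms by (intro sum.cong) (auto simp: codes_iff state_mult_def)
qed

lemma count_cover:
  assumes "c \<in> codes"
  shows "count (cover h) (grid_edge c) = state_mult h c"
proof -
  have "count (cover h) (grid_edge c) =
      (\<Sum>d\<in>codes. if d = c then state_mult h c else 0)"
    unfolding cover_def count_sum using assms inj_onD[OF grid_edge_inj]
    by (intro sum.cong) auto
  then show ?thesis using assms finite_codes by simp
qed

lemma set_cover: "set_mset (cover h) \<subseteq> snake_edges T"
  unfolding snake_edges_code cover_def using finite_codes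
  by (auto simp: set_mset_sum split: if_splits)

lemma code_count_cover:
  assumes "legal_fun h" "1 \<le> m" "m \<le> ntri T"
  shows "code_count (cover h) m s s' = state_mult h (m, s, s')"
proof (cases "(m, s, s') \<in> codes")
  case False
  then have "(s \<noteq> moving m \<and> s' \<noteq> moving m) \<or> (m = 1 \<and> s \<noteq> moving m) \<or> (m = ntri T \<and> s' \<noteq> moving m)"
    using assms by (auto simp: codes_iff)
  then have "state_mult h (m, s, s') = 0"
    using assms(1) by (auto simp: state_mult_def legal_fun_def lower_degree_not)
  then show ?thesis using False by (simp add: code_count_def)
qed (simp add: code_count_def count_cover del: grid_edge.simps)

lemma code_count_cover_in:
  assumes "legal_fun h" "1 \<le> m" "m \<le> ntri T"
  shows "code_count (cover h) m True s + code_count (cover h) m False s = lower_degree s (h m)"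
proof -
  have "code_count (cover h) m (moving m) s + code_count (cover h) m (\<not> moving m) s = lower_degree s (h m)"
    using assms by (cases "s = moving m") (auto simp: code_count_cover state_mult_def legal_fun_def)
  then show ?thesis by (cases "moving m") auto
qed

lemma code_count_cover_out:
  assumes "legal_fun h" "1 \<le> m" "m \<le> ntri T"
  shows "code_count (cover h) m s True + code_count (cover h) m s False = 2 - lower_degree s (h (m - 1))"
proof -
  have le: "lower_degree (moving m) (h (m - 1)) \<le> lower_degree (moving m) (h m)" "lower_degree (moving m) (h m) \<le> 2"
    using assms lower_degree_le by (auto simp: legal_fun_def)
  have "code_count (cover h) m s (moving m) + code_count (cover h) m s (\<not> moving m) = 2 - lower_degree s (h (m - 1))"
  proof (cases "s = moving m")
    case True
    then show ?thesis using assms le lower_degree_not[of "moving m" "h m"] by (simp add: code_count_cover state_mult_def)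
  next
    case False
    then have s: "s = (\<not> moving m)" by auto
    then show ?thesis using assms le lower_degree_not[of "moving m" "h (m - 1)"] by (simp add: code_count_cover state_mult_def)
  qed
  then show ?thesis by (cases "moving m") auto
qed

lemma cover_double_dimer:
  assumes "legal_fun h"
  shows "cover h \<in> double_dimers T"
  unfolding double_dimers_iff
proof (intro conjI allI impI set_cover)
  have n: "1 \<le> ntri T" using ntri_ge by simp
  show "code_count (cover h) k True s + code_count (cover h) k False s +
      (code_count (cover h) (Suc k) s True + code_count (cover h) (Suc k) s False) = 2"
    if "0 < k \<and> k < ntri T" for k s
    using code_count_cover_in[OF assms, of k s] code_count_cover_out[OF assms, of "Suc k" s] that lower_degree_le[of s "h k"]
    by auto
  have *: "lower_degree True s + lower_degree False s = 2" for s
    by (auto simp: lower_degree_def split: option.splits)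
  show "code_count (cover h) 1 True True + code_count (cover h) 1 False True +
      (code_count (cover h) 1 True False + code_count (cover h) 1 False False) = 2"
    using code_count_cover_in[OF assms, of 1 True] code_count_cover_in[OF assms, of 1 False] n *[of "h 1"] by auto
  show "code_count (cover h) (ntri T) True True + code_count (cover h) (ntri T) False True +
      (code_count (cover h) (ntri T) True False + code_count (cover h) (ntri T) False False) = 2"
    using code_count_cover_in[OF assms n, of True] code_count_cover_in[OF assms n, of False] *[of "h (ntri T)"] by auto
qed

lemma cover_inj:
  assumes "legal_fun h" "legal_fun h'" "cover h = cover h'" "m \<le> ntri T"
  shows "h m = h' m"
proof (cases "m = 0")
  case False
  then have "lower_degree True (h m) = lower_degree True (h' m)"
    using code_count_cover_in[OF assms(1), of m True] code_count_cover_in[OF assms(2), of m True] assms(3,4) by simp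
  then show ?thesis by (simp add: lower_degree_eq_iff)
qed (use assms in \<open>simp add: legal_fun_def\<close>)

text \<open>
  Let \<open>inn k s\<close> and \<open>out (k + 1) s\<close> count the elements that the vertex on the side \<open>s\<close> of level
  \<open>k\<close> receives from below and from above. The lowest corner has degree two, so \<open>inn 1\<close> has total
  two. If \<open>inn k\<close> has total two, then so has \<open>out (k + 1)\<close>, as the degrees at level \<open>k\<close> add up to
  four, and \<open>out (k + 1)\<close> and \<open>inn (k + 1)\<close> count the same elements.
\<close>

lemma double_dimer_cover:
  assumes D: "D \<in> double_dimers T"
  obtains h where "legal_fun h" "D = cover h"
proof -
  define inn where "inn k s = code_count D k True s + code_count D k False s" for k s
  define out where "out k s = code_count D k s True + code_count D k s False" for k s
  have n: "1 \<le> ntri T" "2 \<le> ntri T" using ntri_ge by auto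
  have sub: "set_mset D \<subseteq> snake_edges T"
    and io: "\<And>k s. 0 < k \<Longrightarrow> k < ntri T \<Longrightarrow> inn k s + out (Suc k) s = 2"
    and first: "inn 1 True + inn 1 False = 2"
    using D unfolding double_dimers_iff by (auto simp: inn_def out_def)
  have tot: "inn k True + inn k False = 2" if "1 \<le> k" "k \<le> ntri T" for k
    using that
  proof (induction k rule: dec_induct)
    case (step k)
    have "out (Suc k) True + out (Suc k) False = inn (Suc k) True + inn (Suc k) False"
      by (simp add: inn_def out_def)
    then show ?case using step io[of k True] io[of k False] by simp
  qed (use first in simp)
  define h where "h k = (if k = 0 then Some (moving 1) else if inn k True = 0 then Some True
      else if inn k True = 1 then None else Some False)" for k
  have dv: "lower_degree s (h k) = inn k s" if "1 \<le> k" "k \<le> ntri T" for k s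
    using tot[OF that] that by (cases s) (auto simp: h_def)
  \<comment> \<open>There is no edge between the nonmoving vertices, and none from or to the missing vertices of
    the first and the last level.\<close>
  have zero: "code_count D m (\<not> moving m) (\<not> moving m) = 0" "code_count D 1 (\<not> moving 1) s = 0"
    "code_count D (ntri T) s (\<not> moving (ntri T)) = 0" for m s
    by (auto simp: code_count_def codes_iff)
  have inM: "inn m s = code_count D m (moving m) s + code_count D m (\<not> moving m) s" for m s
    by (cases "moving m") (auto simp: inn_def)
  have outM: "out m s = code_count D m s (moving m) + code_count D m s (\<not> moving m)" for m s
    by (cases "moving m") (auto simp: out_def)
  have slant: "code_count D m (\<not> moving m) (moving m) = lower_degree (moving m) (h (m - 1))" if "1 \<le> m" "m \<le> ntri T" for m
  proof (cases "m = 1")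
    case True
    then show ?thesis using zero(2)[of "moving 1"] by (simp add: h_def)
  next
    case False
    then have "inn (m - 1) (\<not> moving m) + out m (\<not> moving m) = 2" using io[of "m - 1"] that by auto
    moreover have "lower_degree (\<not> moving m) (h (m - 1)) = inn (m - 1) (\<not> moving m)" using dv[of "m - 1"] False that by auto
    ultimately show ?thesis
      using zero(1)[of m] lower_degree_not[of "moving m" "h (m - 1)"] lower_degree_le[of "moving m" "h (m - 1)"]
      unfolding outM by arith
  qed
  have M: "lower_degree (moving m) (h m) = code_count D m (moving m) (moving m) + lower_degree (moving m) (h (m - 1))" if "1 \<le> m" "m \<le> ntri T" for m
    using slant[OF that] dv[OF that] by (simp add: inM)
  have N: "lower_degree (\<not> moving m) (h m) = code_count D m (moving m) (\<not> moving m)" if "1 \<le> m" "m \<le> ntri T" for m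
    using dv[OF that] zero(1)[of m] by (simp add: inM)
  have "h (ntri T) = Some (\<not> moving (ntri T))"
    using N[OF n(1)] zero(3) lower_degree_eq_iff[of "\<not> moving (ntri T)" "h (ntri T)" "Some (\<not> moving (ntri T))"] by simp
  moreover have "h 0 = Some (moving 1)" by (simp add: h_def)
  ultimately have leg: "legal_fun h" unfolding legal_fun_def using M by auto
  have "count D e = count (cover h) e" for e
  proof (cases "e \<in> snake_edges T")
    case True
    then obtain m s s' where c: "e = grid_edge (m, s, s')" "(m, s, s') \<in> codes"
      unfolding snake_edges_code by auto
    then have m: "1 \<le> m" "m \<le> ntri T" "s = moving m \<or> s' = moving m" by (auto simp: codes_iff)
    have "count D e = code_count D m s s'" using c by (simp add: code_count_def)
    also have "\<dots> = state_mult h (m, s, s')"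
    proof (cases "s = moving m")
      case s: True
      show ?thesis
      proof (cases "s' = moving m")
        case True
        then show ?thesis using s M[OF m(1,2)] by (simp add: state_mult_def)
      next
        case False
        then have "s' = (\<not> moving m)" by auto
        then show ?thesis using s N[OF m(1,2)] by (simp add: state_mult_def)
      qed
    next
      case False
      then have "s = (\<not> moving m)" "s' = moving m" using m by auto
      then show ?thesis using slant[OF m(1,2)] by (simp add: state_mult_def)
    qed
    also have "\<dots> = count (cover h) e" unfolding c(1) count_cover[OF c(2)] by (rule refl)
    finally show ?thesis .
  next
    case False
    then have "e \<notin># D" "e \<notin># cover h" using sub set_cover[of h] by auto
    then show ?thesis by (simp add: not_in_iff)
  qed
  then have "D = cover h" by (rule multiset_eqI)
  with leg show thesis by (rule that)
qed

lemma legal_fun_iff: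
  "legal 0 (Some (moving 1)) hs \<longleftrightarrow> length hs = ntri T \<and> legal_fun (\<lambda>k. (Some (moving 1) # hs) ! k)"
proof -
  have "(\<forall>m. 1 \<le> m \<and> m \<le> ntri T \<longrightarrow> P m) \<longleftrightarrow> (\<forall>i<ntri T. P (Suc i))" for P
    by (metis Suc_le_eq Suc_pred le_add1 less_eq_Suc_le plus_1_eq_Suc zero_less_one order_less_le_trans)
  then show ?thesis unfolding legal_iff legal_fun_def by (auto simp: trans_ok_lower_degree)
qed

lemma cover_bij:
  "bij_betw (\<lambda>hs. cover (\<lambda>k. (Some (moving 1) # hs) ! k)) {hs. legal 0 (Some (moving 1)) hs} (double_dimers T)"
proof (rule bij_betw_imageI)
  note leg = legal_fun_iff
  show "inj_on (\<lambda>hs. cover (\<lambda>k. (Some (moving 1) # hs) ! k)) {hs. legal 0 (Some (moving 1)) hs}"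
  proof (rule inj_onI)
    fix hs hs' assume *: "hs \<in> {hs. legal 0 (Some (moving 1)) hs}" "hs' \<in> {hs. legal 0 (Some (moving 1)) hs}"
      "cover (\<lambda>k. (Some (moving 1) # hs) ! k) = cover (\<lambda>k. (Some (moving 1) # hs') ! k)"
    then have l: "legal_fun (\<lambda>k. (Some (moving 1) # hs) ! k)" "legal_fun (\<lambda>k. (Some (moving 1) # hs') ! k)"
      "length hs = ntri T" "length hs' = ntri T" using leg by blast+
    have "hs ! i = hs' ! i" if "i < ntri T" for i
      using cover_inj[OF l(1,2) *(3), of "Suc i"] that by simp
    then show "hs = hs'" using l by (intro nth_equalityI) auto
  qed
  show "(\<lambda>hs. cover (\<lambda>k. (Some (moving 1) # hs) ! k)) ` {hs. legal 0 (Some (moving 1)) hs} = double_dimers T"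
  proof (intro equalityI subsetI)
    fix D assume "D \<in> double_dimers T"
    then obtain h where h: "legal_fun h" "D = cover h" by (rule double_dimer_cover)
    define hs where "hs = map h [1..<Suc (ntri T)]"
    have hs: "(Some (moving 1) # hs) ! k = h k" if "k \<le> ntri T" for k
      using h(1) that by (cases k) (auto simp: hs_def legal_fun_def simp del: upt_Suc)
    have "legal_fun (\<lambda>k. (Some (moving 1) # hs) ! k)" "cover (\<lambda>k. (Some (moving 1) # hs) ! k) = cover h"
      using h(1) states_cong[of "\<lambda>k. (Some (moving 1) # hs) ! k" h] hs by blast+
    moreover have "length hs = ntri T" by (simp add: hs_def)
    ultimately show "D \<in> (\<lambda>hs. cover (\<lambda>k. (Some (moving 1) # hs) ! k)) ` {hs. legal 0 (Some (moving 1)) hs}"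
      using h(2) by (intro image_eqI[of _ _ hs]) (simp_all only: leg mem_Collect_eq)
  qed (use cover_double_dimer leg in blast)
qed

end

section \<open>Comparing the weights\<close>

lemma even_prod_replicate:
  fixes f :: "'b \<Rightarrow> 'c::comm_monoid_mult"
  assumes "finite A"
  shows "prod_mset (image_mset f (\<Sum>c\<in>A. replicate_mset (k c) (E c))) = (\<Prod>c\<in>A. f (E c) ^ k c)"
  using assms by (induction A) auto

lemma var_pow_0 [simp]: "var_pow e 0 = 1"
  by (simp add: var_pow_def)

lemma var_pow_add: "var_pow e q * var_pow e r = var_pow e (q + r)"
  by (simp add: even_mono_simps flip: single_add)

lemma var_pow_power: "var_pow e q ^ k = var_pow e (of_nat k * q)"
  by (induction k) (simp_all add: var_pow_add algebra_simps)

lemma unit_inv_eq: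
  assumes "u * v = (1 :: 'a :: comm_ring_1)"
  shows "unit_inv u = v"
  unfolding unit_inv_def
proof (rule the_equality)
  show "w = v" if "u * w = 1" for w
  proof -
    have "w = (u * v) * w" using assms by simp
    also have "\<dots> = (u * w) * v" by (simp only: mult_ac)
    finally show ?thesis using that by simp
  qed
qed (rule assms)

lemma gscale_gscale: "gscale a (gscale b z) = gscale (a * b) z"
  by transfer (simp add: mult.assoc)

text \<open>
  Every maximal run of \<open>N\<close> contributes its first index and the index after its last one, and these
  are exactly the indices where \<open>N\<close> changes.
\<close>

lemma sum_runs:
  fixes N :: "nat \<Rightarrow> bool"
  assumes "\<not> N 0" "\<not> N n"
  shows "(\<Sum>(s, t)\<in>{(s, t). 1 \<le> s \<and> s \<le> t \<and> t < n \<and> (\<forall>m\<in>{s..t}. N m) \<and> \<not> N (s - 1) \<and> \<not> N (t + 1)}. {#s, t + 1#}) =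
    (\<Sum>m\<in>{1..n}. if N (m - 1) = N m then {#} else {#m#})"
proof -
  define R where "R = {(s, t). 1 \<le> s \<and> s \<le> t \<and> t < n \<and> (\<forall>m\<in>{s..t}. N m) \<and> \<not> N (s - 1) \<and> \<not> N (t + 1)}"
  define A where "A = {m\<in>{1..n}. \<not> N (m - 1) \<and> N m}"
  define B where "B = {m\<in>{1..n}. N (m - 1) \<and> \<not> N m}"
  have run: "\<forall>m\<in>{s..t}. N m" "\<not> N (s - 1)" "\<not> N (t + 1)" "1 \<le> s" "s \<le> t" if "(s, t) \<in> R" for s t
    using that by (simp_all add: R_def)
  have ends: "\<not> t < t'" if "(s, t) \<in> R" "(s, t') \<in> R" for s t t'
  proof
    assume "t < t'"
    then have "t + 1 \<in> {s..t'}" using run(5)[OF that(1)] by simp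
    then show False using run(1)[OF that(2)] run(3)[OF that(1)] by blast
  qed
  have starts: "\<not> s < s'" if "(s, t) \<in> R" "(s', t) \<in> R" for s s' t
  proof
    assume "s < s'"
    then have "s' - 1 \<in> {s..t}" using run(5)[OF that(2)] by auto
    then show False using run(1)[OF that(1)] run(2)[OF that(2)] by blast
  qed
  have same: "s = s' \<and> t = t'" if "(s, t) \<in> R" "(s', t') \<in> R" "s = s' \<or> t = t'" for s t s' t'
  proof (cases "s = s'")
    case True
    then show ?thesis using ends[of s t t'] ends[of s t' t] that(1,2) by simp
  next
    case False
    then have "t = t'" using that(3) by simp
    then show ?thesis using starts[of s t s'] starts[of s' t s] that(1,2) False by simp
  qed
  have inj1: "inj_on fst R"
  proof (rule inj_onI)
    fix r r' assume r: "r \<in> R" "r' \<in> R" "fst r = fst r'"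
    obtain s t s' t' where st: "r = (s, t)" "r' = (s', t')" by fastforce
    have "s = s' \<and> t = t'" by (rule same) (use r st in simp_all)
    then show "r = r'" using st by simp
  qed
  have inj2: "inj_on (\<lambda>(s, t). t + 1) R"
  proof (rule inj_onI)
    fix r r' assume r: "r \<in> R" "r' \<in> R" "(case r of (s, t) \<Rightarrow> t + 1) = (case r' of (s, t) \<Rightarrow> t + 1)"
    obtain s t s' t' where st: "r = (s, t)" "r' = (s', t')" by fastforce
    have "s = s' \<and> t = t'" by (rule same) (use r st in simp_all)
    then show "r = r'" using st by simp
  qed
  have fstR: "fst ` R = A"
  proof (intro equalityI subsetI)
    fix m assume m: "m \<in> A"
    define k where "k = (LEAST k. m \<le> k \<and> \<not> N k)"
    have n: "m \<le> n \<and> \<not> N n" using m assms by (auto simp: A_def)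
    have k: "m \<le> k \<and> \<not> N k" unfolding k_def by (rule LeastI) (rule n)
    have "k \<le> n" unfolding k_def by (rule Least_le) (rule n)
    moreover have "N j" if "m \<le> j" "j < k" for j
      using not_less_Least[of j "\<lambda>k. m \<le> k \<and> \<not> N k"] that by (auto simp: k_def)
    moreover have "m \<noteq> k" using k m by (auto simp: A_def)
    ultimately have "(m, k - 1) \<in> R" using k m by (auto simp: R_def A_def)
    then show "m \<in> fst ` R" by force
  qed (auto simp: R_def A_def)
  have sndR: "(\<lambda>(s, t). t + 1) ` R = B"
  proof (intro equalityI subsetI)
    fix m assume m: "m \<in> B"
    define k where "k = Max {k. k \<le> m - 1 \<and> \<not> N k}"
    have fin: "finite {k. k \<le> m - 1 \<and> \<not> N k}" by simp
    moreover have "{k. k \<le> m - 1 \<and> \<not> N k} \<noteq> {}" using assms(1) by auto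
    ultimately have k: "k \<le> m - 1" "\<not> N k" using Max_in unfolding k_def by blast+
    have "N j" if "k < j" "j \<le> m - 1" for j
    proof (rule ccontr)
      assume "\<not> N j"
      then have "j \<le> k" unfolding k_def using that(2) by (intro Max_ge fin) simp
      then show False using that(1) by simp
    qed
    moreover have "k \<noteq> m - 1" "m - 1 \<noteq> 0" using k m assms by (auto simp: B_def)
    ultimately have "(Suc k, m - 1) \<in> R" using k m by (auto simp: R_def B_def)
    moreover have "m - 1 + 1 = m" using m by (auto simp: B_def)
    ultimately show "m \<in> (\<lambda>(s, t). t + 1) ` R" by force
  qed (auto simp: R_def B_def)
  have "(\<Sum>(s, t)\<in>R. {#s, t + 1#}) = (\<Sum>r\<in>R. {#fst r#}) + (\<Sum>r\<in>R. {#case r of (s, t) \<Rightarrow> t + 1#})"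
    unfolding sum.distrib[symmetric] by (rule sum.cong) auto
  also have "(\<Sum>r\<in>R. {#fst r#}) = (\<Sum>m\<in>A. {#m#})"
    unfolding fstR[symmetric] by (simp only: sum.reindex[OF inj1] o_def)
  also have "(\<Sum>r\<in>R. {#case r of (s, t) \<Rightarrow> t + 1#}) = (\<Sum>m\<in>B. {#m#})"
    unfolding sndR[symmetric] by (simp only: sum.reindex[OF inj2] o_def)
  also have "(\<Sum>m\<in>A. {#m#}) + (\<Sum>m\<in>B. {#m#}) = (\<Sum>m\<in>{1..n}. if N (m - 1) = N m then {#} else {#m#})"
    unfolding A_def B_def sum.inter_filter[OF finite_atLeastAtMost] sum.distrib[symmetric]
    by (rule sum.cong) auto
  finally show ?thesis unfolding R_def .
qed

context arc_skeleton
begin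

lemma states_even_prod:
  "states_even m s hs = (\<Prod>i<length hs. tri_wt (Suc (m + i)) ((s # hs) ! i) (hs ! i)) * var_pow (spoke (m + length hs)) (1/2)"
proof (induction hs arbitrary: m s)
  case (Cons s' hs)
  show ?case
    unfolding states_even.simps Cons.IH
    by (simp add: prod.lessThan_Suc_shift mult.assoc del: prod.lessThan_Suc)
qed simp

lemma states_odd_sum:
  "states_odd m s hs = (\<Sum>i<length hs. if ((s # hs) ! i = None) = (hs ! i = None) then {#} else {#Suc (m + i)#})"
proof (induction hs arbitrary: m s)
  case (Cons s' hs)
  have shift: "Suc m + i = m + Suc i" for i by simp
  show ?case
    unfolding states_odd.simps Cons.IH shift
    by (cases s; cases s') (simp_all add: sum.lessThan_Suc_shift del: sum.lessThan_Suc)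
qed simp

text \<open>
  The halves of \<open>x\<^sub>m\<close> which two adjacent triangles contribute add up to \<open>x\<^sub>m\<close>; only one half
  remains at each end of the strip.
\<close>

lemma half_spokes:
  "1 \<le> N \<Longrightarrow> (\<Prod>m\<in>{1..N}. var_pow (spoke (m - 1)) (1/2) * var_pow (spoke m) (1/2)) =
    var_pow (spoke 0) (1/2) * (\<Prod>m\<in>{1..<N}. var_pow (spoke m) 1) * var_pow (spoke N) (1/2)"
proof (induction N rule: dec_induct)
  case (step N)
  have "(\<Prod>m\<in>{1..Suc N}. var_pow (spoke (m - 1)) (1/2) * var_pow (spoke m) (1/2)) =
      var_pow (spoke 0) (1/2) * (\<Prod>m\<in>{1..<N}. var_pow (spoke m) 1) * var_pow (spoke N) (1/2) *
      (var_pow (spoke N) (1/2) * var_pow (spoke (Suc N)) (1/2))"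
    using step.IH by simp
  also have "\<dots> = var_pow (spoke 0) (1/2) * ((\<Prod>m\<in>{1..<N}. var_pow (spoke m) 1) *
      (var_pow (spoke N) (1/2) * var_pow (spoke N) (1/2))) * var_pow (spoke (Suc N)) (1/2)"
    by (simp only: mult_ac)
  also have "var_pow (spoke N) (1/2) * var_pow (spoke N) (1/2) = var_pow (spoke N) 1"
    by (simp add: var_pow_add)
  also have "(\<Prod>m\<in>{1..<N}. var_pow (spoke m) 1) * var_pow (spoke N) 1 = (\<Prod>m\<in>{1..<Suc N}. var_pow (spoke m) 1)"
    using step.hyps by (simp add: prod.atLeastLessThan_Suc)
  finally show ?case .
qed simp

lemma triangle_weight:
  assumes "1 \<le> m" "m \<le> ntri T" "lower_degree (moving m) (h (m - 1)) \<le> lower_degree (moving m) (h m)"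
  shows "(\<Prod>s\<in>UNIV. \<Prod>s'\<in>UNIV. var_pow (code_label (m, s, s')) (of_nat (state_mult h (m, s, s')) * (1/2))) =
    tri_wt m (h (m - 1)) (h m) * (var_pow (spoke (m - 1)) (1/2) * var_pow (spoke m) (1/2))"
proof -
  have lab: "code_label (m, moving m, moving m) = rim m" "code_label (m, moving m, \<not> moving m) = spoke (m - 1)"
    "code_label (m, \<not> moving m, moving m) = spoke m"
    using vtx_stay[OF assms(1,2)] spoke_sides[of m "moving m"] spoke_sides[of "m - 1" "moving m"]
    by (auto simp: rim_def)
  have box: "(\<Prod>s\<in>UNIV. \<Prod>s'\<in>UNIV. F s s') = F (moving m) (moving m) * F (moving m) (\<not> moving m) * F (\<not> moving m) (moving m) * F (\<not> moving m) (\<not> moving m)"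
    for F :: "bool \<Rightarrow> bool \<Rightarrow> even_ring"
    by (cases "moving m") (simp_all add: UNIV_bool mult_ac)
  show ?thesis
    unfolding box lab tri_wt_def using assms(3)
    by (simp add: state_mult_def lab even_mono_simps of_nat_diff del: code_label.simps)
       (rule arg_cong[where f = even_mono], rule poly_mapping_eqI,
        simp add: lookup_add lookup_single when_def field_simps)
qed

lemma cover_even:
  assumes "legal_fun h"
  shows "(\<Prod>e\<in>#cover h. var_pow (edge_label T e) (1/2)) =
    (\<Prod>m\<in>{1..ntri T}. tri_wt m (h (m - 1)) (h m)) *
    (var_pow (spoke 0) (1/2) * cross_arc T * var_pow (spoke (ntri T)) (1/2))"
proof -
  let ?F = "\<lambda>c. var_pow (code_label c) (of_nat (state_mult h c) * (1/2))"
  have "(\<Prod>e\<in>#cover h. var_pow (edge_label T e) (1/2)) = (\<Prod>c\<in>codes. ?F c)"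
    unfolding cover_def even_prod_replicate[OF finite_codes]
    by (rule prod.cong) (auto simp: edge_label_code var_pow_power simp del: grid_edge.simps code_label.simps)
  also have "\<dots> = (\<Prod>c\<in>{1..ntri T} \<times> UNIV \<times> UNIV. ?F c)"
  proof (rule prod.mono_neutral_left)
    show "\<forall>c\<in>{1..ntri T} \<times> UNIV \<times> UNIV - codes. ?F c = 1"
    proof
      fix c assume c: "c \<in> {1..ntri T} \<times> UNIV \<times> UNIV - codes"
      obtain m s s' where mss: "c = (m, s, s')" by (metis prod_cases3)
      have "state_mult h c = 0"
        using code_count_cover[OF assms, of m s s'] c unfolding mss code_count_def by simp
      then show "?F c = 1" by simp
    qed
  qed (auto simp: codes_iff)
  also have "\<dots> = (\<Prod>m\<in>{1..ntri T}. \<Prod>s\<in>UNIV. \<Prod>s'\<in>UNIV. ?F (m, s, s'))"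
    by (simp add: prod.cartesian_product case_prod_unfold del: code_label.simps)
  also have "\<dots> = (\<Prod>m\<in>{1..ntri T}. tri_wt m (h (m - 1)) (h m) * (var_pow (spoke (m - 1)) (1/2) * var_pow (spoke m) (1/2)))"
    using assms by (intro prod.cong refl triangle_weight) (auto simp: legal_fun_def)
  also have "\<dots> = (\<Prod>m\<in>{1..ntri T}. tri_wt m (h (m - 1)) (h m)) *
      (var_pow (spoke 0) (1/2) * (\<Prod>m\<in>{1..<ntri T}. var_pow (spoke m) 1) * var_pow (spoke (ntri T)) (1/2))"
    using half_spokes[of "ntri T"] ntri_ge by (simp only: prod.distrib)
  also have "(\<Prod>m\<in>{1..<ntri T}. var_pow (spoke m) 1) = cross_arc T"
    unfolding cross_arc_def by (rule prod.cong) (auto simp: dg_spoke)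
  finally show ?thesis .
qed

lemma unit_inv_cross: "unit_inv (cross_arc T) * cross_arc T = 1"
proof -
  have 1: "cross_arc T * (\<Prod>m\<in>{1..<ntri T}. var_pow (dg T m) (-1)) = 1"
    unfolding cross_arc_def prod.distrib[symmetric] by (simp add: var_pow_add)
  show ?thesis using 1 unit_inv_eq[OF 1] by (simp add: mult.commute)
qed

lemma mem_tile_edges:
  assumes "(k, a, b) \<in> codes" "1 \<le> m" "m < ntri T"
  shows "grid_edge (k, a, b) \<in> tile_edges T m \<longleftrightarrow> (m = k \<and> a = moving k) \<or> (Suc m = k \<and> b = moving k)"
proof -
  have "range (side_code m) \<subseteq> codes" using side_code_codes assms by auto
  then have "grid_edge (k, a, b) \<in> tile_edges T m \<longleftrightarrow> (k, a, b) \<in> range (side_code m)"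
    unfolding tile_edges_code[OF assms(2,3)] by (rule inj_on_image_mem_iff[OF grid_edge_inj assms(1)])
  then show ?thesis unfolding tile_codes by (cases a; cases b) auto
qed

lemma mem_surrounding_cycle:
  assumes "(k, a, b) \<in> codes" "1 \<le> s" "t < ntri T"
  shows "grid_edge (k, a, b) \<in> surrounding_cycle T s t \<longleftrightarrow>
    (k \<in> {s..t} \<and> a = moving k) \<noteq> (k - 1 \<in> {s..t} \<and> b = moving k)"
proof -
  have k: "1 \<le> k" using assms by (simp add: codes_iff)
  have "(m \<in> {s..t} \<and> grid_edge (k, a, b) \<in> tile_edges T m) \<longleftrightarrow>
      m = k \<and> k \<in> {s..t} \<and> a = moving k \<or> m = k - 1 \<and> k - 1 \<in> {s..t} \<and> b = moving k" for m
    using mem_tile_edges[OF assms(1), of m] assms k by auto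
  then have "grid_edge (k, a, b) \<in> surrounding_cycle T s t \<longleftrightarrow>
      (\<exists>!m. m = k \<and> (k \<in> {s..t} \<and> a = moving k) \<or> m = k - 1 \<and> (k - 1 \<in> {s..t} \<and> b = moving k))"
    unfolding surrounding_cycle_def mem_Collect_eq by (simp only: conj_assoc)
  also have "\<dots> \<longleftrightarrow> (k \<in> {s..t} \<and> a = moving k) \<noteq> (k - 1 \<in> {s..t} \<and> b = moving k)"
  proof -
    have "(\<exists>!m. m = i \<and> P \<or> m = j \<and> Q) \<longleftrightarrow> P \<noteq> Q" if "i \<noteq> j" for i j :: nat and P Q
      using that by (cases P; cases Q) auto
    then show ?thesis using k by simp
  qed
  finally show ?thesis .
qed

lemma surrounding_cycle_codes:
  assumes "1 \<le> s" "t < ntri T" "e \<in> surrounding_cycle T s t"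
  obtains k a b where "e = grid_edge (k, a, b)" "(k, a, b) \<in> codes"
proof -
  obtain m where "m \<in> {s..t}" "e \<in> tile_edges T m"
    using assms(3) by (auto simp: surrounding_cycle_def)
  then have "e \<in> snake_edges T" using assms(1,2) by (auto simp: snake_edges_def)
  then show thesis using that by (auto simp: snake_edges_code)
qed

text \<open>
  The cycle around a run of tiles contains, for each tile, an edge whose multiplicity depends only
  on the state of this tile and is \<open>1\<close> only for \<open>None\<close>. The two edges which close the cycle have
  as multiplicity the difference of the lower degrees on their two levels, so they require the
  state beyond to be different from \<open>None\<close>.
\<close>

lemma cover_cycles:
  assumes "legal_fun h"
  shows "dimer_cycles T (cover h) = {(s, t). 1 \<le> s \<and> s \<le> t \<and> t < ntri T \<and>
    (\<forall>m\<in>{s..t}. h m = None) \<and> h (s - 1) \<noteq> None \<and> h (t + 1) \<noteq> None}"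
proof -
  have mono: "lower_degree (moving m) (h (m - 1)) \<le> lower_degree (moving m) (h m)" if "1 \<le> m" "m \<le> ntri T" for m
    using assms that by (auto simp: legal_fun_def)
  have "(\<forall>e\<in>surrounding_cycle T s t. count (cover h) e = 1) \<longleftrightarrow>
      (\<forall>m\<in>{s..t}. h m = None) \<and> h (s - 1) \<noteq> None \<and> h (t + 1) \<noteq> None"
    if st: "1 \<le> s" "s \<le> t" "t < ntri T" for s t
  proof
    assume cnt: "\<forall>e\<in>surrounding_cycle T s t. count (cover h) e = 1"
    have *: "state_mult h (k, a, b) = 1" if "(k, a, b) \<in> codes"
      "(k \<in> {s..t} \<and> a = moving k) \<noteq> (k - 1 \<in> {s..t} \<and> b = moving k)" for k a b
      using cnt mem_surrounding_cycle[OF that(1) st(1,3)] that(2) count_cover[OF that(1), of h]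
      by (auto simp del: grid_edge.simps)
    have N: "h m = None" if "m \<in> {s..t}" for m
      using *[of m "moving m" "\<not> moving m"] that st lower_degree_1[of "\<not> moving m" "h m"]
      by (auto simp: codes_iff state_mult_def)
    have "h (s - 1) \<noteq> None"
    proof
      assume "h (s - 1) = None"
      moreover have "h s = None" "s - 1 \<notin> {s..t}" using N st by auto
      ultimately show False using *[of s "moving s" "moving s"] st by (auto simp: codes_iff state_mult_def)
    qed
    moreover have "h (t + 1) \<noteq> None"
    proof
      assume "h (t + 1) = None"
      moreover have "h t = None" using N st by simp
      ultimately show False
        using *[of "t + 1" "moving (t + 1)" "moving (t + 1)"] st by (auto simp: codes_iff state_mult_def)
    qed
    ultimately show "(\<forall>m\<in>{s..t}. h m = None) \<and> h (s - 1) \<noteq> None \<and> h (t + 1) \<noteq> None"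
      using N by blast
  next
    assume N: "(\<forall>m\<in>{s..t}. h m = None) \<and> h (s - 1) \<noteq> None \<and> h (t + 1) \<noteq> None"
    show "\<forall>e\<in>surrounding_cycle T s t. count (cover h) e = 1"
    proof
      fix e assume e: "e \<in> surrounding_cycle T s t"
      obtain k a b where c: "e = grid_edge (k, a, b)" "(k, a, b) \<in> codes"
        by (rule surrounding_cycle_codes[OF st(1,3) e])
      have k: "1 \<le> k" "k \<le> ntri T" "a = moving k \<or> b = moving k" using c(2) by (auto simp: codes_iff)
      have one: "(k \<in> {s..t} \<and> a = moving k) \<noteq> (k - 1 \<in> {s..t} \<and> b = moving k)"
        using e mem_surrounding_cycle[OF c(2) st(1,3)] unfolding c(1) by blast
      have "state_mult h (k, a, b) = 1"
      proof (cases "a = moving k \<and> b = moving k")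
        case True
        then have "k = s \<or> k = t + 1" using one st k by auto
        then show ?thesis
        proof
          assume ks: "k = s"
          then have "h k = None" "lower_degree (moving k) (h (k - 1)) \<noteq> 1" "lower_degree (moving k) (h (k - 1)) \<le> 1"
            using N st mono[OF k(1,2)] lower_degree_1[of "moving k" "h (k - 1)"] by auto
          then show ?thesis using True by (simp add: state_mult_def)
        next
          assume kt: "k = t + 1"
          then have "h (k - 1) = None" "lower_degree (moving k) (h k) \<noteq> 1" "1 \<le> lower_degree (moving k) (h k)"
            using N st mono[OF k(1,2)] lower_degree_1[of "moving k" "h k"] by auto
          moreover have "lower_degree (moving k) (h k) \<le> 2" by (rule lower_degree_le)
          ultimately show ?thesis using True by (simp add: state_mult_def)
        qed
      next
        case False
        then show ?thesis
          using one k(3) N by (cases "a = moving k") (simp_all add: state_mult_def)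
      qed
      then show "count (cover h) e = 1" unfolding c(1) count_cover[OF c(2)] .
    qed
  qed
  then show ?thesis unfolding dimer_cycles_def by auto
qed

lemma weights_agree:
  assumes "legal 0 (Some (moving 1)) hs"
  shows "twt T (path_of T (path_steps 0 (AtV (moving 1) True) hs)) =
    gscale (unit_inv (cross_arc T)) (dimer_wt T (cover (\<lambda>k. (Some (moving 1) # hs) ! k)))"
proof -
  define h where "h = (\<lambda>k. (Some (moving 1) # hs) ! k)"
  have leg: "legal_fun h" and len: "length hs = ntri T"
    using assms unfolding h_def legal_fun_iff by auto
  have legP: "legal 0 (port_state (AtV (moving 1) True)) hs" using assms by simp
  have ev: "path_even T True (map fst (path_steps 0 (AtV (moving 1) True) hs)) =
      var_pow (spoke 0) (1/2) * ((\<Prod>m\<in>{1..ntri T}. tri_wt m (h (m - 1)) (h m)) * var_pow (spoke (ntri T)) (1/2))"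
    using path_steps_even[OF legP] len unfolding states_even_prod
    by (simp add: h_def prod.atLeast1_atMost_eq)
  have od: "sum_list (map twt_odd (map fst (path_steps 0 (AtV (moving 1) True) hs))) =
      (\<Sum>m\<in>{1..ntri T}. if (h (m - 1) = None) = (h m = None) then {#} else {#m#})"
    using path_steps_odd[OF legP] len unfolding states_odd_sum add_0
    by (simp add: h_def sum.atLeast1_atMost_eq)
  have "(\<Sum>(s, t)\<in>dimer_cycles T (cover h). {#s, t + 1#}) =
      (\<Sum>m\<in>{1..ntri T}. if (h (m - 1) = None) = (h m = None) then {#} else {#m#})"
    unfolding cover_cycles[OF leg] by (rule sum_runs) (use leg in \<open>auto simp: legal_fun_def\<close>)
  moreover have "unit_inv (cross_arc T) * (\<Prod>e\<in>#cover h. var_pow (edge_label T e) (1/2)) =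
      path_even T True (map fst (path_steps 0 (AtV (moving 1) True) hs))"
  proof -
    have "unit_inv (cross_arc T) * (W * (a * cross_arc T * b)) = (unit_inv (cross_arc T) * cross_arc T) * (a * (W * b))"
      for W a b by (simp only: mult_ac)
    then show ?thesis unfolding cover_even[OF leg] ev unit_inv_cross by simp
  qed
  ultimately show ?thesis
    unfolding twt_path_of od dimer_wt_def gscale_gscale h_def[symmetric] by simp
qed

end

section \<open>The bijection\<close>

theorem theorem7p8:
  fixes T :: arc_triangulation
  assumes "longest_arc_triangulation T"
  shows "\<exists>\<phi>. bij_betw \<phi> (twisted_paths T) (double_dimers T) \<and>
    (\<forall>t\<in>twisted_paths T. twt T t = gscale (unit_inv (cross_arc T)) (dimer_wt T (\<phi> t)))"
proof -
  interpret arc_skeleton T "moving_side T" "side_vertex T"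
    by (rule skeleton[OF assms])
  let ?H = "{hs. legal 0 (Some (moving_side T 1)) hs}"
  define path where "path = path_of T \<circ> path_steps 0 (AtV (moving_side T 1) True)"
  define dimers where "dimers hs = cover (\<lambda>k. (Some (moving_side T 1) # hs) ! k)" for hs
  have path: "bij_betw path ?H (twisted_paths T)"
    unfolding path_def by (rule bij_betw_trans[OF path_steps_bij path_of_bij])
  have dimers: "bij_betw dimers ?H (double_dimers T)"
    unfolding dimers_def by (rule cover_bij)
  define \<phi> where "\<phi> = dimers \<circ> inv_into ?H path"
  have "bij_betw \<phi> (twisted_paths T) (double_dimers T)"
    unfolding \<phi>_def by (rule bij_betw_trans[OF bij_betw_inv_into[OF path] dimers])
  moreover have "twt T t = gscale (unit_inv (cross_arc T)) (dimer_wt T (\<phi> t))" if t: "t \<in> twisted_paths T" for t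
  proof -
    have hs: "inv_into ?H path t \<in> ?H" "path (inv_into ?H path t) = t"
    proof -
      have "t \<in> path ` ?H" using path t by (simp add: bij_betw_def)
      then show "inv_into ?H path t \<in> ?H" "path (inv_into ?H path t) = t"
        by (rule inv_into_into, rule f_inv_into_f)
    qed
    show ?thesis
      using weights_agree[of "inv_into ?H path t"] hs by (simp add: \<phi>_def dimers_def path_def)
  qed
  ultimately show ?thesis by blast
qed

end
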